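(* The finite and semi-finite Hilbert transformations, as well as the Wiener-Hopf operators $W_\kappa$ for $\kappa(x)=-\tanh\big(\frac{ax+b}{cx+d}\big)$ with $a,b,c,d\in\mathbb{R}$, $ad-bc=1$, are Hilbert space isomorphic to $2K-I$. More precisely: (1) For $-\infty\le a<b\le\infty$, not both infinite, $H_{[a,b]}=\Lambda\,(2K-I)\,\Lambda^{-1}$, where $\Lambda=\Gamma_{a,b}\,F'_B$ with $B=\frac1{\sqrt2}\begin{pmatrix}1&-1\\1&1\end{pmatrix}$, and $\Gamma_{a,b}:L^2(0,\infty)\to L^2(a,b)$ is the Hilbert space isomorphism $(\Gamma_{a,b}g)(t)=\sqrt{|\gamma'(t)|}\,g(\gamma(t))$ due to the change of variable $\gamma(t)=\frac{t-a}{-t+b}$ if $a,b$ are finite, $\gamma(t)=t-a$ if $b=\infty$, $\gamma(t)=\frac1{-t+b}$ if $a=-\infty$. (2) For $A=\begin{pmatrix}a&b\\c&d\end{pmatrix}\in SL(2,\mathbb{R})$ and $\kappa(x)=-\tanh\big(\frac{ax+b}{cx+d}\big)$, $W_\kappa=\Lambda'\,(2K-I)\,\Lambda'^{-1}$, where $\Lambda'=F_A'^{-1}\,\Gamma^{-1}\,\Lambda$ with $\Gamma:L^2(\mathbb{R}_+)\to L^2(0,1)$, $(\Gamma g)(t)=(\pi t)^{-1/2}g\big(-\frac1\pi\ln t\big)$, and $\Lambda:L^2(\mathbb{R}_+)\to L^2(0,1)$ the isomorphism from (1) relating $H_{[0,1]}$ to $2K-I$.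
   Context: $\mathbb{R}_+=\{x>0\}$. $K$ is the operator on $L^2(\mathbb{R}_+)$ given by $(Kg)(x)=\int_0^\infty\frac1\pi\operatorname{sinc}(x-y)g(y)\,dy$, with $\operatorname{sinc}(x)=\frac{\sin x}{x}$ for $x\neq 0$, $\operatorname{sinc}(0)=1$; $I$ is the identity. The (finite or semi-finite) Hilbert transformation on $L^2(a,b)$ is $(H_{[a,b]}g)(x)=\frac1{i\pi}\int_a^b\frac{g(y)}{y-x}\,dy$ (principal value at $x$), where for $a=-\infty$ or $b=\infty$ the interval is $]-\infty,b]$ or $[a,\infty[$. $\mathcal{F}$ is the unitary Fourier transformation on $L^2(\mathbb{R})$ with $\mathcal{F}f(x)=(2\pi)^{-1/2}\int e^{-ixy}f(y)\,dy$ for $f\in L^1\cap L^2$. $P_+:L^2(\mathbb{R})\to L^2(\mathbb{R}_+)$ is restriction, $P_+^*$ is extension by zero. For $\kappa\in L^\infty(\mathbb{R})$, $M(\kappa)$ is multiplication by $\kappa$ on $L^2(\mathbb{R})$ and $W_\kappa=P_+\mathcal{F}M(\kappa)\mathcal{F}^{-1}P_+^*$ is the Wiener-Hopf operator with symbol $\kappa$. For $A=\begin{pmatrix}a&b\\c&d\end{pmatrix}\in SL(2,\mathbb{R})$, $A\cdot x=\frac{ax+b}{cx+d}$, $(F_Af)(x)=\frac1{-cx+a}f(A^{-1}\cdot x)$ on $L^2(\mathbb{R})$, and $F'_A=P_+\mathcal{F}F_A\mathcal{F}^{-1}P_+^*$, which is unitary on $L^2(\mathbb{R}_+)$.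
   Formalization: The formula in (2) is false by a sign: the formal statement has W_{-κ} = Λ'(2K-I)Λ'^{-1} for the given Λ', and for κ = -tanh(A·x) itself W_κ = L(2K-I)L^{-1} with L = F_A'^{-1} Γ^{-1} R Λ, where (Rf)(t) = f(1-t) on L^2(0,1). *)

theory Defs
  imports "HOL-Analysis.Analysis" "HOL-Probability.Sinc_Integral"
begin

section \<open>The Hilbert spaces $L^2(S)$ for $S$ a Borel set of reals\<close>

text \<open>Elements are classes of complex-valued functions modulo equality almost everywhere. Since
  every Lebesgue measurable function agrees almost everywhere with a Borel function, Borel
  measurable representatives suffice. The function \<open>f\<close> in \<open>ae_class S f\<close> only has to be almost
  everywhere equal to a measurable function; otherwise the class is empty.\<close>

definition leb :: "real set \<Rightarrow> real measure" where
  "leb S = restrict_space lborel S"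

type_synonym fclass = "(real \<Rightarrow> complex) set"

definition ae_class :: "real set \<Rightarrow> (real \<Rightarrow> complex) \<Rightarrow> fclass" where
  "ae_class S f = {g \<in> borel_measurable (leb S). AE x in leb S. g x = f x}"

definition square_int :: "real set \<Rightarrow> (real \<Rightarrow> complex) \<Rightarrow> bool" where
  "square_int S f \<longleftrightarrow> f \<in> borel_measurable (leb S) \<and> integrable (leb S) (\<lambda>x. (cmod (f x))\<^sup>2)"

definition L2 :: "real set \<Rightarrow> fclass set" where
  "L2 S = {ae_class S f | f. square_int S f}"

definition rep :: "fclass \<Rightarrow> real \<Rightarrow> complex" where
  "rep u = (SOME f. f \<in> u)"

definition L2_add :: "real set \<Rightarrow> fclass \<Rightarrow> fclass \<Rightarrow> fclass" where
  "L2_add S u v = ae_class S (\<lambda>x. rep u x + rep v x)"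

definition L2_scale :: "real set \<Rightarrow> complex \<Rightarrow> fclass \<Rightarrow> fclass" where
  "L2_scale S z u = ae_class S (\<lambda>x. z * rep u x)"

definition L2_inner :: "real set \<Rightarrow> fclass \<Rightarrow> fclass \<Rightarrow> complex" where
  "L2_inner S u v = (LINT x|leb S. cnj (rep u x) * rep v x)"

definition hilbert_iso :: "real set \<Rightarrow> real set \<Rightarrow> (fclass \<Rightarrow> fclass) \<Rightarrow> bool" where
  "hilbert_iso S T V \<longleftrightarrow>
     bij_betw V (L2 S) (L2 T) \<and>
     (\<forall>u\<in>L2 S. \<forall>v\<in>L2 S. V (L2_add S u v) = L2_add T (V u) (V v)) \<and>
     (\<forall>z. \<forall>u\<in>L2 S. V (L2_scale S z u) = L2_scale T z (V u)) \<and>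
     (\<forall>u\<in>L2 S. \<forall>v\<in>L2 S. L2_inner T (V u) (V v) = L2_inner S u v)"

text \<open>\<open>Y = V X V\<inverse>\<close> for operators \<open>X\<close> on \<open>L2 S\<close> and \<open>Y\<close> on \<open>L2 T\<close>.\<close>

definition conjugate_via ::
    "real set \<Rightarrow> real set \<Rightarrow> (fclass \<Rightarrow> fclass) \<Rightarrow> (fclass \<Rightarrow> fclass) \<Rightarrow> (fclass \<Rightarrow> fclass) \<Rightarrow> bool" where
  "conjugate_via S T V X Y \<longleftrightarrow>
     hilbert_iso S T V \<and> X ` L2 S \<subseteq> L2 S \<and> Y ` L2 T \<subseteq> L2 T \<and>
     (\<forall>u\<in>L2 T. Y u = V (X (inv_into (L2 S) V u)))"

definition hilbert_isomorphic ::
    "real set \<Rightarrow> real set \<Rightarrow> (fclass \<Rightarrow> fclass) \<Rightarrow> (fclass \<Rightarrow> fclass) \<Rightarrow> bool" where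
  "hilbert_isomorphic S T X Y \<longleftrightarrow> (\<exists>V. conjugate_via S T V X Y)"


section \<open>The operator $2K-I$ and the Hilbert transformations\<close>

abbreviation Rplus :: "real set" where
  "Rplus \<equiv> {0<..}"

definition K_op :: "fclass \<Rightarrow> fclass" where
  "K_op u = ae_class Rplus (\<lambda>x. LINT y|leb Rplus. of_real (1 / pi * sinc (x - y)) * rep u y)"

definition twoK_minus_I :: "fclass \<Rightarrow> fclass" where
  "twoK_minus_I u = L2_add Rplus (L2_scale Rplus 2 (K_op u)) (L2_scale Rplus (-1) u)"

text \<open>The principal value is the pointwise limit of the truncated integrals. It is required to exist
  for almost every \<open>x\<close>: if it does not, the class below is empty and hence not in \<open>L2\<close>.\<close>

definition hilbert_transf :: "ereal \<Rightarrow> ereal \<Rightarrow> fclass \<Rightarrow> fclass" where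
  "hilbert_transf a b u =
     {h \<in> borel_measurable (leb (einterval a b)).
       AE x in leb (einterval a b).
         ((\<lambda>\<epsilon>. 1 / (\<i> * of_real pi) *
             (LINT y|leb {y \<in> einterval a b. \<epsilon> < \<bar>y - x\<bar>}. rep u y / of_real (y - x)))
           \<longlongrightarrow> h x) (at_right 0)}"


section \<open>Fourier transformation and Wiener-Hopf operators\<close>

text \<open>The two properties determine the operator on \<open>L2 UNIV\<close>, as the square integrable functions
  that are also integrable are dense there.\<close>

definition fourier :: "fclass \<Rightarrow> fclass" where
  "fourier = (SOME F. hilbert_iso UNIV UNIV F \<and>
     (\<forall>f. square_int UNIV f \<and> integrable lborel f \<longrightarrow>
        F (ae_class UNIV f) =
        ae_class UNIV (\<lambda>x. of_real ((2 * pi) powr (-1/2)) *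
          (LINT y|lborel. exp (- (\<i> * of_real (x * y))) * f y))))"

definition fourier_inv :: "fclass \<Rightarrow> fclass" where
  "fourier_inv = inv_into (L2 UNIV) fourier"

definition P_plus :: "fclass \<Rightarrow> fclass" where
  "P_plus u = ae_class Rplus (rep u)"

definition P_plus_adj :: "fclass \<Rightarrow> fclass" where
  "P_plus_adj u = ae_class UNIV (\<lambda>x. if x > 0 then rep u x else 0)"

definition mult_op :: "(real \<Rightarrow> complex) \<Rightarrow> fclass \<Rightarrow> fclass" where
  "mult_op \<kappa> u = ae_class UNIV (\<lambda>x. \<kappa> x * rep u x)"

definition wiener_hopf :: "(real \<Rightarrow> complex) \<Rightarrow> fclass \<Rightarrow> fclass" where
  "wiener_hopf \<kappa> = P_plus \<circ> fourier \<circ> mult_op \<kappa> \<circ> fourier_inv \<circ> P_plus_adj"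


section \<open>The action of $SL(2,R)$\<close>

text \<open>Where the denominator vanishes, at one point at most, the value of \<open>moebius A\<close> is irrelevant.\<close>

definition moebius :: "real^2^2 \<Rightarrow> real \<Rightarrow> real" where
  "moebius A x = (A$1$1 * x + A$1$2) / (A$2$1 * x + A$2$2)"

definition F_op :: "real^2^2 \<Rightarrow> fclass \<Rightarrow> fclass" where
  "F_op A u = ae_class UNIV
     (\<lambda>x. of_real (1 / (- A$2$1 * x + A$1$1)) * rep u (moebius (matrix_inv A) x))"

definition F_op' :: "real^2^2 \<Rightarrow> fclass \<Rightarrow> fclass" where
  "F_op' A = P_plus \<circ> fourier \<circ> F_op A \<circ> fourier_inv \<circ> P_plus_adj"

definition kappa :: "real^2^2 \<Rightarrow> real \<Rightarrow> complex" where
  "kappa A x = of_real (- tanh (moebius A x))"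


section \<open>The isomorphisms\<close>

definition B_mat :: "real^2^2" where
  "B_mat = (1 / sqrt 2) *\<^sub>R vector [vector [1, -1], vector [1, 1]]"

definition gamma_fun :: "ereal \<Rightarrow> ereal \<Rightarrow> real \<Rightarrow> real" where
  "gamma_fun a b t =
     (if a = -\<infinity> then 1 / (- t + real_of_ereal b)
      else if b = \<infinity> then t - real_of_ereal a
      else (t - real_of_ereal a) / (- t + real_of_ereal b))"

definition Gamma_ab :: "ereal \<Rightarrow> ereal \<Rightarrow> fclass \<Rightarrow> fclass" where
  "Gamma_ab a b u = ae_class (einterval a b)
     (\<lambda>t. of_real (sqrt \<bar>deriv (gamma_fun a b) t\<bar>) * rep u (gamma_fun a b t))"

definition Lambda :: "ereal \<Rightarrow> ereal \<Rightarrow> fclass \<Rightarrow> fclass" where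
  "Lambda a b = Gamma_ab a b \<circ> F_op' B_mat"

definition Gamma_log :: "fclass \<Rightarrow> fclass" where
  "Gamma_log u = ae_class {0<..<1}
     (\<lambda>t. of_real ((pi * t) powr (-1/2)) * rep u (- (1 / pi) * ln t))"

definition Lambda' :: "real^2^2 \<Rightarrow> fclass \<Rightarrow> fclass" where
  "Lambda' A = inv_into (L2 Rplus) (F_op' A) \<circ> inv_into (L2 Rplus) Gamma_log \<circ> Lambda 0 1"

text \<open>The change of variable in \<open>Gamma_log\<close> reverses the orientation, whereas \<open>gamma_fun\<close> preserves
  it. Hence \<open>Gamma_log\<close> carries the Hilbert transformation of $[0,1]$ to the Wiener-Hopf operator with
  symbol $+\tanh$: its kernel becomes $\frac1i\,\frac1{2\sinh(\pi(u-v)/2)}$, and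
  $\int_0^\infty \frac{\sin(ws)}{\sinh(\pi w/2)}\,dw = \tanh s$. The symbol $-\tanh$ is reached after
  inserting the reflection of $[0,1]$, which anticommutes with the Hilbert transformation.\<close>

definition reflect01 :: "fclass \<Rightarrow> fclass" where
  "reflect01 u = ae_class {0<..<1} (\<lambda>t. rep u (1 - t))"

definition Lambda'_refl :: "real^2^2 \<Rightarrow> fclass \<Rightarrow> fclass" where
  "Lambda'_refl A =
     inv_into (L2 Rplus) (F_op' A) \<circ> inv_into (L2 Rplus) Gamma_log \<circ> reflect01 \<circ> Lambda 0 1"

end

(*
  On the Fourier side, 2K - I is the Wiener-Hopf operator whose symbol is the sign function of
  [-1,1]. A real Moebius transformation acts unitarily on L2(R) and preserves the Hardy space: it
  maps the functions 1/(l - it), Re l > 0, which are the inverse Fourier transforms of the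
  exponentials exp(-ly) on y > 0, to multiples of functions of the same kind, and these
  exponentials are total. Hence F'_A is unitary on L2(0,oo) and carries the symbol k to k o A^{-1},
  in particular 2K - I to the operator with symbol -sgn, which is the Hilbert transformation of
  (0,oo). For the same reason the Hilbert transformation of the line commutes with the Moebius
  action, which moves (0,oo) to an arbitrary interval.

  The principal values exist almost everywhere because the truncated kernel differs from the
  conjugate Poisson kernel by at most the Poisson kernel, and the conjugate Poisson integral of f is
  the Poisson integral of the L2 Hilbert transform of f; both converge at Lebesgue points.

  In logarithmic coordinates the Hilbert transformation of (0,oo) becomes multiplication by tanh
  on the Fourier side. It suffices to see this on the total set of the functions 1/(t + c), c > 0:
  there the principal value is elementary, it is log(t/c)/(t + c) up to a constant, and the claim
  becomes the differential equation -f' = tanh f for f = 1/cosh, the Fourier transform of the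
  hyperbolic secant.
*)
theory Submission
  imports Defs "HOL-Probability.Characteristic_Functions"
begin

section \<open>Square integrable functions on the real line\<close>

text \<open>All analysis is done with Borel functions on the whole line. A class on \<open>S\<close>
  is represented by its extension by zero, so one inner product and one Fourier transformation serve
  every interval. Operator identities become equalities almost everywhere and are mostly proved
  weakly: both sides are tested against a total family and adjoints are moved. Invariance of the
  half-lines under the Moebius action is obtained in this way too: the exponentials show it for the
  negative half-line, duality with the inverse matrix for the positive one. The Hilbert
  transformation is at first only the Fourier multiplier -sgn; its covariance is proved for the
  multiplier, and the principal value is identified with it once, on the line. A Gaussian is
  dominated by a Poisson kernel, so a single theorem on Lebesgue points yields both Plancherel's
  identity and the principal values. The sign is the delicate point: \<open>Gamma_log\<close> leads
  to +tanh. Hence \<open>Lambda'\<close> reaches the symbol \<open>- kappa A\<close>, and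
  \<open>kappa A\<close> itself is reached by \<open>Lambda'_refl\<close>.\<close>

definition L2f :: "(real \<Rightarrow> complex) \<Rightarrow> bool" where
  "L2f f \<longleftrightarrow> f \<in> borel_measurable borel \<and> integrable lborel (\<lambda>x. (cmod (f x))\<^sup>2)"

definition ip :: "(real \<Rightarrow> complex) \<Rightarrow> (real \<Rightarrow> complex) \<Rightarrow> complex" where
  "ip f g = (LINT x|lborel. cnj (f x) * g x)"

definition nsq :: "(real \<Rightarrow> complex) \<Rightarrow> real" where
  "nsq f = (LINT x|lborel. (cmod (f x))\<^sup>2)"

lemma borel_measurable_cnj [measurable (raw)]:
  assumes "f \<in> borel_measurable M"
  shows "(\<lambda>x. cnj (f x)) \<in> borel_measurable M"
  using measurable_compose[OF assms borel_measurable_continuous_onI[of cnj]]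
  by (simp add: continuous_on_cnj)

lemma L2f_measurable [measurable_dest]: "L2f f \<Longrightarrow> f \<in> borel_measurable borel"
  by (simp add: L2f_def)

lemma L2f_integrable: "L2f f \<Longrightarrow> integrable lborel (\<lambda>x. (cmod (f x))\<^sup>2)"
  by (simp add: L2f_def)

lemma L2f_bound:
  assumes [measurable]: "f \<in> borel_measurable borel"
    and "integrable lborel g" "AE x in lborel. (cmod (f x))\<^sup>2 \<le> g x"
  shows "L2f f"
  unfolding L2f_def
proof
  show "integrable lborel (\<lambda>x. (cmod (f x))\<^sup>2)"
    by (rule Bochner_Integration.integrable_bound[OF assms(2)]) (use assms(3) in \<open>auto elim!: eventually_mono\<close>)
qed (fact assms)

lemma L2f_integrable_mult:
  assumes "L2f f" "L2f g"
  shows "integrable lborel (\<lambda>x. f x * g x)"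
proof (rule Bochner_Integration.integrable_bound)
  show "integrable lborel (\<lambda>x. (cmod (f x))\<^sup>2 + (cmod (g x))\<^sup>2)"
    using assms by (intro Bochner_Integration.integrable_add L2f_integrable)
  show "(\<lambda>x. f x * g x) \<in> borel_measurable lborel"
    using assms[THEN L2f_measurable] by measurable
  show "AE x in lborel. norm (f x * g x) \<le> norm ((cmod (f x))\<^sup>2 + (cmod (g x))\<^sup>2)"
  proof (intro always_eventually allI)
    fix x
    have "2 * (cmod (f x) * cmod (g x)) \<le> (cmod (f x))\<^sup>2 + (cmod (g x))\<^sup>2"
      using sum_squares_bound[of "cmod (f x)" "cmod (g x)"] by simp
    moreover have "0 \<le> cmod (f x) * cmod (g x)" by simp
    ultimately show "norm (f x * g x) \<le> norm ((cmod (f x))\<^sup>2 + (cmod (g x))\<^sup>2)"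
      unfolding norm_mult real_norm_def by linarith
  qed
qed

lemma L2f_bounded_mult:
  assumes "L2f f" and [measurable]: "m \<in> borel_measurable borel" and "\<And>x. cmod (m x) \<le> C"
  shows "L2f (\<lambda>x. m x * f x)"
proof (rule L2f_bound)
  show "(\<lambda>x. m x * f x) \<in> borel_measurable borel"
    using assms(1)[THEN L2f_measurable] by measurable
  show "integrable lborel (\<lambda>x. C\<^sup>2 * (cmod (f x))\<^sup>2)"
    using L2f_integrable[OF assms(1)] by simp
  show "AE x in lborel. (cmod (m x * f x))\<^sup>2 \<le> C\<^sup>2 * (cmod (f x))\<^sup>2"
    using assms(3) by (auto simp: norm_mult power_mult_distrib intro!: always_eventually mult_right_mono power_mono)
qed

lemma L2f_scale: "L2f f \<Longrightarrow> L2f (\<lambda>x. c * f x)"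
  by (rule L2f_bounded_mult[where C="cmod c"]) auto

lemma L2f_uminus: "L2f f \<Longrightarrow> L2f (\<lambda>x. - f x)"
  using L2f_scale[of f "-1"] by simp

lemma L2f_indicator: "L2f f \<Longrightarrow> A \<in> sets borel \<Longrightarrow> L2f (\<lambda>x. indicator A x * f x)"
  by (rule L2f_bounded_mult[where C=1]) (auto split: split_indicator)

lemma L2f_cnj: "L2f f \<Longrightarrow> L2f (\<lambda>x. cnj (f x))"
  by (auto simp: L2f_def)

lemma cmod_add_sq_le: "(cmod (a + b))\<^sup>2 \<le> 2 * (cmod a)\<^sup>2 + 2 * (cmod b)\<^sup>2"
proof -
  have "(cmod (a + b))\<^sup>2 \<le> (cmod a + cmod b)\<^sup>2"
    by (intro power_mono norm_triangle_ineq) auto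
  also have "\<dots> \<le> 2 * (cmod a)\<^sup>2 + 2 * (cmod b)\<^sup>2"
    using sum_squares_bound[of "cmod a" "cmod b"] by (simp add: power2_sum)
  finally show ?thesis .
qed

lemma L2f_add:
  assumes "L2f f" "L2f g"
  shows "L2f (\<lambda>x. f x + g x)"
proof (rule L2f_bound)
  show "(\<lambda>x. f x + g x) \<in> borel_measurable borel"
    using assms[THEN L2f_measurable] by measurable
  show "integrable lborel (\<lambda>x. 2 * (cmod (f x))\<^sup>2 + 2 * (cmod (g x))\<^sup>2)"
    using assms[THEN L2f_integrable] by simp
  show "AE x in lborel. (cmod (f x + g x))\<^sup>2 \<le> 2 * (cmod (f x))\<^sup>2 + 2 * (cmod (g x))\<^sup>2"
    by (intro always_eventually allI cmod_add_sq_le)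
qed

lemma L2f_diff: "L2f f \<Longrightarrow> L2f g \<Longrightarrow> L2f (\<lambda>x. f x - g x)"
  using L2f_add[OF _ L2f_uminus, of f g] by simp

lemma L2f_cong_AE:
  assumes "L2f f" "g \<in> borel_measurable borel" "AE x in lborel. g x = f x"
  shows "L2f g"
  using assms(1) by (intro L2f_bound[OF assms(2) L2f_integrable[OF assms(1)]])
    (use assms(3) in \<open>auto elim!: eventually_mono\<close>)

section \<open>The inner product and the squared norm\<close>

lemma ip_integrable: "L2f f \<Longrightarrow> L2f g \<Longrightarrow> integrable lborel (\<lambda>x. cnj (f x) * g x)"
  by (intro L2f_integrable_mult L2f_cnj)

lemma ip_add_right: "L2f f \<Longrightarrow> L2f g \<Longrightarrow> L2f h \<Longrightarrow> ip f (\<lambda>x. g x + h x) = ip f g + ip f h"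
  by (simp add: ip_def distrib_left ip_integrable)

lemma ip_diff_right: "L2f f \<Longrightarrow> L2f g \<Longrightarrow> L2f h \<Longrightarrow> ip f (\<lambda>x. g x - h x) = ip f g - ip f h"
  by (simp add: ip_def right_diff_distrib ip_integrable)

lemma ip_scale_right: "ip f (\<lambda>x. c * g x) = c * ip f g"
proof -
  have "(\<lambda>x. cnj (f x) * (c * g x)) = (\<lambda>x. c * (cnj (f x) * g x))" by (auto simp: ac_simps)
  then show ?thesis by (simp add: ip_def)
qed

lemma ip_cnj: "cnj (ip f g) = ip g f"
  by (simp add: ip_def mult.commute flip: Bochner_Integration.integral_cnj)

lemma ip_add_left: "L2f f \<Longrightarrow> L2f g \<Longrightarrow> L2f h \<Longrightarrow> ip (\<lambda>x. g x + h x) f = ip g f + ip h f"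
  by (metis complex_cnj_add ip_add_right ip_cnj)

lemma ip_diff_left: "L2f f \<Longrightarrow> L2f g \<Longrightarrow> L2f h \<Longrightarrow> ip (\<lambda>x. g x - h x) f = ip g f - ip h f"
  by (metis complex_cnj_diff ip_diff_right ip_cnj)

lemma ip_scale_left: "ip (\<lambda>x. c * f x) g = cnj c * ip f g"
  by (metis complex_cnj_mult ip_scale_right ip_cnj)

lemma ip_self: "ip f f = of_real (nsq f)"
proof -
  have "(\<lambda>x. cnj (f x) * f x) = (\<lambda>x. of_real ((cmod (f x))\<^sup>2))"
    by (auto simp: mult.commute complex_norm_square[symmetric] simp flip: of_real_power)
  then show ?thesis by (simp add: ip_def nsq_def del: of_real_power)
qed

lemma ip_cong_AE:
  assumes "f \<in> borel_measurable borel" "f' \<in> borel_measurable borel"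
    "g \<in> borel_measurable borel" "g' \<in> borel_measurable borel"
    "AE x in lborel. f x = f' x" "AE x in lborel. g x = g' x"
  shows "ip f g = ip f' g'"
  unfolding ip_def using assms by (intro integral_cong_AE) auto

lemma nsq_cong_AE:
  assumes "f \<in> borel_measurable borel" "g \<in> borel_measurable borel" "AE x in lborel. f x = g x"
  shows "nsq f = nsq g"
  unfolding nsq_def using assms by (intro integral_cong_AE) auto

lemma nsq_nonneg: "nsq f \<ge> 0"
  by (simp add: nsq_def)

lemma nsq_eq_0:
  assumes "L2f f" "nsq f = 0"
  shows "AE x in lborel. f x = 0"
proof -
  have "AE x in lborel. (cmod (f x))\<^sup>2 = 0"
    using assms by (subst integral_nonneg_eq_0_iff_AE[symmetric]) (auto simp: nsq_def L2f_integrable)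
  then show ?thesis by auto
qed

lemma nn_integral_nsq:
  assumes "L2f f"
  shows "(\<integral>\<^sup>+x. ennreal ((cmod (f x))\<^sup>2) \<partial>lborel) = ennreal (nsq f)"
  using L2f_integrable[OF assms] by (simp add: nsq_def nn_integral_eq_integral)

text \<open>Nonnegative integrals presuppose no integrability: a bound obtained by Tonelli or Fatou
  is turned here into membership together with a norm estimate.\<close>

lemma L2f_nn:
  assumes [measurable]: "f \<in> borel_measurable borel"
    and "(\<integral>\<^sup>+x. ennreal ((cmod (f x))\<^sup>2) \<partial>lborel) \<le> ennreal C" "C \<ge> 0"
  shows "L2f f" "nsq f \<le> C"
proof -
  have "(\<integral>\<^sup>+x. ennreal ((cmod (f x))\<^sup>2) \<partial>lborel) < \<infinity>"
    using assms(2) by (simp add: order_le_less_trans)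
  then have "integrable lborel (\<lambda>x. (cmod (f x))\<^sup>2)"
    by (intro integrableI_bounded) auto
  then show "L2f f" by (simp add: L2f_def)
  from nn_integral_nsq[OF this] show "nsq f \<le> C"
    using assms(2,3) by simp
qed

lemma nsq_add_le:
  assumes "L2f f" "L2f g"
  shows "nsq (\<lambda>x. f x + g x) \<le> 2 * nsq f + 2 * nsq g"
proof -
  have "nsq (\<lambda>x. f x + g x) \<le> (LINT x|lborel. 2 * (cmod (f x))\<^sup>2 + 2 * (cmod (g x))\<^sup>2)"
    unfolding nsq_def using assms L2f_add[OF assms]
    by (intro integral_mono cmod_add_sq_le Bochner_Integration.integrable_add integrable_mult_right L2f_integrable)
  also have "\<dots> = 2 * nsq f + 2 * nsq g"
    using assms[THEN L2f_integrable] by (simp add: nsq_def)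
  finally show ?thesis .
qed

lemma nsq_scale: "nsq (\<lambda>x. c * f x) = (cmod c)\<^sup>2 * nsq f"
  by (simp add: nsq_def norm_mult power_mult_distrib)

lemma nsq_minus_commute: "nsq (\<lambda>x. f x - g x) = nsq (\<lambda>x. g x - f x)"
  by (simp add: nsq_def norm_minus_commute)

lemma ip_Cauchy_Schwarz:
  assumes "L2f f" "L2f g"
  shows "(cmod (ip f g))\<^sup>2 \<le> nsq f * nsq g"
proof -
  note [measurable] = assms[THEN L2f_measurable]
  have "ennreal (cmod (ip f g)) \<le> (\<integral>\<^sup>+x. ennreal (cmod (cnj (f x) * g x)) \<partial>lborel)"
    unfolding ip_def by (rule integral_norm_bound_ennreal[OF ip_integrable[OF assms]])
  also have "\<dots> = (\<integral>\<^sup>+x. ennreal (cmod (f x)) * ennreal (cmod (g x)) \<partial>lborel)"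
    by (simp add: norm_mult ennreal_mult)
  finally have "(ennreal (cmod (ip f g)))\<^sup>2 \<le> (\<integral>\<^sup>+x. ennreal (cmod (f x)) * ennreal (cmod (g x)) \<partial>lborel)\<^sup>2"
    by (intro power_mono) auto
  also have "\<dots> \<le> (\<integral>\<^sup>+x. (ennreal (cmod (f x)))\<^sup>2 \<partial>lborel) * (\<integral>\<^sup>+x. (ennreal (cmod (g x)))\<^sup>2 \<partial>lborel)"
    by (rule Cauchy_Schwarz_nn_integral) auto
  also have "\<dots> = ennreal (nsq f * nsq g)"
    using assms by (simp add: ennreal_power nn_integral_nsq ennreal_mult nsq_nonneg)
  finally show ?thesis
    by (simp add: ennreal_power nsq_nonneg)
qed

lemma ip_Cauchy_Schwarz':
  assumes "L2f f" "L2f g"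
  shows "cmod (ip f g) \<le> sqrt (nsq f) * sqrt (nsq g)"
  using ip_Cauchy_Schwarz[OF assms] by (metis real_le_rsqrt real_sqrt_mult)

lemma ip_tendsto:
  assumes "\<And>n. L2f (f n)" "\<And>n. L2f (g n)" "L2f f'" "L2f g'"
    and f: "(\<lambda>n. nsq (\<lambda>x. f n x - f' x)) \<longlonglongrightarrow> 0" and g: "(\<lambda>n. nsq (\<lambda>x. g n x - g' x)) \<longlonglongrightarrow> 0"
  shows "(\<lambda>n. ip (f n) (g n)) \<longlonglongrightarrow> ip f' g'"
proof -
  let ?f = "\<lambda>n x. f n x - f' x" and ?g = "\<lambda>n x. g n x - g' x"
  have L: "\<And>n. L2f (?f n)" "\<And>n. L2f (?g n)" using assms by (auto intro: L2f_diff)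
  have z: "(\<lambda>n. ip (u n) (v n)) \<longlonglongrightarrow> 0"
    if "\<And>n. L2f (u n)" "\<And>n. L2f (v n)" "(\<lambda>n. sqrt (nsq (u n)) * sqrt (nsq (v n))) \<longlonglongrightarrow> 0" for u v
    using that ip_Cauchy_Schwarz' by (intro Lim_null_comparison[OF _ that(3)]) auto
  \<comment> \<open>Expansion around the limits: each of the first three terms contains a difference
    that tends to 0, so Cauchy-Schwarz disposes of it.\<close>
  have eq: "ip (f n) (g n) = ip (?f n) (?g n) + ip f' (?g n) + ip (?f n) g' + ip f' g'" for n
    using assms L by (simp add: ip_diff_left ip_diff_right)
  have sf: "(\<lambda>n. sqrt (nsq (?f n))) \<longlonglongrightarrow> 0" and sg: "(\<lambda>n. sqrt (nsq (?g n))) \<longlonglongrightarrow> 0"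
    using tendsto_real_sqrt[OF f] tendsto_real_sqrt[OF g] by auto
  have "(\<lambda>n. ip (?f n) (?g n)) \<longlonglongrightarrow> 0" "(\<lambda>n. ip f' (?g n)) \<longlonglongrightarrow> 0" "(\<lambda>n. ip (?f n) g') \<longlonglongrightarrow> 0"
    using tendsto_mult[OF sf sg] tendsto_mult_left[OF sg] tendsto_mult_right[OF sf] assms L
    by (auto intro!: z)
  then have "(\<lambda>n. ip (?f n) (?g n) + ip f' (?g n) + ip (?f n) g' + ip f' g') \<longlonglongrightarrow> 0 + 0 + 0 + ip f' g'"
    by (intro tendsto_add tendsto_const)
  then show ?thesis by (simp add: eq)
qed

lemma nsq_tendsto:
  assumes "\<And>n. L2f (f n)" "L2f f'" "(\<lambda>n. nsq (\<lambda>x. f n x - f' x)) \<longlonglongrightarrow> 0"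
  shows "(\<lambda>n. nsq (f n)) \<longlonglongrightarrow> nsq f'"
  using ip_tendsto[OF assms(1,1,2,2,3,3)] by (simp add: ip_self tendsto_of_real_iff)

text \<open>The choice h = f - g makes the squared distance vanish. Identities between operators are
  reduced by this rule to identities between inner products, where adjoints are available.\<close>

lemma ip_eq_imp_AE_eq:
  assumes "L2f f" "L2f g" "\<And>h. L2f h \<Longrightarrow> ip h f = ip h g"
  shows "AE x in lborel. f x = g x"
proof -
  have "L2f (\<lambda>x. f x - g x)" using assms by (intro L2f_diff)
  then have "ip (\<lambda>x. f x - g x) (\<lambda>x. f x - g x) = 0"
    using assms by (simp add: ip_diff_right)
  then have "nsq (\<lambda>x. f x - g x) = 0" by (simp add: ip_self)
  from nsq_eq_0[OF \<open>L2f (\<lambda>x. f x - g x)\<close> this] show ?thesis by auto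
qed

lemma nsq_add:
  assumes "L2f f" "L2f g"
  shows "nsq (\<lambda>x. f x + g x) = nsq f + nsq g + 2 * Re (ip f g)"
proof -
  have "complex_of_real (nsq (\<lambda>x. f x + g x)) = ip f f + ip f g + (ip g f + ip g g)"
    using assms by (simp add: ip_self[symmetric] ip_add_left ip_add_right L2f_add)
  then have "complex_of_real (nsq (\<lambda>x. f x + g x)) = of_real (nsq f) + of_real (nsq g) + (ip f g + cnj (ip f g))"
    by (simp add: ip_self ip_cnj)
  also have "\<dots> = of_real (nsq f + nsq g + 2 * Re (ip f g))"
    by (simp add: complex_add_cnj)
  finally show ?thesis using of_real_eq_iff by blast
qed

text \<open>Polarisation. \<open>V\<close> acts on functions while its linearity holds only almost
  everywhere, so the argument is phrased with norms and inner products, which do not see null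
  sets.\<close>

lemma isometry_imp_ip:
  assumes L: "\<And>f. L2f f \<Longrightarrow> L2f (V f)"
    and add: "\<And>f g. L2f f \<Longrightarrow> L2f g \<Longrightarrow> AE x in lborel. V (\<lambda>x. f x + g x) x = V f x + V g x"
    and scale: "\<And>c f. L2f f \<Longrightarrow> AE x in lborel. V (\<lambda>x. c * f x) x = c * V f x"
    and nsq: "\<And>f. L2f f \<Longrightarrow> nsq (V f) = nsq f"
    and f: "L2f f" and g: "L2f g"
  shows "ip (V f) (V g) = ip f g"
proof -
  have re: "Re (ip (V f) (V g)) = Re (ip f g)" if g: "L2f g" for g
  proof -
    have "nsq (\<lambda>x. V f x + V g x) = nsq (V (\<lambda>x. f x + g x))"
      using add[OF f g] L[OF f] L[OF g] L[OF L2f_add[OF f g]]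
      by (intro nsq_cong_AE) (auto dest: L2f_measurable)
    then have "nsq (V f) + nsq (V g) + 2 * Re (ip (V f) (V g)) = nsq f + nsq g + 2 * Re (ip f g)"
      using nsq_add[OF L[OF f] L[OF g]] nsq_add[OF f g] nsq[OF L2f_add[OF f g]] by simp
    then show ?thesis using nsq f g by simp
  qed
  \<comment> \<open>The real part of the inner product with i g is minus the imaginary part of that
    with g.\<close>
  have "ip (V f) (V (\<lambda>x. \<i> * g x)) = ip (V f) (\<lambda>x. \<i> * V g x)"
    using scale[OF g, of \<i>] L[OF f] L[OF g] L[OF L2f_scale[OF g]]
    by (intro ip_cong_AE) (auto dest: L2f_measurable)
  with re[OF L2f_scale[OF g, of \<i>]] have "Im (ip (V f) (V g)) = Im (ip f g)"
    by (simp add: ip_scale_right)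
  with re[OF g] show ?thesis by (simp add: complex_eq_iff)
qed

section \<open>Limits in the mean: Fatou's lemma and completeness\<close>

lemma L2f_Fatou:
  assumes f: "\<And>n. L2f (f n)" and [measurable]: "g \<in> borel_measurable borel"
    and lim: "AE x in lborel. (\<lambda>n. f n x) \<longlonglongrightarrow> g x"
    and C: "eventually (\<lambda>n. nsq (f n) \<le> C) sequentially"
  shows "L2f g" "nsq g \<le> C"
proof -
  note [measurable] = f[THEN L2f_measurable]
  have "C \<ge> 0"
    using C nsq_nonneg by (metis (no_types, lifting) eventually_sequentially order_refl order_trans)
  have "(\<integral>\<^sup>+x. ennreal ((cmod (g x))\<^sup>2) \<partial>lborel) = (\<integral>\<^sup>+x. liminf (\<lambda>n. ennreal ((cmod (f n x))\<^sup>2)) \<partial>lborel)"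
  proof (intro nn_integral_cong_AE, use lim in eventually_elim)
    fix x assume "(\<lambda>n. f n x) \<longlonglongrightarrow> g x"
    then have "(\<lambda>n. ennreal ((cmod (f n x))\<^sup>2)) \<longlonglongrightarrow> ennreal ((cmod (g x))\<^sup>2)"
      by (intro tendsto_ennrealI tendsto_intros)
    from lim_imp_Liminf[OF _ this] show "ennreal ((cmod (g x))\<^sup>2) = liminf (\<lambda>n. ennreal ((cmod (f n x))\<^sup>2))"
      by simp
  qed
  also have "\<dots> \<le> liminf (\<lambda>n. \<integral>\<^sup>+x. ennreal ((cmod (f n x))\<^sup>2) \<partial>lborel)"
    by (intro nn_integral_liminf) auto
  also have "\<dots> = liminf (\<lambda>n. ennreal (nsq (f n)))"
    by (simp add: nn_integral_nsq f)
  also have "\<dots> \<le> liminf (\<lambda>n. ennreal C)"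
    using C by (intro Liminf_mono) (auto elim!: eventually_mono simp: ennreal_leI)
  finally have "(\<integral>\<^sup>+x. ennreal ((cmod (g x))\<^sup>2) \<partial>lborel) \<le> ennreal C"
    by (simp add: Liminf_const)
  from L2f_nn[OF _ this \<open>C \<ge> 0\<close>] show "L2f g" "nsq g \<le> C" by auto
qed

text \<open>Riesz-Fischer for sequences with geometric steps. Squared steps of size
  \<open>(1/4) ^ n\<close> may be weighted by \<open>2 ^ n\<close> and still have summable
  integrals; finiteness of the weighted sum at a point forces the increments there to decay like
  \<open>sqrt (1/2) ^ n\<close>, which gives pointwise convergence.\<close>

lemma L2f_complete:
  assumes L: "\<And>n. L2f (h n)" and step: "\<And>n. nsq (\<lambda>x. h (Suc n) x - h n x) \<le> (1/4) ^ n"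
  shows "\<exists>g. L2f g \<and> (\<lambda>n. nsq (\<lambda>x. h n x - g x)) \<longlonglongrightarrow> 0"
proof -
  note [measurable] = L[THEN L2f_measurable]
  define d where "d n x = h (Suc n) x - h n x" for n x
  have d: "L2f (d n)" for n unfolding d_def by (intro L2f_diff L)
  note [measurable] = d[THEN L2f_measurable]
  have "(\<integral>\<^sup>+x. (\<Sum>n. ennreal (2 ^ n * (cmod (d n x))\<^sup>2)) \<partial>lborel)
      = (\<Sum>n. \<integral>\<^sup>+x. ennreal (2 ^ n * (cmod (d n x))\<^sup>2) \<partial>lborel)"
    by (intro nn_integral_suminf) auto
  also have "\<dots> = (\<Sum>n. ennreal (2 ^ n * nsq (d n)))"
    using d by (simp add: ennreal_mult nn_integral_cmult nn_integral_nsq nsq_nonneg)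
  also have "\<dots> \<le> (\<Sum>n. ennreal ((1/2) ^ n))"
  proof (intro suminf_le ennreal_leI)
    fix n
    have "(2::real) ^ n * nsq (d n) \<le> 2 ^ n * (1/4) ^ n"
      using step[of n] by (intro mult_left_mono) (auto simp: d_def[abs_def])
    also have "\<dots> = (1/2) ^ n"
      by (simp flip: power_mult_distrib)
    finally show "(2::real) ^ n * nsq (d n) \<le> (1/2) ^ n" .
  qed auto
  also have "\<dots> = ennreal (\<Sum>n. (1/2) ^ n)"
    by (intro suminf_ennreal2) auto
  also have "\<dots> < \<infinity>" by simp
  finally have fin: "(\<integral>\<^sup>+x. (\<Sum>n. ennreal (2 ^ n * (cmod (d n x))\<^sup>2)) \<partial>lborel) < \<infinity>" .
  have "AE x in lborel. (\<Sum>n. ennreal (2 ^ n * (cmod (d n x))\<^sup>2)) \<noteq> \<infinity>"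
    using fin by (intro nn_integral_PInf_AE) auto
  then have conv: "AE x in lborel. convergent (\<lambda>n. h n x)"
  proof eventually_elim
    fix x assume "(\<Sum>n. ennreal (2 ^ n * (cmod (d n x))\<^sup>2)) \<noteq> \<infinity>"
    then have fin': "(\<Sum>n. ennreal (2 ^ n * (cmod (d n x))\<^sup>2)) < top"
      by (simp only: infinity_ennreal_def less_top[symmetric] not_False_eq_True)
    define C where "C = enn2real (\<Sum>n. ennreal (2 ^ n * (cmod (d n x))\<^sup>2))"
    have C: "C \<ge> 0" "ennreal C = (\<Sum>n. ennreal (2 ^ n * (cmod (d n x))\<^sup>2))"
      unfolding C_def by (rule enn2real_nonneg) (rule ennreal_enn2real[OF fin'])
    have bd: "cmod (d n x) \<le> sqrt C * (sqrt (1/2)) ^ n" for n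
    proof -
      define F where "F n = ennreal (2 ^ n * (cmod (d n x))\<^sup>2)" for n
      have "sum F {n} \<le> suminf F"
        by (rule sum_le_suminf) auto
      also have "\<dots> = ennreal C"
        unfolding C(2) F_def ..
      finally have "ennreal (2 ^ n * (cmod (d n x))\<^sup>2) \<le> ennreal C"
        by (simp add: F_def)
      then have "2 ^ n * (cmod (d n x))\<^sup>2 \<le> C"
        using C(1) ennreal_le_iff by blast
      then have "(cmod (d n x))\<^sup>2 \<le> C * (1/2) ^ n"
        by (simp add: field_simps power_one_over)
      then have "cmod (d n x) \<le> sqrt (C * (1/2) ^ n)"
        by (rule real_le_rsqrt)
      then show ?thesis by (simp only: real_sqrt_mult real_sqrt_power)
    qed
    have "summable (\<lambda>n. sqrt C * (sqrt (1/2)) ^ n)"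
      by (intro summable_mult summable_geometric) (auto simp: real_sqrt_divide)
    then have "summable (\<lambda>n. d n x)"
      by (rule summable_comparison_test'[where N=0]) (use bd in auto)
    then have "(\<lambda>n. h 0 x + (\<Sum>k<n. d k x)) \<longlonglongrightarrow> h 0 x + (\<Sum>k. d k x)"
      by (intro tendsto_add tendsto_const summable_LIMSEQ)
    moreover have "h 0 x + (\<Sum>k<n. d k x) = h n x" for n
      using sum_lessThan_telescope[of "\<lambda>k. h k x" n] by (simp add: d_def)
    ultimately show "convergent (\<lambda>n. h n x)" by (auto simp: convergent_def)
  qed
  define g where "g x = lim (\<lambda>n. h n x)" for x
  have [measurable]: "g \<in> borel_measurable borel"
    unfolding g_def by (rule borel_measurable_lim_metric) auto
  have lim: "AE x in lborel. (\<lambda>n. h n x) \<longlonglongrightarrow> g x"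
    using conv by eventually_elim (auto simp: g_def convergent_LIMSEQ_iff)
  \<comment> \<open>The factor 4 solves C = 2 (C/4) + 2, the recursion produced by splitting off one
    step with \<open>nsq_add_le\<close>; thus the bound does not deteriorate with
    \<open>p\<close>.\<close>
  have bd: "nsq (\<lambda>x. h (n + p) x - h n x) \<le> 4 * (1/4) ^ n" for n p
  proof (induction p arbitrary: n)
    case 0
    then show ?case by (simp add: nsq_def)
  next
    case (Suc p)
    have "nsq (\<lambda>x. (h (Suc n + p) x - h (Suc n) x) + d n x)
        \<le> 2 * nsq (\<lambda>x. h (Suc n + p) x - h (Suc n) x) + 2 * nsq (d n)"
      by (intro nsq_add_le L2f_diff L d)
    also have "\<dots> \<le> 2 * (4 * (1/4) ^ Suc n) + 2 * (1/4) ^ n"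
      using Suc.IH[of "Suc n"] step[of n] by (simp add: d_def[abs_def])
    also have "\<dots> = 4 * (1/4) ^ n" by simp
    finally show ?case by (simp add: d_def)
  qed
  have 1: "L2f (\<lambda>x. g x - h n x)" and 2: "nsq (\<lambda>x. g x - h n x) \<le> 4 * (1/4) ^ n" for n
  proof -
    have *: "AE x in lborel. (\<lambda>p. h (n + p) x - h n x) \<longlonglongrightarrow> g x - h n x"
      using lim
    proof eventually_elim
      fix x assume "(\<lambda>n. h n x) \<longlonglongrightarrow> g x"
      from LIMSEQ_ignore_initial_segment[OF this, of n]
      show "(\<lambda>p. h (n + p) x - h n x) \<longlonglongrightarrow> g x - h n x"
        by (intro tendsto_diff tendsto_const) (simp add: add.commute)
    qed
    have e: "eventually (\<lambda>p. nsq (\<lambda>x. h (n + p) x - h n x) \<le> 4 * (1/4) ^ n) sequentially"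
      using bd by simp
    have m: "(\<lambda>x. g x - h n x) \<in> borel_measurable borel" by measurable
    show "L2f (\<lambda>x. g x - h n x)" "nsq (\<lambda>x. g x - h n x) \<le> 4 * (1/4) ^ n"
      by (rule L2f_Fatou[OF L2f_diff[OF L L] m * e])+
  qed
  have "L2f (\<lambda>x. (g x - h 0 x) + h 0 x)" by (intro L2f_add 1 L)
  then have "L2f g" by simp
  moreover have "(\<lambda>n. nsq (\<lambda>x. h n x - g x)) \<longlonglongrightarrow> 0"
  proof (rule tendsto_sandwich[OF _ _ tendsto_const])
    show "(\<lambda>n. 4 * (1/4::real) ^ n) \<longlonglongrightarrow> 0"
      by (intro tendsto_mult_right_zero LIMSEQ_power_zero) auto
  qed (auto simp: nsq_nonneg nsq_minus_commute[of _ g] 2)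
  ultimately show ?thesis by auto
qed

section \<open>Lebesgue points and the Poisson kernel\<close>

text \<open>Intervals to the right of the point suffice: \<open>AE_Lebesgue_point\<close> obtains
  the left-hand averages from the function reflected at 0.\<close>

lemma AE_Lebesgue_differentiation:
  fixes \<phi> :: "real \<Rightarrow> real"
  assumes "\<And>a b. \<phi> integrable_on cbox a b"
  shows "AE x in lborel. ((\<lambda>h. integral {x..x+h} \<phi> / h) \<longlongrightarrow> \<phi> x) (at_right 0)"
proof -
  obtain N where N: "negligible N"
    "\<And>x e. x \<notin> N \<Longrightarrow> 0 < e \<Longrightarrow> \<exists>d>0. \<forall>h. 0 < h \<and> h < d \<longrightarrow>
       norm (integral (cbox x (x + h *\<^sub>R One)) \<phi> /\<^sub>R h ^ DIM(real) - \<phi> x) < e"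
    using integrable_ccontinuous_explicit[of \<phi>] assms by blast
  have "AE x in lebesgue. x \<notin> N"
    using N(1) by (simp add: negligible_iff_null_sets AE_not_in)
  then have "AE x in lborel. x \<notin> N"
    by (simp add: AE_completion_iff)
  then show ?thesis
  proof eventually_elim
    fix x assume "x \<notin> N"
    show "((\<lambda>h. integral {x..x+h} \<phi> / h) \<longlongrightarrow> \<phi> x) (at_right 0)"
      unfolding tendsto_iff eventually_at_right_field
    proof (intro allI impI)
      fix e :: real assume "0 < e"
      from N(2)[OF \<open>x \<notin> N\<close> this] show "\<exists>b>0. \<forall>y>0. y < b \<longrightarrow> dist (integral {x..x+y} \<phi> / y) (\<phi> x) < e"
        by (auto simp: dist_norm field_simps)
    qed
  qed
qed

lemma AE_lborel_uminus: "AE x::real in lborel. P x \<Longrightarrow> AE x::real in lborel. P (- x)"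
  using AE_distrD[of uminus lborel borel P] by (subst (asm) lborel_distr_uminus[symmetric]) simp

lemma L2f_local_integrable:
  assumes "L2f g"
  shows "set_integrable lborel {a..b} (\<lambda>y. cmod (g y - q))"
  unfolding set_integrable_def
proof (rule Bochner_Integration.integrable_bound)
  note [measurable] = L2f_measurable[OF assms]
  \<comment> \<open>On the interval |g - q| <= |g| + |q| <= |g|^2 + 1 + |q|, so square integrability
    provides the majorant.\<close>
  show "integrable lborel (\<lambda>y. (cmod (g y))\<^sup>2 + indicator {a..b} y *\<^sub>R (1 + cmod q))"
    by (intro Bochner_Integration.integrable_add L2f_integrable[OF assms] integrable_indicator) (auto simp: emeasure_lborel_Icc_eq)
  show "(\<lambda>y. indicator {a..b} y *\<^sub>R cmod (g y - q)) \<in> borel_measurable lborel"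
    by measurable
  show "AE y in lborel. norm (indicator {a..b} y *\<^sub>R cmod (g y - q))
      \<le> norm ((cmod (g y))\<^sup>2 + indicator {a..b} y *\<^sub>R (1 + cmod q))"
  proof (intro always_eventually allI)
    fix y
    have "cmod (g y - q) \<le> cmod (g y) + cmod q" by (rule norm_triangle_ineq4)
    moreover have "cmod (g y) \<le> (cmod (g y))\<^sup>2 + 1"
    proof -
      have "2 * cmod (g y) \<le> (cmod (g y))\<^sup>2 + 1"
        using sum_squares_bound[of "cmod (g y)" 1] by simp
      then show ?thesis using norm_ge_zero[of "g y"] by linarith
    qed
    ultimately show "norm (indicator {a..b} y *\<^sub>R cmod (g y - q))
      \<le> norm ((cmod (g y))\<^sup>2 + indicator {a..b} y *\<^sub>R (1 + cmod q))"
      by (auto split: split_indicator)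
  qed
qed

text \<open>The differentiation theorem is applied to |g - q| for q in a countable dense set, so
  that one null set works for all q; at a remaining point x, q is then taken close to g x.\<close>

lemma AE_Lebesgue_point:
  assumes "L2f g"
  shows "AE x in lborel. \<forall>\<eta>>0. \<exists>\<delta>>0. \<forall>h. 0 < h \<and> h < \<delta> \<longrightarrow>
    (LINT y|lborel. indicator {x-h..x+h} y * cmod (g y - g x)) \<le> \<eta> * h"
proof -
  obtain D :: "complex set" where D: "countable D" "\<And>X. open X \<Longrightarrow> X \<noteq> {} \<Longrightarrow> \<exists>d\<in>D. d \<in> X"
    by (rule countable_dense_setE) blast
  define \<phi> where "\<phi> q y = cmod (g y - q)" for q y
  have int: "\<phi> q integrable_on {a..b}" for q a b
    unfolding \<phi>_def using set_borel_integral_eq_integral(1)[OF L2f_local_integrable[OF assms]] .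
  have int': "(\<lambda>y. \<phi> q (- y)) integrable_on {a..b}" for q a b
    using Henstock_Kurzweil_Integration.integrable_reflect_real[where f="\<phi> q" and a="- b" and b="- a"] int by simp
  have A: "AE x in lborel. ((\<lambda>h. integral {x..x+h} (\<phi> q) / h) \<longlongrightarrow> \<phi> q x) (at_right 0)" for q
    by (rule AE_Lebesgue_differentiation) (use int in auto)
  have B: "AE x in lborel. ((\<lambda>h. integral {x-h..x} (\<phi> q) / h) \<longlongrightarrow> \<phi> q x) (at_right 0)" for q
  proof -
    have "AE x in lborel. ((\<lambda>h. integral {x..x+h} (\<lambda>y. \<phi> q (- y)) / h) \<longlongrightarrow> \<phi> q (- x)) (at_right 0)"
      by (rule AE_Lebesgue_differentiation) (use int' in auto)
    from AE_lborel_uminus[OF this]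
    have "AE x in lborel. ((\<lambda>h. integral {-x..-x+h} (\<lambda>y. \<phi> q (- y)) / h) \<longlongrightarrow> \<phi> q x) (at_right 0)"
      by simp
    moreover have "integral {-x..-x+h} (\<lambda>y. \<phi> q (- y)) = integral {x-h..x} (\<phi> q)" for x h
      using Henstock_Kurzweil_Integration.integral_reflect_real[where f="\<phi> q" and a="x-h" and b=x] by simp
    ultimately show ?thesis by simp
  qed
  have "AE x in lborel. \<forall>q\<in>D. ((\<lambda>h. integral {x..x+h} (\<phi> q) / h) \<longlongrightarrow> \<phi> q x) (at_right 0) \<and>
      ((\<lambda>h. integral {x-h..x} (\<phi> q) / h) \<longlongrightarrow> \<phi> q x) (at_right 0)"
    using D(1) A B by (simp add: AE_ball_countable)
  then show ?thesis
  proof eventually_elim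
    fix x assume x: "\<forall>q\<in>D. ((\<lambda>h. integral {x..x+h} (\<phi> q) / h) \<longlongrightarrow> \<phi> q x) (at_right 0) \<and>
      ((\<lambda>h. integral {x-h..x} (\<phi> q) / h) \<longlongrightarrow> \<phi> q x) (at_right 0)"
    show "\<forall>\<eta>>0. \<exists>\<delta>>0. \<forall>h. 0 < h \<and> h < \<delta> \<longrightarrow>
        (LINT y|lborel. indicator {x-h..x+h} y * cmod (g y - g x)) \<le> \<eta> * h"
    proof (intro allI impI)
      \<comment> \<open>With |g x - q| < \<eta>/6 the two one-sided averages of |g - q| together
        tend to less than \<eta>/3 and so fall below \<eta>/2, while replacing q by g x costs at
        most \<eta>/3.\<close>
      fix \<eta> :: real assume "\<eta> > 0"
      then obtain q where q: "q \<in> D" "q \<in> ball (g x) (\<eta> / 6)"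
        using D(2)[of "ball (g x) (\<eta> / 6)"] by auto
      then have qx: "\<phi> q x < \<eta> / 6" by (simp add: \<phi>_def dist_norm)
      have "((\<lambda>h. integral {x-h..x} (\<phi> q) / h + integral {x..x+h} (\<phi> q) / h) \<longlongrightarrow> \<phi> q x + \<phi> q x) (at_right 0)"
        using x q by (intro tendsto_add) auto
      moreover have "\<phi> q x + \<phi> q x < \<eta> / 2" using qx \<open>\<eta> > 0\<close> by simp
      ultimately have "eventually (\<lambda>h. integral {x-h..x} (\<phi> q) / h + integral {x..x+h} (\<phi> q) / h < \<eta> / 2) (at_right 0)"
        by (rule order_tendstoD(2))
      then obtain \<delta> where \<delta>: "\<delta> > 0"
        "\<And>h. 0 < h \<Longrightarrow> h < \<delta> \<Longrightarrow> integral {x-h..x} (\<phi> q) / h + integral {x..x+h} (\<phi> q) / h < \<eta> / 2"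
        unfolding eventually_at_right_field by auto
      show "\<exists>\<delta>>0. \<forall>h. 0 < h \<and> h < \<delta> \<longrightarrow>
        (LINT y|lborel. indicator {x-h..x+h} y * cmod (g y - g x)) \<le> \<eta> * h"
      proof (intro exI conjI allI impI)
        fix h assume h: "0 < h \<and> h < \<delta>"
        note int_g = L2f_local_integrable[OF assms, of "x-h" "x+h", unfolded set_integrable_def real_scaleR_def]
        have "(LINT y|lborel. indicator {x-h..x+h} y * cmod (g y - g x))
            \<le> (LINT y|lborel. indicator {x-h..x+h} y * cmod (g y - q) + indicator {x-h..x+h} y * cmod (g x - q))"
        proof (rule integral_mono)
          show "integrable lborel (\<lambda>y. indicator {x-h..x+h} y * cmod (g y - q) + indicator {x-h..x+h} y * cmod (g x - q))"
            by (intro Bochner_Integration.integrable_add int_g integrable_mult_left integrable_real_indicator)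
              (auto simp: emeasure_lborel_Icc_eq)
          fix y
          have "cmod (g y - g x) \<le> cmod (g y - q) + cmod (g x - q)"
            using norm_triangle_ineq4[of "g y - q" "g x - q"] by simp
          then show "indicator {x-h..x+h} y * cmod (g y - g x)
              \<le> indicator {x-h..x+h} y * cmod (g y - q) + indicator {x-h..x+h} y * cmod (g x - q)"
            by (auto split: split_indicator)
        qed (rule int_g)
        also have "\<dots> = (LINT y|lborel. indicator {x-h..x+h} y * cmod (g y - q)) + 2 * h * cmod (g x - q)"
          using h int_g[of q] by (subst Bochner_Integration.integral_add) auto
        also have "(LINT y|lborel. indicator {x-h..x+h} y * cmod (g y - q)) = integral {x-h..x+h} (\<phi> q)"
          using set_borel_integral_eq_integral(2)[OF L2f_local_integrable[OF assms, of "x-h" "x+h" q]]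
          by (simp add: set_lebesgue_integral_def \<phi>_def[abs_def])
        also have "\<dots> = integral {x-h..x} (\<phi> q) + integral {x..x+h} (\<phi> q)"
          using h int by (intro Henstock_Kurzweil_Integration.integral_combine[symmetric]) auto
        also have "\<dots> \<le> \<eta> / 2 * h"
          using \<delta>(2)[of h] h by (simp add: field_simps)
        also have "2 * h * cmod (g x - q) \<le> 2 * h * (\<eta> / 6)"
          using qx h unfolding \<phi>_def by (intro mult_left_mono) auto
        also have "\<eta> / 2 * h + 2 * h * (\<eta> / 6) \<le> \<eta> * h"
          using \<open>\<eta> > 0\<close> h by (simp add: field_simps)
        finally show "(LINT y|lborel. indicator {x-h..x+h} y * cmod (g y - g x)) \<le> \<eta> * h"
          by simp
      qed (fact \<open>\<delta> > 0\<close>)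
    qed
  qed
qed

section \<open>The Poisson kernel at Lebesgue points\<close>

lemma integrable_inverse_1_plus_sq: "integrable lborel (\<lambda>s::real. 1 / (1 + s\<^sup>2))"
  and integral_inverse_1_plus_sq: "(LINT s|lborel. 1 / (1 + s\<^sup>2)) = pi"
  using integrable_inverse_1_plus_square LBINT_inverse_1_plus_square
  by (simp_all add: set_integrable_def interval_lebesgue_integral_def set_lebesgue_integral_def
      inverse_eq_divide einterval_def)

text \<open>Poisson kernel of the upper half-plane at height \<open>e\<close>, without the factor
  1/pi; its total mass is therefore pi.\<close>

definition pkern :: "real \<Rightarrow> real \<Rightarrow> real" where
  "pkern e s = e / (s\<^sup>2 + e\<^sup>2)"

lemma pkern_nonneg: "e > 0 \<Longrightarrow> pkern e s \<ge> 0"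
  by (simp add: pkern_def)

lemma pkern_measurable [measurable]: "pkern e \<in> borel_measurable borel"
  unfolding pkern_def by measurable

lemma pkern_scaled: "e > 0 \<Longrightarrow> e * pkern e (e * s) = 1 / (1 + s\<^sup>2)"
proof -
  assume "e > 0"
  have "(e * s)\<^sup>2 + e\<^sup>2 = e\<^sup>2 * (1 + s\<^sup>2)" by (simp add: algebra_simps power2_eq_square)
  then show ?thesis using \<open>e > 0\<close> by (simp add: pkern_def power2_eq_square)
qed

lemma integrable_pkern: "e > 0 \<Longrightarrow> integrable lborel (\<lambda>y. pkern e (y - x))"
  and integral_pkern: "e > 0 \<Longrightarrow> (LINT y|lborel. pkern e (y - x)) = pi"
proof -
  assume "e > 0"
  have eq: "pkern e (x + e * s - x) = (1 / e) * (1 / (1 + s\<^sup>2))" for s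
    unfolding pkern_scaled[OF \<open>e > 0\<close>, of s, symmetric] using \<open>e > 0\<close> by simp
  show "integrable lborel (\<lambda>y. pkern e (y - x))"
    using \<open>e > 0\<close> integrable_inverse_1_plus_sq
    by (subst lborel_integrable_real_affine_iff[where c=e and t=x, symmetric]) (auto simp only: eq intro!: integrable_mult_right)
  show "(LINT y|lborel. pkern e (y - x)) = pi"
    using \<open>e > 0\<close> by (subst lborel_integral_real_affine[where c=e and t=x])
      (auto simp only: eq Bochner_Integration.integral_mult_right_zero integral_inverse_1_plus_sq, auto)
qed

text \<open>Away from 0 the kernel is of order \<open>e\<close>, with a majorant that is a fixed
  multiple of \<open>pkern 1\<close>. Hence the far part of a Poisson average is at most a constant
  times \<open>e\<close>.\<close>

lemma pkern_le:
  assumes "e > 0" "e \<le> 1" "d > 0" "\<bar>s\<bar> \<ge> d"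
  shows "pkern e s \<le> e * ((1 + 1 / d\<^sup>2) * (1 / (1 + s\<^sup>2)))"
proof -
  have "d\<^sup>2 \<le> s\<^sup>2" using assms by (simp add: abs_le_square_iff[symmetric])
  moreover have "d\<^sup>2 > 0" using assms by simp
  ultimately have s2: "s\<^sup>2 > 0" by linarith
  have "(1 + s\<^sup>2) \<le> (1 + 1 / d\<^sup>2) * s\<^sup>2"
    using \<open>d\<^sup>2 \<le> s\<^sup>2\<close> \<open>d\<^sup>2 > 0\<close> by (simp add: field_simps)
  then have "1 / s\<^sup>2 \<le> (1 + 1 / d\<^sup>2) * (1 / (1 + s\<^sup>2))"
    using s2 by (simp add: field_simps add_pos_pos)
  moreover have "pkern e s \<le> e * (1 / s\<^sup>2)"
    using assms s2 by (auto simp: pkern_def intro!: divide_left_mono add_pos_pos mult_pos_pos)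
  ultimately show ?thesis using assms(1) by (meson mult_left_mono order.strict_implies_order order_trans)
qed


lemma L2f_pkern: "e > 0 \<Longrightarrow> L2f (\<lambda>y. of_real (pkern e (y - x)))"
proof (rule L2f_bound)
  assume e: "e > 0"
  show "integrable lborel (\<lambda>y. (1 / e) * pkern e (y - x))"
    by (intro integrable_mult_right integrable_pkern e)
  show "AE y in lborel. (cmod (of_real (pkern e (y - x))))\<^sup>2 \<le> (1 / e) * pkern e (y - x)"
  proof (intro always_eventually allI)
    fix y
    have "pkern e (y - x) \<le> e / e\<^sup>2"
      using e unfolding pkern_def by (intro divide_left_mono mult_pos_pos add_nonneg_pos) auto
    then have "pkern e (y - x) * pkern e (y - x) \<le> (1 / e) * pkern e (y - x)"
      using pkern_nonneg[OF e] e by (intro mult_right_mono) (auto simp: power2_eq_square)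
    then show "(cmod (of_real (pkern e (y - x))))\<^sup>2 \<le> (1 / e) * pkern e (y - x)"
      by (simp add: power2_eq_square flip: abs_mult)
  qed
qed measurable

lemma integrable_pkern_mult: "e > 0 \<Longrightarrow> L2f g \<Longrightarrow> integrable lborel (\<lambda>y. of_real (pkern e (y - x)) * g y)"
  by (intro L2f_integrable_mult L2f_pkern)

lemma integrable_pkern_diff:
  assumes "e > 0" "L2f g"
  shows "integrable lborel (\<lambda>y. of_real (pkern e (y - x)) * (g y - c))"
proof -
  have "integrable lborel (\<lambda>y. of_real (pkern e (y - x)) * g y - of_real (pkern e (y - x)) * c)"
    using integrable_of_real[OF integrable_pkern[OF assms(1)]]
    by (intro Bochner_Integration.integrable_diff integrable_pkern_mult integrable_mult_left assms) auto
  then show ?thesis by (simp add: right_diff_distrib)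
qed

lemma integrable_pkern_diff_norm:
  assumes "e > 0" "L2f g"
  shows "integrable lborel (\<lambda>y. pkern e (y - x) * cmod (g y - c))"
  using integrable_norm[OF integrable_pkern_diff[OF assms]] pkern_nonneg[OF assms(1)]
  by (simp add: norm_mult)

text \<open>Up to radius 2^K e a step function on dyadic intervals dominates the kernel, so Poisson
  averages are controlled by the plain averages that occur at a Lebesgue point.\<close>

lemma pkern_le_dyadic_sum:
  assumes "e > 0" "\<bar>s\<bar> \<le> 2 ^ K * e"
  shows "pkern e s \<le> (\<Sum>k\<le>K. 4 / 4 ^ k / e * indicator {- (2 ^ k * e)..2 ^ k * e} s)"
proof -
  \<comment> \<open>On the k-th dyadic shell, k > 0, s^2 is at least 4^(k-1) e^2; the factor 4 in
    the height makes up for the shift from k to k - 1.\<close>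
  define k where "k = (LEAST k. \<bar>s\<bar> \<le> 2 ^ k * e)"
  have k: "\<bar>s\<bar> \<le> 2 ^ k * e" "k \<le> K"
    unfolding k_def using assms(2) by (auto intro: LeastI Least_le)
  have "pkern e s \<le> 4 / 4 ^ k / e"
  proof (cases k)
    case 0
    have "pkern e s \<le> e / e\<^sup>2"
      using assms unfolding pkern_def by (intro divide_left_mono mult_pos_pos add_nonneg_pos) auto
    also have "\<dots> \<le> 4 / 4 ^ k / e" using 0 assms(1) by (simp add: power2_eq_square field_simps)
    finally show ?thesis .
  next
    case (Suc j)
    then have "\<not> \<bar>s\<bar> \<le> 2 ^ j * e"
      using not_less_Least[of j "\<lambda>k. \<bar>s\<bar> \<le> 2 ^ k * e"] by (simp add: k_def)
    then have "(2 ^ j * e)\<^sup>2 \<le> s\<^sup>2"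
      using assms(1) by (subst abs_le_square_iff[symmetric]) (auto simp: abs_mult)
    then have "4 ^ j * e\<^sup>2 \<le> s\<^sup>2"
      by (simp add: power_mult_distrib power_mult[symmetric] mult.commute[of _ 2] power_mult)
    then have "4 ^ j * e\<^sup>2 \<le> s\<^sup>2 + e\<^sup>2"
      using zero_le_power2[of e] by linarith
    then have "pkern e s \<le> e / (4 ^ j * e\<^sup>2)"
      using assms unfolding pkern_def by (intro divide_left_mono mult_pos_pos add_nonneg_pos) auto
    also have "\<dots> = 4 / 4 ^ k / e" using Suc assms(1) by (simp add: power2_eq_square field_simps)
    finally show ?thesis .
  qed
  also have "\<dots> = 4 / 4 ^ k / e * indicator {- (2 ^ k * e)..2 ^ k * e} s"
    using k by (simp add: abs_le_iff)
  also have "\<dots> \<le> (\<Sum>k\<le>K. 4 / 4 ^ k / e * indicator {- (2 ^ k * e)..2 ^ k * e} s)"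
    using k(2) assms(1) by (intro member_le_sum) (auto split: split_indicator)
  finally show ?thesis .
qed

text \<open>The k-th dyadic interval contributes at most 4/(4^k e) times \<eta> 2^k e, that is 4
  \<eta> / 2^k, and the geometric series adds up to 8 \<eta>. The part beyond distance d/2 is the
  term with the factor \<open>e\<close>.\<close>

lemma pkern_Lebesgue_bound:
  assumes g: "L2f g" and e: "0 < e" "e \<le> 1" "e \<le> d"
    and d: "\<And>h. 0 < h \<Longrightarrow> h \<le> d \<Longrightarrow> (LINT y|lborel. indicator {x-h..x+h} y * cmod (g y - g x)) \<le> \<eta> * h"
    and "\<eta> > 0"
  shows "(LINT y|lborel. pkern e (y - x) * cmod (g y - g x))
    \<le> 8 * \<eta> + e * ((1 + 1 / (d/2)\<^sup>2) * (LINT y|lborel. pkern 1 (y - x) * cmod (g y - g x)))"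
proof -
  have "d > 0" using e by simp
  define \<psi> where "\<psi> y = cmod (g y - g x)" for y
  \<comment> \<open>\<open>K\<close> is the largest scale with 2^K e <= d: up to it the hypothesis
    on averages applies, and beyond it |y - x| > d/2.\<close>
  define K where "K = (LEAST n. d < 2 ^ Suc n * e)"
  obtain n where "d / e < 2 ^ n" using real_arch_pow[of 2 "d / e"] by auto
  also have "\<dots> \<le> 2 ^ Suc n" by simp
  finally have "d < 2 ^ Suc n * e" using e by (simp add: field_simps)
  then have K1: "d < 2 ^ Suc K * e" unfolding K_def by (rule LeastI)
  have K2: "2 ^ K * e \<le> d"
  proof (cases K)
    case (Suc j)
    then show ?thesis using not_less_Least[of j "\<lambda>n. d < 2 ^ Suc n * e"] by (simp add: K_def)
  qed (use e in simp)
  define C where "C = 1 + 1 / (d/2)\<^sup>2"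
  note int_g = L2f_local_integrable[OF g, of _ _ "g x", unfolded set_integrable_def real_scaleR_def, folded \<psi>_def]
  note int_p = integrable_pkern_diff_norm[OF _ g, of _ x "g x", folded \<psi>_def]
  have pw: "pkern e (y - x) \<le> (\<Sum>k\<le>K. 4 / 4 ^ k / e * indicator {x - 2 ^ k * e..x + 2 ^ k * e} y) + e * (C * pkern 1 (y - x))" for y
  proof -
    have s0: "0 \<le> (\<Sum>k\<le>K. 4 / 4 ^ k / e * indicator {x - 2 ^ k * e..x + 2 ^ k * e} y)"
      using e by (intro sum_nonneg) auto
    have t0: "0 \<le> e * (C * pkern 1 (y - x))"
      using e by (simp add: C_def pkern_nonneg)
    show ?thesis
    proof (cases "\<bar>y - x\<bar> \<le> 2 ^ K * e")
      case True
      have "indicator {- (2 ^ k * e)..2 ^ k * e} (y - x) = (indicator {x - 2 ^ k * e..x + 2 ^ k * e} y :: real)" for k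
        by (auto split: split_indicator)
      with pkern_le_dyadic_sum[OF e(1) True] t0 show ?thesis by simp
    next
      case False
      then have "\<bar>y - x\<bar> \<ge> d / 2" using K1 by simp
      from pkern_le[OF e(1,2) _ this] \<open>d > 0\<close>
      have "pkern e (y - x) \<le> e * (C * pkern 1 (y - x))"
        by (simp add: C_def pkern_def add.commute)
      with s0 show ?thesis by simp
    qed
  qed
  have "(LINT y|lborel. pkern e (y - x) * \<psi> y) \<le>
    (LINT y|lborel. (\<Sum>k\<le>K. 4 / 4 ^ k / e * (indicator {x - 2 ^ k * e..x + 2 ^ k * e} y * \<psi> y)) + e * C * (pkern 1 (y - x) * \<psi> y))"
  proof (rule integral_mono)
    fix y
    show "pkern e (y - x) * \<psi> y \<le> (\<Sum>k\<le>K. 4 / 4 ^ k / e * (indicator {x - 2 ^ k * e..x + 2 ^ k * e} y * \<psi> y)) + e * C * (pkern 1 (y - x) * \<psi> y)"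
      using mult_right_mono[OF pw[of y], of "\<psi> y"] by (simp add: \<psi>_def distrib_right sum_distrib_right mult.assoc)
  qed (use e int_p int_g in \<open>auto intro!: Bochner_Integration.integrable_add Bochner_Integration.integrable_sum\<close>)
  also have "\<dots> = (\<Sum>k\<le>K. 4 / 4 ^ k / e * (LINT y|lborel. indicator {x - 2 ^ k * e..x + 2 ^ k * e} y * \<psi> y))
      + e * C * (LINT y|lborel. pkern 1 (y - x) * \<psi> y)"
    using int_g int_p[of 1] by (simp add: Bochner_Integration.integral_add Bochner_Integration.integral_sum)
  also have "(\<Sum>k\<le>K. 4 / 4 ^ k / e * (LINT y|lborel. indicator {x - 2 ^ k * e..x + 2 ^ k * e} y * \<psi> y))
      \<le> (\<Sum>k\<le>K. 4 * \<eta> * (1/2) ^ k)"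
  proof (rule sum_mono)
    fix k assume "k \<in> {..K}"
    then have "(2::real) ^ k \<le> 2 ^ K" by (intro power_increasing) auto
    then have "2 ^ k * e \<le> 2 ^ K * e" using e by (intro mult_right_mono) auto
    then have "2 ^ k * e \<le> d" using K2 by linarith
    then have "(LINT y|lborel. indicator {x - 2 ^ k * e..x + 2 ^ k * e} y * \<psi> y) \<le> \<eta> * (2 ^ k * e)"
      unfolding \<psi>_def using e by (intro d) auto
    then have "4 / 4 ^ k / e * (LINT y|lborel. indicator {x - 2 ^ k * e..x + 2 ^ k * e} y * \<psi> y) \<le> 4 / 4 ^ k / e * (\<eta> * (2 ^ k * e))"
      using e by (intro mult_left_mono) auto
    also have "(4::real) ^ k = 2 ^ k * 2 ^ k" by (simp flip: power_mult_distrib)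
    then have "4 / 4 ^ k / e * (\<eta> * (2 ^ k * e)) = 4 * \<eta> * (1/2) ^ k"
      using e by (simp add: power_one_over)
    finally show "4 / 4 ^ k / e * (LINT y|lborel. indicator {x - 2 ^ k * e..x + 2 ^ k * e} y * \<psi> y) \<le> 4 * \<eta> * (1/2) ^ k" .
  qed
  also have "\<dots> = 4 * \<eta> * (\<Sum>k\<le>K. (1/2) ^ k)" by (simp add: sum_distrib_left)
  also have "(\<Sum>k\<le>K. (1/2::real) ^ k) \<le> (\<Sum>k. (1/2) ^ k)"
    by (intro sum_le_suminf) auto
  also have "(\<Sum>k. (1/2::real) ^ k) = 2" by (simp add: suminf_geometric)
  finally show ?thesis using \<open>\<eta> > 0\<close> by (simp add: \<psi>_def C_def mult.assoc)
qed

theorem AE_pkern_tendsto: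
  assumes g: "L2f g"
  shows "AE x in lborel. ((\<lambda>e. LINT y|lborel. pkern e (y - x) * cmod (g y - g x)) \<longlongrightarrow> 0) (at_right 0)"
  using AE_Lebesgue_point[OF g]
proof eventually_elim
  fix x assume x: "\<forall>\<eta>>0. \<exists>\<delta>>0. \<forall>h. 0 < h \<and> h < \<delta> \<longrightarrow>
    (LINT y|lborel. indicator {x-h..x+h} y * cmod (g y - g x)) \<le> \<eta> * h"
  define D where "D = (LINT y|lborel. pkern 1 (y - x) * cmod (g y - g x))"
  show "((\<lambda>e. LINT y|lborel. pkern e (y - x) * cmod (g y - g x)) \<longlongrightarrow> 0) (at_right 0)"
    unfolding tendsto_iff
  proof (intro allI impI)
    fix r :: real assume "r > 0"
    \<comment> \<open>With \<eta> = r/16 the near part is at most r/2; the far part tends to 0 with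
      \<open>e\<close>.\<close>
    then have "r / 16 > 0" by simp
    with x obtain \<delta> where \<delta>: "\<delta> > 0" "\<And>h. 0 < h \<Longrightarrow> h < \<delta> \<Longrightarrow>
        (LINT y|lborel. indicator {x-h..x+h} y * cmod (g y - g x)) \<le> r / 16 * h" by blast
    define d where "d = \<delta> / 2"
    have d: "d > 0" "\<And>h. 0 < h \<Longrightarrow> h \<le> d \<Longrightarrow>
        (LINT y|lborel. indicator {x-h..x+h} y * cmod (g y - g x)) \<le> r / 16 * h"
      using \<delta> by (auto simp: d_def)
    have "((\<lambda>e. e * ((1 + 1 / (d/2)\<^sup>2) * D)) \<longlongrightarrow> 0 * ((1 + 1 / (d/2)\<^sup>2) * D)) (at_right 0)"
      by (intro tendsto_intros)
    then have "eventually (\<lambda>e. e * ((1 + 1 / (d/2)\<^sup>2) * D) < r / 2) (at_right 0)"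
      using \<open>r > 0\<close> by (intro order_tendstoD(2)) auto
    moreover have "eventually (\<lambda>e. e < min 1 d) (at_right 0)" "eventually (\<lambda>e. e > (0::real)) (at_right 0)"
      using d(1) unfolding eventually_at_right_field by (intro exI[of _ "min 1 d"]; simp)+
    ultimately show "eventually (\<lambda>e. dist (LINT y|lborel. pkern e (y - x) * cmod (g y - g x)) 0 < r) (at_right 0)"
    proof eventually_elim
      case (elim e)
      have "(LINT y|lborel. pkern e (y - x) * cmod (g y - g x)) \<le> 8 * (r / 16) + e * ((1 + 1 / (d/2)\<^sup>2) * D)"
        unfolding D_def using elim d \<open>r > 0\<close> by (intro pkern_Lebesgue_bound[OF g]) auto
      moreover have "0 \<le> (LINT y|lborel. pkern e (y - x) * cmod (g y - g x))"
        using elim by (intro integral_nonneg_AE always_eventually allI mult_nonneg_nonneg pkern_nonneg) auto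
      moreover have "(LINT y|lborel. pkern e (y - x) * cmod (g y - g x)) < r"
        using calculation(1) elim(1) by linarith
      ultimately show ?case by (simp add: dist_real_def)
    qed
  qed
qed

section \<open>The Fourier transformation on integrable functions\<close>

definition c0 :: real where
  "c0 = (2 * pi) powr (-1/2)"

lemma c0_eq: "c0 = 1 / sqrt (2 * pi)"
  by (simp add: c0_def powr_minus_divide powr_half_sqrt)

lemma c0_pos: "c0 > 0"
  by (simp add: c0_def)

lemma c0_sq: "c0 * c0 = 1 / (2 * pi)"
  by (simp add: c0_eq)

definition FT0 :: "(real \<Rightarrow> complex) \<Rightarrow> real \<Rightarrow> complex" where
  "FT0 f t = of_real c0 * (LINT y|lborel. exp (- (\<i> * of_real (t * y))) * f y)"

lemma cmod_exp_ii [simp]: "cmod (exp (\<i> * of_real t)) = 1" "cmod (exp (- (\<i> * of_real t))) = 1"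
  by (simp_all add: norm_exp_eq_Re)

lemma borel_measurable_cexp [measurable]: "(exp :: complex \<Rightarrow> complex) \<in> borel_measurable borel"
  by (intro borel_measurable_continuous_onI continuous_intros)

lemma FT0_integrable:
  assumes "integrable lborel f"
  shows "integrable lborel (\<lambda>y. exp (- (\<i> * of_real (t * y))) * f y)"
proof (rule Bochner_Integration.integrable_bound[OF assms])
  have [measurable]: "f \<in> borel_measurable borel" using assms by auto
  show "(\<lambda>y. exp (- (\<i> * of_real (t * y))) * f y) \<in> borel_measurable lborel" by measurable
qed (simp add: norm_mult del: of_real_mult)

lemma FT0_measurable [measurable]:
  assumes [measurable]: "f \<in> borel_measurable borel"
  shows "FT0 f \<in> borel_measurable borel"
  unfolding FT0_def by measurable

lemma FT0_bound:
  assumes "integrable lborel f"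
  shows "cmod (FT0 f t) \<le> c0 * (LINT y|lborel. cmod (f y))"
proof -
  have "cmod (LINT y|lborel. exp (- (\<i> * of_real (t * y))) * f y)
      \<le> (LINT y|lborel. cmod (exp (- (\<i> * of_real (t * y))) * f y))"
    by (rule integral_norm_bound)
  then show ?thesis
    using c0_pos by (simp add: FT0_def norm_mult del: of_real_mult)
qed

lemma FT0_add: "integrable lborel f \<Longrightarrow> integrable lborel g \<Longrightarrow> FT0 (\<lambda>x. f x + g x) t = FT0 f t + FT0 g t"
  unfolding FT0_def by (simp add: distrib_left FT0_integrable del: of_real_mult)

lemma FT0_scale: "FT0 (\<lambda>x. c * f x) t = c * FT0 f t"
proof -
  have "(\<lambda>y. exp (- (\<i> * of_real (t * y))) * (c * f y)) = (\<lambda>y. c * (exp (- (\<i> * of_real (t * y))) * f y))"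
    by (auto simp: ac_simps)
  then show ?thesis by (simp add: FT0_def del: of_real_mult)
qed

lemma FT0_diff: "integrable lborel f \<Longrightarrow> integrable lborel g \<Longrightarrow> FT0 (\<lambda>x. f x - g x) t = FT0 f t - FT0 g t"
  unfolding FT0_def by (simp add: right_diff_distrib FT0_integrable del: of_real_mult)

lemma FT0_cnj: "cnj (FT0 f t) = FT0 (\<lambda>y. cnj (f y)) (- t)"
  by (simp add: FT0_def exp_cnj flip: Bochner_Integration.integral_cnj)

text \<open>The kernel exp (-i t y) is symmetric in t and y, so Fubini shifts the transform to the
  other factor. Regularisation by Gaussians and the adjoint of the transform both rest on this
  formula.\<close>

lemma FT0_multiplication:
  assumes f: "integrable lborel f" and g: "integrable lborel g"
  shows "(LINT t|lborel. FT0 f t * g t) = (LINT y|lborel. f y * FT0 g y)"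
proof -
  have [measurable]: "f \<in> borel_measurable borel" "g \<in> borel_measurable borel"
    using f g by auto
  let ?h = "\<lambda>t y. exp (- (\<i> * of_real (t * y))) * f y * g t"
  have int: "integrable (lborel \<Otimes>\<^sub>M lborel) (case_prod ?h)"
  proof (rule lborel_pair.Fubini_integrable)
    show "case_prod ?h \<in> borel_measurable (lborel \<Otimes>\<^sub>M lborel)" by measurable
    have "(\<lambda>t. LINT y|lborel. cmod (?h t y)) = (\<lambda>t. (LINT y|lborel. cmod (f y)) * cmod (g t))"
      by (simp add: norm_mult del: of_real_mult)
    then show "integrable lborel (\<lambda>t. LINT y|lborel. cmod (case_prod ?h (t, y)))"
      using g by simp
    show "AE t in lborel. integrable lborel (\<lambda>y. case_prod ?h (t, y))"
      using FT0_integrable[OF f] by (simp del: of_real_mult)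
  qed
  have "(LINT t|lborel. FT0 f t * g t) = of_real c0 * (LINT t|lborel. LINT y|lborel. ?h t y)"
    by (simp add: FT0_def mult.assoc del: of_real_mult flip: Bochner_Integration.integral_mult_left_zero)
  also have "(LINT t|lborel. LINT y|lborel. ?h t y) = (LINT y|lborel. LINT t|lborel. ?h t y)"
    by (rule lborel_pair.Fubini_integral[OF int, symmetric])
  also have "of_real c0 * \<dots> = (LINT y|lborel. f y * FT0 g y)"
  proof -
    have "(LINT t|lborel. ?h t y) = f y * (LINT t|lborel. exp (- (\<i> * of_real (y * t))) * g t)" for y
      unfolding Bochner_Integration.integral_mult_right_zero[symmetric]
      by (intro Bochner_Integration.integral_cong) (auto simp: ac_simps)
    then have "of_real c0 * (LINT y|lborel. LINT t|lborel. ?h t y)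
        = (LINT y|lborel. of_real c0 * (f y * (LINT t|lborel. exp (- (\<i> * of_real (y * t))) * g t)))"
      by (simp del: of_real_mult)
    then show ?thesis by (simp add: FT0_def mult.left_commute del: of_real_mult)
  qed
  finally show ?thesis .
qed

section \<open>Gaussian regularisation\<close>

definition gs :: "real \<Rightarrow> real \<Rightarrow> real" where
  "gs e t = exp (- (e * t)\<^sup>2 / 2)"

lemma gs_measurable [measurable]: "gs e \<in> borel_measurable borel"
  unfolding gs_def by measurable

lemma gs_bounds: "0 \<le> gs e t" "gs e t \<le> 1"
  by (auto simp: gs_def)

lemma gs_integrable: "e > 0 \<Longrightarrow> integrable lborel (gs e)"
proof -
  assume "e > 0"
  have "integrable lborel (\<lambda>t. sqrt (2 * pi) * std_normal_density t)"
    by (intro integrable_mult_right integrable_normal_density) auto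
  then have "integrable lborel (\<lambda>t. gs 1 t)"
    by (simp add: gs_def std_normal_density_def)
  then have "integrable lborel (\<lambda>t. gs 1 (0 + e * t))"
    using \<open>e > 0\<close> by (subst lborel_integrable_real_affine_iff) auto
  then show ?thesis by (simp add: gs_def[abs_def])
qed

text \<open>Up to normalisation and the sign of the argument this is the characteristic function of
  the standard normal distribution.\<close>

lemma FT0_gs1: "FT0 (\<lambda>y. of_real (gs 1 y)) t = of_real (gs 1 t)"
proof -
  have "char std_normal_distribution (- t) =
      (LINT y|lborel. std_normal_density y *\<^sub>R exp (\<i> * of_real (- t * y)))"
    unfolding char_def by (subst integral_density) auto
  also have "\<dots> = FT0 (\<lambda>y. of_real (gs 1 y)) t"
    unfolding FT0_def Bochner_Integration.integral_mult_right_zero[symmetric]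
    by (intro Bochner_Integration.integral_cong)
      (auto simp: std_normal_density_def gs_def c0_eq scaleR_conv_of_real)
  finally show ?thesis
    by (simp add: char_std_normal_distribution gs_def)
qed

lemma FT0_gs:
  assumes e: "e > 0"
  shows "FT0 (\<lambda>y. exp (\<i> * of_real (z * y)) * of_real (gs e y)) x = of_real (normal_density z e x / c0)"
proof -
  have "FT0 (\<lambda>y. exp (\<i> * of_real (z * y)) * of_real (gs e y)) x
      = of_real c0 * (LINT y|lborel. exp (- (\<i> * of_real ((x - z) * y))) * of_real (gs e y))"
  proof -
    have "exp (- (\<i> * of_real (x * y))) * (exp (\<i> * of_real (z * y)) * of_real (gs e y))
        = exp (- (\<i> * of_real ((x - z) * y))) * of_real (gs e y)" for y
      unfolding mult.assoc[symmetric] exp_add[symmetric] by (simp add: algebra_simps)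
    then show ?thesis by (simp only: FT0_def)
  qed
  also have "(LINT y|lborel. exp (- (\<i> * of_real ((x - z) * y))) * of_real (gs e y))
      = of_real (1 / e) * (LINT y|lborel. exp (- (\<i> * of_real ((x - z) / e * y))) * of_real (gs 1 y))"
    using e by (subst lborel_integral_real_affine[where c="1/e" and t=0])
      (simp_all add: gs_def scaleR_conv_of_real)
  also have "of_real c0 * \<dots> = of_real (1 / e) * FT0 (\<lambda>y. of_real (gs 1 y)) ((x - z) / e)"
    by (simp add: FT0_def)
  also have "\<dots> = of_real (gs 1 ((x - z) / e) / e)"
    by (simp add: FT0_gs1)
  also have "gs 1 ((x - z) / e) / e = normal_density z e x / c0"
    using e by (simp add: gs_def normal_density_def c0_eq power_divide real_sqrt_mult)
  finally show ?thesis .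
qed

definition gconv :: "real \<Rightarrow> (real \<Rightarrow> complex) \<Rightarrow> real \<Rightarrow> complex" where
  "gconv e f z = (LINT x|lborel. f x * of_real (normal_density z e x))"

lemma normal_density_shift: "normal_density z e x = normal_density 0 e (x - z)"
  by (simp add: normal_density_def)

lemma gconv_measurable [measurable]:
  assumes [measurable]: "f \<in> borel_measurable borel"
  shows "gconv e f \<in> borel_measurable borel"
  unfolding gconv_def by (subst normal_density_shift) measurable

text \<open>Fourier inversion with Gaussian summation: the multiplication formula is applied to a
  modulated Gaussian, whose transform is the normal density centred at \<open>z\<close>.\<close>

lemma gconv_eq_FT0:
  assumes e: "e > 0" and f: "integrable lborel f"
  shows "gconv e f z = FT0 (\<lambda>t. FT0 f t * of_real (gs e t)) (- z)"
proof -
  have gi: "integrable lborel (\<lambda>t. exp (\<i> * of_real (z * t)) * of_real (gs e t))"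
    by (rule Bochner_Integration.integrable_bound[OF gs_integrable[OF e]])
      (auto simp: norm_mult gs_bounds simp del: of_real_mult)
  have "(LINT t|lborel. FT0 f t * (exp (\<i> * of_real (z * t)) * of_real (gs e t)))
      = (LINT x|lborel. f x * FT0 (\<lambda>t. exp (\<i> * of_real (z * t)) * of_real (gs e t)) x)"
    by (rule FT0_multiplication[OF f gi])
  also have "\<dots> = (LINT x|lborel. f x * of_real (normal_density z e x) / of_real c0)"
    by (simp add: FT0_gs[OF e] del: of_real_mult)
  also have "\<dots> = gconv e f z / of_real c0"
    by (simp add: gconv_def)
  finally have "gconv e f z = of_real c0 * (LINT t|lborel. FT0 f t * (exp (\<i> * of_real (z * t)) * of_real (gs e t)))"
    using c0_pos by simp
  also have "\<dots> = FT0 (\<lambda>t. FT0 f t * of_real (gs e t)) (- z)"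
    by (simp add: FT0_def ac_simps)
  finally show ?thesis .
qed

text \<open>Convolution with a probability density is a contraction: Cauchy-Schwarz with N = sqrt N
  sqrt N bounds the squared mean by the mean of the square, and Tonelli integrates the density away
  in the other variable.\<close>

lemma gconv_L2:
  assumes e: "e > 0" and f: "L2f f"
  shows "L2f (gconv e f)" "nsq (gconv e f) \<le> nsq f"
proof -
  note [measurable] = L2f_measurable[OF f]
  let ?N = "\<lambda>z x. normal_density z e x"
  have N: "(\<integral>\<^sup>+x. ennreal (?N z x) \<partial>lborel) = 1" for z
    unfolding nn_integral_eq_integral[OF integrable_normal_density[OF e] always_eventually[OF allI[OF normal_density_nonneg]]]
    by (simp add: integral_normal_density[OF e])
  have N': "(\<integral>\<^sup>+z. ennreal (?N z x) \<partial>lborel) = 1" for x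
    using N[of x] by (simp add: normal_density_def power2_commute)
  have pw: "ennreal ((cmod (gconv e f z))\<^sup>2) \<le> (\<integral>\<^sup>+x. ennreal ((cmod (f x))\<^sup>2 * ?N z x) \<partial>lborel)" for z
  proof -
    have "ennreal (cmod (gconv e f z)) \<le> (\<integral>\<^sup>+x. ennreal (cmod (f x) * ?N z x) \<partial>lborel)"
    proof (cases "integrable lborel (\<lambda>x. f x * of_real (?N z x))")
      case True
      from integral_norm_bound_ennreal[OF this] show ?thesis
        by (simp add: gconv_def norm_mult)
    next
      \<comment> \<open>A non-integrable function has integral 0 by convention, which makes the
        bound trivial.\<close>
      case False
      then show ?thesis by (simp add: gconv_def not_integrable_integral_eq)
    qed
    also have "\<dots> = (\<integral>\<^sup>+x. ennreal (cmod (f x) * sqrt (?N z x)) * ennreal (sqrt (?N z x)) \<partial>lborel)"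
      by (simp add: mult.assoc flip: ennreal_mult)
    finally have "(ennreal (cmod (gconv e f z)))\<^sup>2 \<le>
        (\<integral>\<^sup>+x. ennreal (cmod (f x) * sqrt (?N z x)) * ennreal (sqrt (?N z x)) \<partial>lborel)\<^sup>2"
      by (intro power_mono) auto
    also have "\<dots> \<le> (\<integral>\<^sup>+x. (ennreal (cmod (f x) * sqrt (?N z x)))\<^sup>2 \<partial>lborel) * (\<integral>\<^sup>+x. (ennreal (sqrt (?N z x)))\<^sup>2 \<partial>lborel)"
      by (rule Cauchy_Schwarz_nn_integral) auto
    also have "\<dots> = (\<integral>\<^sup>+x. ennreal ((cmod (f x))\<^sup>2 * ?N z x) \<partial>lborel)"
      by (simp add: ennreal_power power_mult_distrib N)
    finally show ?thesis by (simp add: ennreal_power)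
  qed
  have "(\<integral>\<^sup>+z. ennreal ((cmod (gconv e f z))\<^sup>2) \<partial>lborel)
      \<le> (\<integral>\<^sup>+z. \<integral>\<^sup>+x. ennreal ((cmod (f x))\<^sup>2 * ?N z x) \<partial>lborel \<partial>lborel)"
    by (intro nn_integral_mono pw)
  also have "\<dots> = (\<integral>\<^sup>+x. \<integral>\<^sup>+z. ennreal ((cmod (f x))\<^sup>2 * ?N z x) \<partial>lborel \<partial>lborel)"
    by (subst (1 2) normal_density_shift, rule lborel_pair.Fubini') measurable
  also have "\<dots> = (\<integral>\<^sup>+x. ennreal ((cmod (f x))\<^sup>2) \<partial>lborel)"
  proof (rule nn_integral_cong)
    fix x
    have [measurable]: "(\<lambda>z. ?N z x) \<in> borel_measurable borel"
      unfolding normal_density_def by measurable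
    show "(\<integral>\<^sup>+z. ennreal ((cmod (f x))\<^sup>2 * ?N z x) \<partial>lborel) = ennreal ((cmod (f x))\<^sup>2)"
      by (simp add: ennreal_mult nn_integral_cmult N')
  qed
  finally have *: "(\<integral>\<^sup>+z. ennreal ((cmod (gconv e f z))\<^sup>2) \<partial>lborel) \<le> ennreal (nsq f)"
    by (simp add: nn_integral_nsq f)
  from L2f_nn[OF gconv_measurable[OF L2f_measurable[OF f]] * nsq_nonneg]
  show "L2f (gconv e f)" "nsq (gconv e f) \<le> nsq f" .
qed


text \<open>From exp (-r/2) <= 1/(1 + r/2) <= 2/(1 + r) with r = (x - z)^2 / e^2. The domination
  lets the Lebesgue point theorem for Poisson averages serve Gaussian means as well.\<close>

lemma normal_density_le_pkern:
  assumes e: "e > 0"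
  shows "normal_density z e x \<le> 2 * pkern e (x - z)"
proof -
  define r where "r = (x - z)\<^sup>2 / e\<^sup>2"
  have r: "r \<ge> 0" by (simp add: r_def)
  have "1 + r / 2 \<le> exp (r / 2)" by (rule exp_ge_add_one_self)
  then have "exp (- (r / 2)) \<le> 1 / (1 + r / 2)"
    using r by (simp add: exp_minus divide_simps)
  also have "\<dots> \<le> 2 / (1 + r)"
    using r by (simp add: divide_simps)
  finally have 1: "exp (- (r / 2)) \<le> 2 / (1 + r)" .
  have "1 * e\<^sup>2 \<le> 2 * pi * e\<^sup>2"
    using pi_gt3 by (intro mult_right_mono) auto
  then have "e \<le> sqrt (2 * pi * e\<^sup>2)"
    using e by (intro real_le_rsqrt) auto
  then have 2: "1 / sqrt (2 * pi * e\<^sup>2) \<le> 1 / e"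
    using e by (intro divide_left_mono) auto
  have "normal_density z e x = 1 / sqrt (2 * pi * e\<^sup>2) * exp (- (r / 2))"
    by (simp add: normal_density_def r_def)
  also have "\<dots> \<le> 1 / e * (2 / (1 + r))"
    using 1 2 e by (intro mult_mono) auto
  also have "\<dots> = 2 * pkern e (x - z)"
    using e unfolding pkern_def r_def by (simp add: field_simps power2_eq_square add_nonneg_eq_0_iff)
  finally show ?thesis .
qed

lemma gconv_tendsto:
  assumes f: "L2f f"
  shows "AE z in lborel. ((\<lambda>e. gconv e f z) \<longlongrightarrow> f z) (at_right 0)"
  using AE_pkern_tendsto[OF f]
proof eventually_elim
  fix z assume lim: "((\<lambda>e. LINT y|lborel. pkern e (y - z) * cmod (f y - f z)) \<longlongrightarrow> 0) (at_right 0)"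
  note [measurable] = L2f_measurable[OF f]
  show "((\<lambda>e. gconv e f z) \<longlongrightarrow> f z) (at_right 0)"
  proof (rule Lim_transform2[OF tendsto_const], rule Lim_null_comparison)
    show "((\<lambda>e. 2 * (LINT y|lborel. pkern e (y - z) * cmod (f y - f z))) \<longlongrightarrow> 0) (at_right 0)"
      using tendsto_mult_right_zero[OF lim] .
    have "eventually (\<lambda>e. e > (0::real)) (at_right 0)"
      by (simp add: eventually_at_right_less)
    then show "eventually (\<lambda>e. norm (f z - gconv e f z) \<le> 2 * (LINT y|lborel. pkern e (y - z) * cmod (f y - f z))) (at_right 0)"
    proof eventually_elim
      fix e :: real assume e: "e > 0"
      have bd: "cmod ((f y - f z) * of_real (normal_density z e y)) \<le> 2 * (pkern e (y - z) * cmod (f y - f z))" for y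
      proof -
        have "cmod (f y - f z) * normal_density z e y \<le> cmod (f y - f z) * (2 * pkern e (y - z))"
          by (intro mult_left_mono normal_density_le_pkern e norm_ge_zero)
        then show ?thesis by (simp add: norm_mult mult.commute mult.left_commute)
      qed
      have int1: "integrable lborel (\<lambda>y. (f y - f z) * of_real (normal_density z e y))"
        using bd by (intro Bochner_Integration.integrable_bound[OF integrable_mult_right[of 2, OF integrable_pkern_diff_norm[OF e f, of z "f z"]]])
          (auto intro!: always_eventually order_trans[OF _ abs_ge_self])
      have int2: "integrable lborel (\<lambda>y. f z * of_real (normal_density z e y))"
        using integrable_normal_density[OF e] by (intro integrable_mult_right integrable_of_real)
      have "gconv e f z = (LINT y|lborel. (f y - f z) * of_real (normal_density z e y) + f z * of_real (normal_density z e y))"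
        by (simp add: gconv_def algebra_simps)
      also have "\<dots> = (LINT y|lborel. (f y - f z) * of_real (normal_density z e y)) + f z"
        using int1 int2 by (simp add: integral_normal_density[OF e] del: Bochner_Integration.integral_mult_right)
      finally have "norm (f z - gconv e f z) = norm (LINT y|lborel. (f y - f z) * of_real (normal_density z e y))"
        by simp
      also have "\<dots> \<le> (LINT y|lborel. 2 * (pkern e (y - z) * cmod (f y - f z)))"
        by (intro Bochner_Integration.integral_norm_bound_integral int1 integrable_mult_right integrable_pkern_diff_norm e f bd)
      finally show "norm (f z - gconv e f z) \<le> 2 * (LINT y|lborel. pkern e (y - z) * cmod (f y - f z))"
        by simp
    qed
  qed
qed

section \<open>Plancherel's identity for integrable, square integrable functions\<close>

lemma gs_mult_integrable:
  assumes e: "e > 0" and [measurable]: "h \<in> borel_measurable borel" and "\<And>t. cmod (h t) \<le> C"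
  shows "integrable lborel (\<lambda>t. h t * of_real (gs e t))"
proof (rule Bochner_Integration.integrable_bound[OF integrable_mult_right[of C, OF gs_integrable[OF e]]])
  show "AE t in lborel. norm (h t * of_real (gs e t)) \<le> norm (C * gs e t)"
  proof (intro always_eventually allI)
    fix t
    have "cmod (h t) * gs e t \<le> C * gs e t" by (intro mult_right_mono assms gs_bounds)
    then show "norm (h t * of_real (gs e t)) \<le> norm (C * gs e t)"
      using gs_bounds[of e t] by (simp add: norm_mult abs_mult) (smt (verit) abs_ge_self mult_right_mono)
  qed
qed measurable

text \<open>The weight \<open>gs e\<close> makes |FT0 f|^2 integrable. By the multiplication formula
  the weighted integral is the inner product of the Gaussian mean of f with f, hence at most the
  squared norm of f; Fatou removes the weight.\<close>

lemma FT0_contraction: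
  assumes f1: "integrable lborel f" and f2: "L2f f"
  shows "L2f (FT0 f)" "nsq (FT0 f) \<le> nsq f"
proof -
  note [measurable] = L2f_measurable[OF f2]
  define C where "C = c0 * (LINT y|lborel. cmod (f y))"
  have C: "cmod (FT0 f t) \<le> C" for t using FT0_bound[OF f1] by (simp add: C_def)
  have key: "L2f (\<lambda>t. of_real (sqrt (gs e t)) * FT0 f t)" "nsq (\<lambda>t. of_real (sqrt (gs e t)) * FT0 f t) \<le> nsq f" if e: "e > 0" for e
  proof -
    let ?a = "\<lambda>t. FT0 f t * of_real (gs e t)"
    have a: "integrable lborel ?a"
      by (intro gs_mult_integrable[OF e _ C]) measurable
    have a': "integrable lborel (\<lambda>t. cnj (?a t))" using a by (simp only: integrable_cnj)
    have "(LINT t|lborel. FT0 f t * cnj (?a t)) = (LINT y|lborel. f y * FT0 (\<lambda>t. cnj (?a t)) y)"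
      by (rule FT0_multiplication[OF f1 a'])
    also have "\<dots> = (LINT y|lborel. f y * cnj (gconv e f y))"
      unfolding gconv_eq_FT0[OF e f1] FT0_cnj by simp
    also have "\<dots> = ip (gconv e f) f"
      by (simp add: ip_def mult.commute)
    finally have eq: "(LINT t|lborel. FT0 f t * cnj (?a t)) = ip (gconv e f) f" .
    have re: "FT0 f t * cnj (?a t) = of_real ((cmod (of_real (sqrt (gs e t)) * FT0 f t))\<^sup>2)" for t
      using complex_norm_square[of "FT0 f t"] gs_bounds(1)[of e t]
      by (simp add: norm_mult power_mult_distrib mult.assoc[symmetric])
    have "integrable lborel (\<lambda>t. FT0 f t * cnj (?a t))"
    proof (rule Bochner_Integration.integrable_bound[OF integrable_mult_right[of C, OF integrable_norm[OF a]]])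
      show "AE t in lborel. norm (FT0 f t * cnj (?a t)) \<le> norm (C * norm (?a t))"
        using C by (intro always_eventually allI) (simp add: norm_mult abs_mult, smt (verit) mult_right_mono norm_ge_zero abs_ge_zero mult_nonneg_nonneg)
    qed measurable
    then have "integrable lborel (\<lambda>t. Re (FT0 f t * cnj (?a t)))" by (rule integrable_Re)
    then show L: "L2f (\<lambda>t. of_real (sqrt (gs e t)) * FT0 f t)"
      unfolding L2f_def re Re_complex_of_real by (intro conjI) measurable
    have "of_real (nsq (\<lambda>t. of_real (sqrt (gs e t)) * FT0 f t)) = ip (gconv e f) f"
      using eq unfolding re by (simp add: nsq_def del: of_real_power)
    then have "nsq (\<lambda>t. of_real (sqrt (gs e t)) * FT0 f t) = cmod (ip (gconv e f) f)"
      by (metis abs_of_nonneg norm_of_real nsq_nonneg)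
    also have "\<dots> \<le> sqrt (nsq (gconv e f)) * sqrt (nsq f)"
      by (intro ip_Cauchy_Schwarz' gconv_L2 e f2)
    also have "\<dots> \<le> sqrt (nsq f) * sqrt (nsq f)"
      using gconv_L2(2)[OF e f2] by (intro mult_right_mono) (auto simp: nsq_nonneg)
    also have "\<dots> = nsq f" by (simp add: nsq_nonneg)
    finally show "nsq (\<lambda>t. of_real (sqrt (gs e t)) * FT0 f t) \<le> nsq f" .
  qed
  let ?h = "\<lambda>n t. of_real (sqrt (gs (inverse (Suc n)) t)) * FT0 f t"
  \<comment> \<open>For e = 0 the Gaussian is the constant 1.\<close>
  have "(\<lambda>n. ?h n t) \<longlonglongrightarrow> of_real (sqrt (gs 0 t)) * FT0 f t" for t
    unfolding gs_def by (intro tendsto_intros LIMSEQ_inverse_real_of_nat) simp_all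
  then have lim: "AE t in lborel. (\<lambda>n. ?h n t) \<longlonglongrightarrow> FT0 f t"
    by (simp add: gs_def)
  have ev: "eventually (\<lambda>n. nsq (?h n) \<le> nsq f) sequentially"
    using key(2) by simp
  have L: "L2f (?h n)" for n by (rule key(1)) simp
  have m: "FT0 f \<in> borel_measurable borel" by measurable
  show "L2f (FT0 f)" "nsq (FT0 f) \<le> nsq f"
    by (rule L2f_Fatou[OF L m lim ev])+
qed

lemma L2f_reflect: "L2f f \<Longrightarrow> L2f (\<lambda>x. f (- x))"
  and nsq_reflect: "nsq (\<lambda>x. f (- x)) = nsq f"
  and ip_reflect: "ip (\<lambda>x. f (- x)) (\<lambda>x. g (- x)) = ip f g"
proof -
  show "nsq (\<lambda>x. f (- x)) = nsq f"
    unfolding nsq_def by (subst lborel_integral_real_affine[where c="-1" and t=0]) auto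
  show "ip (\<lambda>x. f (- x)) (\<lambda>x. g (- x)) = ip f g"
    unfolding ip_def by (subst lborel_integral_real_affine[where c="-1" and t=0]) auto
  show "L2f (\<lambda>x. f (- x))" if "L2f f"
    unfolding L2f_def
  proof
    note [measurable] = L2f_measurable[OF that]
    show "(\<lambda>x. f (- x)) \<in> borel_measurable borel" by measurable
    show "integrable lborel (\<lambda>x. (cmod (f (- x)))\<^sup>2)"
      using lborel_integrable_real_affine[OF L2f_integrable[OF that], of "-1" 0] by simp
  qed
qed

text \<open>The Gaussian means of \<open>f\<close> are reflected transforms of \<open>FT0 f\<close> times a Gaussian; the contraction
  estimate, applied to the latter, therefore also bounds \<open>f\<close> by \<open>FT0 f\<close>.\<close>

theorem FT0_isometry:
  assumes f1: "integrable lborel f" and f2: "L2f f"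
  shows "nsq (FT0 f) = nsq f"
proof (rule antisym)
  show "nsq (FT0 f) \<le> nsq f" by (rule FT0_contraction[OF assms])
  note [measurable] = L2f_measurable[OF f2]
  let ?e = "\<lambda>n. inverse (real (Suc n))"
  have bd: "nsq (gconv e f) \<le> nsq (FT0 f)" if e: "e > 0" for e
  proof -
    let ?a = "\<lambda>t. FT0 f t * of_real (gs e t)"
    have a1: "integrable lborel ?a"
      by (intro gs_mult_integrable[OF e _ FT0_bound[OF f1]]) measurable
    have "L2f (\<lambda>t. of_real (gs e t) * FT0 f t)"
      using gs_bounds by (intro L2f_bounded_mult[where C=1] FT0_contraction f1 f2) auto
    then have a2: "L2f ?a" by (simp add: mult.commute)
    have "nsq (gconv e f) = nsq (\<lambda>z. FT0 ?a (- z))"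
      by (simp add: gconv_eq_FT0[OF e f1, abs_def])
    also have "\<dots> \<le> nsq ?a" using FT0_contraction(2)[OF a1 a2] by (simp add: nsq_reflect)
    also have "\<dots> \<le> nsq (FT0 f)"
      unfolding nsq_def
    proof (intro integral_mono L2f_integrable a2 FT0_contraction f1 f2)
      fix t
      have "cmod (FT0 f t) * gs e t \<le> cmod (FT0 f t) * 1"
        by (intro mult_left_mono gs_bounds) auto
      then show "(cmod (?a t))\<^sup>2 \<le> (cmod (FT0 f t))\<^sup>2"
        using gs_bounds by (intro power_mono) (auto simp: norm_mult)
    qed
    finally show ?thesis .
  qed
  have lim: "AE z in lborel. (\<lambda>n. gconv (?e n) f z) \<longlonglongrightarrow> f z"
    using gconv_tendsto[OF f2]
  proof eventually_elim
    fix z assume "((\<lambda>e. gconv e f z) \<longlongrightarrow> f z) (at_right 0)"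
    moreover have "filterlim ?e (at_right 0) sequentially"
      using LIMSEQ_inverse_real_of_nat by (auto simp: filterlim_at)
    ultimately show "(\<lambda>n. gconv (?e n) f z) \<longlonglongrightarrow> f z"
      by (rule filterlim_compose)
  qed
  have ev: "eventually (\<lambda>n. nsq (gconv (?e n) f) \<le> nsq (FT0 f)) sequentially"
    by (intro always_eventually allI bd) simp
  have L: "L2f (gconv (?e n) f)" for n
    by (rule gconv_L2(1)[OF _ f2]) simp
  show "nsq f \<le> nsq (FT0 f)"
    by (rule L2f_Fatou(2)[OF L L2f_measurable[OF f2] lim ev])
qed

section \<open>The Fourier transformation on square integrable functions\<close>

definition L12 :: "(real \<Rightarrow> complex) \<Rightarrow> bool" where
  "L12 f \<longleftrightarrow> L2f f \<and> integrable lborel f"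

definition trunc :: "nat \<Rightarrow> (real \<Rightarrow> complex) \<Rightarrow> real \<Rightarrow> complex" where
  "trunc n f x = indicator {- real n..real n} x * f x"

lemma L2f_indicator_Icc: "L2f (indicator {a..b})"
  by (rule L2f_bound[where g="indicator {a..b}"])
    (auto simp: emeasure_lborel_Icc_eq intro!: integrable_real_indicator always_eventually split: split_indicator)

lemma L12_trunc: "L2f f \<Longrightarrow> L12 (trunc n f)"
  unfolding L12_def trunc_def using L2f_indicator_Icc by (intro conjI L2f_indicator L2f_integrable_mult) auto

lemma trunc_tendsto:
  assumes f: "L2f f"
  shows "(\<lambda>n. nsq (\<lambda>x. trunc n f x - f x)) \<longlonglongrightarrow> 0"
proof -
  note [measurable] = L2f_measurable[OF f]
  have "(\<lambda>n. LINT x|lborel. (cmod (trunc n f x - f x))\<^sup>2) \<longlonglongrightarrow> (LINT x::real|lborel. (0::real))"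
  proof (rule Bochner_Integration.integral_dominated_convergence[where w="\<lambda>x. (cmod (f x))\<^sup>2"])
    show "AE x in lborel. (\<lambda>n. (cmod (trunc n f x - f x))\<^sup>2) \<longlonglongrightarrow> 0"
    proof (intro always_eventually allI)
      fix x :: real
      obtain N :: nat where N: "\<bar>x\<bar> < real N" using reals_Archimedean2 by blast
      have "eventually (\<lambda>n. (cmod (trunc n f x - f x))\<^sup>2 = 0) sequentially"
        unfolding eventually_sequentially
      proof (intro exI allI impI)
        fix n assume "N \<le> n"
        then have "real N \<le> real n" by simp
        with N have "x \<in> {- real n..real n}" by (auto simp: abs_less_iff)
        then show "(cmod (trunc n f x - f x))\<^sup>2 = 0" by (simp add: trunc_def)
      qed
      then show "(\<lambda>n. (cmod (trunc n f x - f x))\<^sup>2) \<longlonglongrightarrow> 0"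
        by (rule tendsto_eventually)
    qed
    show "AE x in lborel. norm ((cmod (trunc n f x - f x))\<^sup>2) \<le> (cmod (f x))\<^sup>2" for n
      by (auto simp: trunc_def intro!: always_eventually split: split_indicator)
    show "(\<lambda>x. (cmod (trunc n f x - f x))\<^sup>2) \<in> borel_measurable lborel" for n
      unfolding trunc_def by measurable
  qed (auto intro: L2f_integrable[OF f])
  then show ?thesis by (simp add: nsq_def)
qed

lemma L12_diff: "L12 f \<Longrightarrow> L12 g \<Longrightarrow> L12 (\<lambda>x. f x - g x)"
  by (auto simp: L12_def intro: L2f_diff)

lemma L12_add: "L12 f \<Longrightarrow> L12 g \<Longrightarrow> L12 (\<lambda>x. f x + g x)"
  by (auto simp: L12_def intro: L2f_add)

lemma L12_scale: "L12 f \<Longrightarrow> L12 (\<lambda>x. c * f x)"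
  by (auto simp: L12_def intro: L2f_scale)

lemma L2f_FT0: "L12 f \<Longrightarrow> L2f (FT0 f)"
  by (simp add: L12_def FT0_contraction)

lemma nsq_FT0_diff:
  assumes "L12 f" "L12 g"
  shows "nsq (\<lambda>x. FT0 f x - FT0 g x) = nsq (\<lambda>x. f x - g x)"
proof -
  have "(\<lambda>x. FT0 f x - FT0 g x) = FT0 (\<lambda>x. f x - g x)"
    using assms by (auto simp: L12_def FT0_diff)
  then show ?thesis using L12_diff[OF assms] by (simp add: L12_def FT0_isometry)
qed

definition FF_approx :: "(real \<Rightarrow> complex) \<Rightarrow> (real \<Rightarrow> complex) \<Rightarrow> (nat \<Rightarrow> real \<Rightarrow> complex) \<Rightarrow> bool" where
  "FF_approx f g a \<longleftrightarrow> (\<forall>n. L12 (a n)) \<and> (\<lambda>n. nsq (\<lambda>x. a n x - f x)) \<longlonglongrightarrow> 0 \<and>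
     (\<lambda>n. nsq (\<lambda>x. FT0 (a n) x - g x)) \<longlonglongrightarrow> 0"

text \<open>A choice among the limits in the mean; only its class is determined, by
  \<open>FF_unique\<close>. The rules for \<open>FF\<close> therefore hold almost everywhere, and
  compatibility with null sets (\<open>FF_cong\<close>) has to be proved.\<close>

definition FF :: "(real \<Rightarrow> complex) \<Rightarrow> real \<Rightarrow> complex" where
  "FF f = (SOME g. L2f g \<and> (\<exists>a. FF_approx f g a))"

lemma FF_approx_exists:
  assumes f: "L2f f"
  shows "\<exists>g. L2f g \<and> (\<exists>a. FF_approx f g a)"
proof -
  \<comment> \<open>Truncations are thinned out until consecutive ones differ by at most
    \<open>(1/4) ^ k\<close> in squared norm, as \<open>L2f_complete\<close> requires; the extra
    quarter absorbs the factor 2 of \<open>nsq_add_le\<close>.\<close>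
  have "\<exists>N. nsq (\<lambda>x. trunc N f x - f x) \<le> (1/4) ^ k / 4" for k
  proof -
    have "eventually (\<lambda>n. nsq (\<lambda>x. trunc n f x - f x) < (1/4) ^ k / 4) sequentially"
      by (rule order_tendstoD(2)[OF trunc_tendsto[OF f]]) simp
    then show ?thesis by (auto simp: eventually_sequentially intro: less_imp_le)
  qed
  then obtain N where N: "\<And>k. nsq (\<lambda>x. trunc (N k) f x - f x) \<le> (1/4) ^ k / 4" by metis
  define a where "a k = trunc (N k) f" for k
  have a: "L12 (a k)" for k unfolding a_def by (rule L12_trunc[OF f])
  then have a2: "L2f (a k)" for k by (simp add: L12_def)
  have step: "nsq (\<lambda>x. FT0 (a (Suc k)) x - FT0 (a k) x) \<le> (1/4) ^ k" for k
  proof -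
    have "nsq (\<lambda>x. (a (Suc k) x - f x) + (f x - a k x)) \<le> 2 * nsq (\<lambda>x. a (Suc k) x - f x) + 2 * nsq (\<lambda>x. f x - a k x)"
      by (intro nsq_add_le L2f_diff a2 f)
    also have "\<dots> \<le> 2 * ((1/4) ^ Suc k / 4) + 2 * ((1/4) ^ k / 4)"
      using N[of k] N[of "Suc k"] unfolding a_def[abs_def] nsq_minus_commute[of f]
      by (intro add_mono mult_left_mono) auto
    also have "\<dots> \<le> (1/4) ^ k" by simp
    finally show ?thesis by (simp add: nsq_FT0_diff a)
  qed
  obtain g where g: "L2f g" "(\<lambda>n. nsq (\<lambda>x. FT0 (a n) x - g x)) \<longlonglongrightarrow> 0"
    using L2f_complete[of "\<lambda>n. FT0 (a n)", OF L2f_FT0[OF a] step] by blast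
  have "(\<lambda>n. nsq (\<lambda>x. a n x - f x)) \<longlonglongrightarrow> 0"
  proof (rule tendsto_sandwich[OF _ _ tendsto_const])
    show "(\<lambda>k. (1/4::real) ^ k / 4) \<longlonglongrightarrow> 0"
      by (intro tendsto_divide_zero LIMSEQ_power_zero) auto
  qed (use N in \<open>auto simp: nsq_nonneg a_def\<close>)
  with g a show ?thesis unfolding FF_approx_def by blast
qed

lemma L2f_FF: "L2f f \<Longrightarrow> L2f (FF f)"
  and FF_approx_FF: "L2f f \<Longrightarrow> \<exists>a. FF_approx f (FF f) a"
  using someI_ex[OF FF_approx_exists] by (auto simp: FF_def)

lemma FF_unique:
  assumes f: "L2f f" and g: "L2f g" and b: "FF_approx f g b"
  shows "AE x in lborel. FF f x = g x"
proof -
  obtain a where a: "FF_approx f (FF f) a" using FF_approx_FF[OF f] by blast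
  have L: "L12 (a n)" "L12 (b n)" for n using a b by (auto simp: FF_approx_def)
  then have L': "L2f (a n)" "L2f (b n)" for n by (auto simp: L12_def)
  note LL = L2f_diff L2f_FT0[OF L(1)] L2f_FT0[OF L(2)] L2f_FF[OF f] f g L'
  \<comment> \<open>\<open>FT0 (a n)\<close> and \<open>FT0 (b n)\<close> are inserted, then
    \<open>f\<close> between \<open>a n\<close> and \<open>b n\<close> once the isometry has removed
    the transforms; each insertion doubles the constants.\<close>
  have "nsq (\<lambda>x. FF f x - g x) \<le>
    2 * nsq (\<lambda>x. FT0 (a n) x - FF f x) + (4 * nsq (\<lambda>x. FT0 (b n) x - g x) +
      (8 * nsq (\<lambda>x. a n x - f x) + 8 * nsq (\<lambda>x. b n x - f x)))" for n
  proof -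
    have "nsq (\<lambda>x. (FF f x - FT0 (a n) x) + (FT0 (a n) x - g x))
        \<le> 2 * nsq (\<lambda>x. FF f x - FT0 (a n) x) + 2 * nsq (\<lambda>x. FT0 (a n) x - g x)"
      by (intro nsq_add_le LL)
    moreover have "nsq (\<lambda>x. (FT0 (a n) x - FT0 (b n) x) + (FT0 (b n) x - g x))
        \<le> 2 * nsq (\<lambda>x. FT0 (a n) x - FT0 (b n) x) + 2 * nsq (\<lambda>x. FT0 (b n) x - g x)"
      by (intro nsq_add_le LL)
    moreover have "nsq (\<lambda>x. (a n x - f x) + (f x - b n x))
        \<le> 2 * nsq (\<lambda>x. a n x - f x) + 2 * nsq (\<lambda>x. f x - b n x)"
      by (intro nsq_add_le LL)
    ultimately show ?thesis
      unfolding nsq_FT0_diff[OF L] nsq_minus_commute[of "FF f" "FT0 (a n)"] nsq_minus_commute[of f "b n"]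
      by simp
  qed
  moreover have "(\<lambda>n. 2 * nsq (\<lambda>x. FT0 (a n) x - FF f x) + (4 * nsq (\<lambda>x. FT0 (b n) x - g x) +
      (8 * nsq (\<lambda>x. a n x - f x) + 8 * nsq (\<lambda>x. b n x - f x)))) \<longlonglongrightarrow> 0"
    using a b unfolding FF_approx_def by (intro tendsto_add_zero tendsto_mult_right_zero) auto
  ultimately have "nsq (\<lambda>x. FF f x - g x) \<le> 0"
    by (intro LIMSEQ_le_const) auto
  then have "nsq (\<lambda>x. FF f x - g x) = 0" using nsq_nonneg by (intro antisym)
  from nsq_eq_0[OF L2f_diff[OF L2f_FF[OF f] g] this] show ?thesis by auto
qed

lemma FF_eq_FT0:
  assumes "L2f f" "integrable lborel f"
  shows "AE x in lborel. FF f x = FT0 f x"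
  using assms by (intro FF_unique[where b="\<lambda>n. f"]) (auto simp: FF_approx_def L12_def FT0_contraction nsq_def)

lemma FF_cong:
  assumes f: "L2f f" and g: "L2f g" and ae: "AE x in lborel. f x = g x"
  shows "AE x in lborel. FF f x = FF g x"
proof -
  obtain b where b: "FF_approx g (FF g) b" using FF_approx_FF[OF g] by blast
  have "nsq (\<lambda>x. b n x - f x) = nsq (\<lambda>x. b n x - g x)" for n
  proof (rule nsq_cong_AE)
    have "L2f (b n)" using b by (auto simp: FF_approx_def L12_def)
    note [measurable] = this[THEN L2f_measurable] f[THEN L2f_measurable] g[THEN L2f_measurable]
    show "(\<lambda>x. b n x - f x) \<in> borel_measurable borel" "(\<lambda>x. b n x - g x) \<in> borel_measurable borel" by measurable
  qed (use ae in auto)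
  with b have "FF_approx f (FF g) b" by (simp add: FF_approx_def)
  then show ?thesis by (intro FF_unique f L2f_FF g)
qed

lemma FF_add:
  assumes f: "L2f f" and g: "L2f g"
  shows "AE x in lborel. FF (\<lambda>x. f x + g x) x = FF f x + FF g x"
proof -
  obtain a where a: "FF_approx f (FF f) a" using FF_approx_FF[OF f] by blast
  obtain b where b: "FF_approx g (FF g) b" using FF_approx_FF[OF g] by blast
  have L: "L12 (a n)" "L12 (b n)" for n using a b by (auto simp: FF_approx_def)
  then have L': "L2f (a n)" "L2f (b n)" "integrable lborel (a n)" "integrable lborel (b n)" for n by (auto simp: L12_def)
  have z: "(\<lambda>n. nsq (\<lambda>x. u n x + v n x)) \<longlonglongrightarrow> 0"
    if "\<And>n. L2f (u n)" "\<And>n. L2f (v n)" "(\<lambda>n. nsq (u n)) \<longlonglongrightarrow> 0" "(\<lambda>n. nsq (v n)) \<longlonglongrightarrow> 0" for u v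
  proof (rule tendsto_sandwich[OF _ _ tendsto_const])
    show "(\<lambda>n. 2 * nsq (u n) + 2 * nsq (v n)) \<longlonglongrightarrow> 0"
      using that by (intro tendsto_add_zero tendsto_mult_right_zero)
  qed (use that in \<open>auto simp: nsq_nonneg nsq_add_le\<close>)
  have "(\<lambda>n. nsq (\<lambda>x. (a n x - f x) + (b n x - g x))) \<longlonglongrightarrow> 0"
    using a b by (intro z L2f_diff f g L') (auto simp: FF_approx_def)
  moreover have "(\<lambda>n. nsq (\<lambda>x. (FT0 (a n) x - FF f x) + (FT0 (b n) x - FF g x))) \<longlonglongrightarrow> 0"
    using a b by (intro z L2f_diff L2f_FF f g L2f_FT0 L) (auto simp: FF_approx_def)
  ultimately have "FF_approx (\<lambda>x. f x + g x) (\<lambda>x. FF f x + FF g x) (\<lambda>n x. a n x + b n x)"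
    using L L' by (simp add: FF_approx_def L12_add FT0_add algebra_simps)
  then show ?thesis by (intro FF_unique L2f_add L2f_FF f g)
qed

lemma FF_scale:
  assumes f: "L2f f"
  shows "AE x in lborel. FF (\<lambda>x. c * f x) x = c * FF f x"
proof -
  obtain a where a: "FF_approx f (FF f) a" using FF_approx_FF[OF f] by blast
  have eq: "nsq (\<lambda>x. c * u x - c * v x) = (cmod c)\<^sup>2 * nsq (\<lambda>x. u x - v x)" for u v
    by (simp add: nsq_scale flip: right_diff_distrib)
  have "FF_approx (\<lambda>x. c * f x) (\<lambda>x. c * FF f x) (\<lambda>n x. c * a n x)"
    using a by (auto simp: FF_approx_def L12_scale FT0_scale eq intro!: tendsto_mult_right_zero)
  then show ?thesis by (intro FF_unique L2f_scale L2f_FF f)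
qed

lemma nsq_FF:
  assumes f: "L2f f"
  shows "nsq (FF f) = nsq f"
proof -
  obtain a where a: "FF_approx f (FF f) a" using FF_approx_FF[OF f] by blast
  have L: "L12 (a n)" for n using a by (auto simp: FF_approx_def)
  have "(\<lambda>n. nsq (FT0 (a n))) \<longlonglongrightarrow> nsq (FF f)"
    using a by (intro nsq_tendsto L2f_FT0 L L2f_FF f) (simp add: FF_approx_def)
  moreover have "(\<lambda>n. nsq (a n)) \<longlonglongrightarrow> nsq f"
    using a L by (intro nsq_tendsto f) (auto simp: FF_approx_def L12_def)
  moreover have "nsq (FT0 (a n)) = nsq (a n)" for n
    using L by (simp add: L12_def FT0_isometry)
  ultimately show ?thesis using LIMSEQ_unique by auto
qed

lemma ip_FF: "L2f f \<Longrightarrow> L2f g \<Longrightarrow> ip (FF f) (FF g) = ip f g"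
  by (rule isometry_imp_ip) (auto simp: L2f_FF FF_add FF_scale nsq_FF)

section \<open>The inverse transformation as adjoint\<close>

definition FI :: "(real \<Rightarrow> complex) \<Rightarrow> real \<Rightarrow> complex" where
  "FI f x = FF f (- x)"

lemma L2f_FI: "L2f f \<Longrightarrow> L2f (FI f)"
  unfolding FI_def[abs_def] by (intro L2f_reflect L2f_FF)

lemma ip_FI: "L2f f \<Longrightarrow> L2f g \<Longrightarrow> ip (FI f) (FI g) = ip f g"
  unfolding FI_def[abs_def] by (simp add: ip_reflect ip_FF)

lemma FI_cong:
  assumes "L2f f" "L2f g" "AE x in lborel. f x = g x"
  shows "AE x in lborel. FI f x = FI g x"
  using AE_lborel_uminus[OF FF_cong[OF assms]] by (simp add: FI_def)

lemma FI_add: "L2f f \<Longrightarrow> L2f g \<Longrightarrow> AE x in lborel. FI (\<lambda>x. f x + g x) x = FI f x + FI g x"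
  using AE_lborel_uminus[OF FF_add, of f g] by (simp add: FI_def)

lemma FI_scale: "L2f f \<Longrightarrow> AE x in lborel. FI (\<lambda>x. c * f x) x = c * FI f x"
  using AE_lborel_uminus[OF FF_scale, of f c] by (simp add: FI_def)

lemma FI_eq_FT0:
  assumes "L2f f" "integrable lborel f"
  shows "AE x in lborel. FI f x = FT0 f (- x)"
  using AE_lborel_uminus[OF FF_eq_FT0[OF assms]] by (simp add: FI_def)

lemma FT0_reflect: "FT0 (\<lambda>y. g (- y)) t = FT0 g (- t)"
  unfolding FT0_def
  by (subst lborel_integral_real_affine[where c="-1" and t=0]) auto

lemma ip_FT0_adjoint:
  assumes f: "L12 f" and g: "L12 g"
  shows "ip (FT0 f) g = ip f (\<lambda>x. FT0 g (- x))"
proof -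
  have f': "integrable lborel (\<lambda>y. cnj (f y))" and g': "integrable lborel (\<lambda>y. g (- y))"
    using f g lborel_integrable_real_affine[of g "-1" 0] by (auto simp: L12_def)
  have "ip (FT0 f) g = (LINT t|lborel. FT0 (\<lambda>y. cnj (f y)) (- t) * g t)"
    by (simp add: ip_def FT0_cnj)
  also have "\<dots> = (LINT t|lborel. FT0 (\<lambda>y. cnj (f y)) t * g (- t))"
    by (subst lborel_integral_real_affine[where c="-1" and t=0]) auto
  also have "\<dots> = (LINT y|lborel. cnj (f y) * FT0 (\<lambda>y. g (- y)) y)"
    by (rule FT0_multiplication[OF f' g'])
  finally show ?thesis by (simp add: ip_def FT0_reflect)
qed

text \<open>Adjointness is the multiplication formula on integrable functions, carried over to L^2
  by approximating both arguments.\<close>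

lemma ip_FF_FI:
  assumes f: "L2f f" and g: "L2f g"
  shows "ip (FF f) g = ip f (FI g)"
proof -
  obtain a where a: "FF_approx f (FF f) a" using FF_approx_FF[OF f] by blast
  obtain b where b: "FF_approx g (FF g) b" using FF_approx_FF[OF g] by blast
  have L: "L12 (a n)" "L12 (b n)" for n using a b by (auto simp: FF_approx_def)
  then have L': "L2f (a n)" "L2f (b n)" for n by (auto simp: L12_def)
  have "(\<lambda>n. ip (FT0 (a n)) (b n)) \<longlonglongrightarrow> ip (FF f) g"
    using a b by (intro ip_tendsto L2f_FT0 L L' L2f_FF f g) (auto simp: FF_approx_def)
  moreover have "(\<lambda>n. ip (a n) (\<lambda>x. FT0 (b n) (- x))) \<longlonglongrightarrow> ip f (FI g)"
  proof (intro ip_tendsto L' L2f_FI f g L2f_reflect L2f_FT0 L)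
    have "nsq (\<lambda>x. FT0 (b n) (- x) - FI g x) = nsq (\<lambda>x. FT0 (b n) x - FF g x)" for n
      unfolding FI_def using nsq_reflect[of "\<lambda>x. FT0 (b n) x - FF g x"] by simp
    then show "(\<lambda>n. nsq (\<lambda>x. FT0 (b n) (- x) - FI g x)) \<longlonglongrightarrow> 0"
      using b by (simp add: FF_approx_def)
  qed (use a in \<open>auto simp: FF_approx_def\<close>)
  ultimately show ?thesis
    using LIMSEQ_unique by (auto simp: ip_FT0_adjoint L)
qed

lemma ip_FI_FF: "L2f f \<Longrightarrow> L2f g \<Longrightarrow> ip (FI f) g = ip f (FF g)"
  by (metis ip_FF_FI ip_cnj)

text \<open>\<open>FI\<close> is both adjoint to \<open>FF\<close> and isometric, so pairing FF (FI
  f) with h gives (FI h, FI f) = (h, f). Surjectivity of \<open>FF\<close> is read off from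
  this.\<close>

theorem FF_FI: "L2f f \<Longrightarrow> AE x in lborel. FF (FI f) x = f x"
  by (rule ip_eq_imp_AE_eq) (auto simp: L2f_FF L2f_FI ip_FI simp flip: ip_FI_FF)

theorem FI_FF: "L2f f \<Longrightarrow> AE x in lborel. FI (FF f) x = f x"
  by (rule ip_eq_imp_AE_eq) (auto simp: L2f_FF L2f_FI ip_FF simp flip: ip_FF_FI)

section \<open>From functions to classes\<close>

lemma borel_measurable_leb:
  fixes f :: "real \<Rightarrow> complex"
  assumes "S \<in> sets borel"
  shows "f \<in> borel_measurable (leb S) \<longleftrightarrow> (\<lambda>x. indicator S x * f x) \<in> borel_measurable borel"
  unfolding leb_def using assms
  by (subst borel_measurable_restrict_space_iff) (auto simp: indicator_scaleR_eq_if intro!: arg_cong2[where f="(\<in>)"] split: split_indicator)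

lemma AE_leb: "S \<in> sets borel \<Longrightarrow> (AE x in leb S. P x) \<longleftrightarrow> (AE x in lborel. x \<in> S \<longrightarrow> P x)"
  unfolding leb_def by (rule AE_restrict_space_iff) simp

lemma integral_leb:
  fixes f :: "real \<Rightarrow> complex"
  shows "S \<in> sets borel \<Longrightarrow> integral\<^sup>L (leb S) f = (LINT x|lborel. indicator S x * f x)"
  unfolding leb_def
  by (subst integral_restrict_space) (auto intro!: Bochner_Integration.integral_cong split: split_indicator)

lemma square_int_iff: "S \<in> sets borel \<Longrightarrow> square_int S f \<longleftrightarrow> L2f (\<lambda>x. indicator S x * f x)"
proof -
  assume S: "S \<in> sets borel"
  have "(\<lambda>x. indicator S x *\<^sub>R (cmod (f x))\<^sup>2) = (\<lambda>x. (cmod (indicator S x * f x))\<^sup>2)"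
    by (auto split: split_indicator)
  then show ?thesis
    unfolding square_int_def L2f_def borel_measurable_leb[OF S]
    using S by (simp add: leb_def integrable_restrict_space)
qed

lemma ae_class_eqI:
  assumes "S \<in> sets borel" "AE x in lborel. x \<in> S \<longrightarrow> f x = g x"
  shows "ae_class S f = ae_class S g"
proof -
  have "AE x in leb S. f x = g x" using assms by (simp add: AE_leb)
  have "(AE x in leb S. h x = f x) \<longleftrightarrow> (AE x in leb S. h x = g x)" for h
  proof
    assume "AE x in leb S. h x = f x"
    with \<open>AE x in leb S. f x = g x\<close> show "AE x in leb S. h x = g x" by eventually_elim simp
  next
    assume "AE x in leb S. h x = g x"
    with \<open>AE x in leb S. f x = g x\<close> show "AE x in leb S. h x = f x" by eventually_elim simp
  qed
  then show ?thesis by (simp add: ae_class_def)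
qed

lemma rep_ae_class:
  assumes S: "S \<in> sets borel" and f: "(\<lambda>x. indicator S x * f x) \<in> borel_measurable borel"
  shows "rep (ae_class S f) \<in> borel_measurable (leb S)"
    "AE x in lborel. x \<in> S \<longrightarrow> rep (ae_class S f) x = f x"
proof -
  have "f \<in> ae_class S f"
    using assms by (simp add: ae_class_def borel_measurable_leb)
  then have "rep (ae_class S f) \<in> ae_class S f"
    unfolding rep_def by (rule someI[where P="\<lambda>g. g \<in> ae_class S f"])
  then show "rep (ae_class S f) \<in> borel_measurable (leb S)"
    "AE x in lborel. x \<in> S \<longrightarrow> rep (ae_class S f) x = f x"
    using S by (auto simp: ae_class_def AE_leb)
qed

section \<open>Square integrable functions supported in a set, and their classes\<close>

definition L2on :: "real set \<Rightarrow> (real \<Rightarrow> complex) \<Rightarrow> bool" where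
  "L2on S f \<longleftrightarrow> L2f f \<and> (\<forall>x. x \<notin> S \<longrightarrow> f x = 0)"

text \<open>Extension by zero embeds every L^2(S) isometrically in L^2(R), where the operators of
  all intervals can be compared.\<close>

definition ext :: "real set \<Rightarrow> fclass \<Rightarrow> real \<Rightarrow> complex" where
  "ext S u x = (if x \<in> S then rep u x else 0)"

lemma L2on_L2f: "L2on S f \<Longrightarrow> L2f f"
  by (simp add: L2on_def)

lemma L2on_indicator: "L2f f \<Longrightarrow> S \<in> sets borel \<Longrightarrow> L2on S (\<lambda>x. indicator S x * f x)"
  by (simp add: L2on_def L2f_indicator)

lemma L2on_UNIV: "L2on UNIV f \<longleftrightarrow> L2f f"
  by (simp add: L2on_def)

lemma L2on_add: "L2on S f \<Longrightarrow> L2on S g \<Longrightarrow> L2on S (\<lambda>x. f x + g x)"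
  by (simp add: L2on_def L2f_add)

lemma L2on_scale: "L2on S f \<Longrightarrow> L2on S (\<lambda>x. c * f x)"
  by (simp add: L2on_def L2f_scale)

lemma ae_class_L2:
  assumes "S \<in> sets borel" "L2f f"
  shows "ae_class S f \<in> L2 S"
  using assms by (auto simp: L2_def square_int_iff L2f_indicator)

lemma ext_ae_class:
  assumes S: "S \<in> sets borel" and f: "L2f f"
  shows "AE x in lborel. ext S (ae_class S f) x = indicator S x * f x"
proof -
  have "(\<lambda>x. indicator S x * f x) \<in> borel_measurable borel"
    using L2f_indicator[OF f S] by (rule L2f_measurable)
  from rep_ae_class(2)[OF S this] show ?thesis
    by eventually_elim (auto simp: ext_def)
qed

lemma ext_L2:
  assumes S: "S \<in> sets borel" and u: "u \<in> L2 S"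
  shows "L2on S (ext S u)" "ae_class S (ext S u) = u"
proof -
  obtain f where f: "u = ae_class S f" "square_int S f" using u by (auto simp: L2_def)
  then have L: "L2f (\<lambda>x. indicator S x * f x)" using S by (simp add: square_int_iff)
  note r = rep_ae_class[OF S L2f_measurable[OF L]]
  have e: "ext S u = (\<lambda>x. indicator S x * rep u x)" by (auto simp: ext_def split: split_indicator)
  have "ext S u \<in> borel_measurable borel"
    unfolding e using r(1) S by (simp add: f(1) borel_measurable_leb)
  moreover have "AE x in lborel. ext S u x = indicator S x * f x"
    unfolding e using r(2) by eventually_elim (auto simp: f(1) split: split_indicator)
  ultimately have "L2f (ext S u)"
    by (rule L2f_cong_AE[OF L])
  then show "L2on S (ext S u)" by (simp add: L2on_def ext_def)
  have "ae_class S (ext S u) = ae_class S f"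
    using r(2) by (intro ae_class_eqI S) (auto simp: ext_def f(1) elim: eventually_mono)
  then show "ae_class S (ext S u) = u" by (simp add: f(1))
qed

lemma L2f_ext: "S \<in> sets borel \<Longrightarrow> u \<in> L2 S \<Longrightarrow> L2f (ext S u)"
  by (rule L2on_L2f[OF ext_L2(1)])

lemma ae_class_eq_iff:
  assumes "S \<in> sets borel" "L2on S f" "L2on S g"
  shows "ae_class S f = ae_class S g \<longleftrightarrow> (AE x in lborel. f x = g x)"
proof
  assume eq: "ae_class S f = ae_class S g"
  from ext_ae_class[OF assms(1) assms(2)[THEN L2on_L2f]] ext_ae_class[OF assms(1) assms(3)[THEN L2on_L2f]]
  show "AE x in lborel. f x = g x"
  proof eventually_elim
    case (elim x)
    then show ?case using assms(2,3) by (cases "x \<in> S") (auto simp: eq L2on_def)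
  qed
qed (auto intro!: ae_class_eqI assms elim: eventually_mono)

lemma ext_ae_class_L2on:
  assumes "S \<in> sets borel" "L2on S f"
  shows "AE x in lborel. ext S (ae_class S f) x = f x"
  using ext_ae_class[OF assms(1) assms(2)[THEN L2on_L2f]]
proof eventually_elim
  case (elim x)
  then show ?case using assms(2) by (cases "x \<in> S") (auto simp: L2on_def)
qed

lemma ext_ae_class_UNIV: "L2f f \<Longrightarrow> AE x in lborel. ext UNIV (ae_class UNIV f) x = f x"
  by (rule ext_ae_class_L2on) (auto simp: L2on_UNIV)

lemma L2_inner_ext:
  assumes "S \<in> sets borel"
  shows "L2_inner S u v = ip (ext S u) (ext S v)"
  unfolding L2_inner_def ip_def integral_leb[OF assms]
  by (intro Bochner_Integration.integral_cong) (auto simp: ext_def split: split_indicator)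

lemma L2_add_ext: "S \<in> sets borel \<Longrightarrow> L2_add S u v = ae_class S (\<lambda>x. ext S u x + ext S v x)"
  unfolding L2_add_def by (intro ae_class_eqI) (auto simp: ext_def)

lemma L2_scale_ext: "S \<in> sets borel \<Longrightarrow> L2_scale S z u = ae_class S (\<lambda>x. z * ext S u x)"
  unfolding L2_scale_def by (intro ae_class_eqI) (auto simp: ext_def)

lemma L2_add_closed: "S \<in> sets borel \<Longrightarrow> u \<in> L2 S \<Longrightarrow> v \<in> L2 S \<Longrightarrow> L2_add S u v \<in> L2 S"
  by (simp add: L2_add_ext ae_class_L2 L2f_add L2f_ext)

lemma L2_scale_closed: "S \<in> sets borel \<Longrightarrow> u \<in> L2 S \<Longrightarrow> L2_scale S z u \<in> L2 S"
  by (simp add: L2_scale_ext ae_class_L2 L2f_scale L2f_ext)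

text \<open>An isomorphism of classes is given by a map \<open>v\<close> on functions extended by
  zero that is linear, isometric and onto up to null sets; injectivity is a consequence of the
  preserved inner products.\<close>

lemma hilbert_isoI:
  assumes S: "S \<in> sets borel" and T: "T \<in> sets borel"
    and V: "\<And>u. u \<in> L2 S \<Longrightarrow> V u = ae_class T (v (ext S u))"
    and L: "\<And>f. L2on S f \<Longrightarrow> L2on T (v f)"
    and cong: "\<And>f g. L2on S f \<Longrightarrow> L2on S g \<Longrightarrow> AE x in lborel. f x = g x \<Longrightarrow> AE x in lborel. v f x = v g x"
    and add: "\<And>f g. L2on S f \<Longrightarrow> L2on S g \<Longrightarrow> AE x in lborel. v (\<lambda>x. f x + g x) x = v f x + v g x"
    and scale: "\<And>c f. L2on S f \<Longrightarrow> AE x in lborel. v (\<lambda>x. c * f x) x = c * v f x"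
    and ip: "\<And>f g. L2on S f \<Longrightarrow> L2on S g \<Longrightarrow> ip (v f) (v g) = ip f g"
    and surj: "\<And>g. L2on T g \<Longrightarrow> \<exists>f. L2on S f \<and> (AE x in lborel. v f x = g x)"
  shows "hilbert_iso S T V"
proof -
  have e: "L2on S (ext S u)" if "u \<in> L2 S" for u by (rule ext_L2(1)[OF S that])
  have ev: "AE x in lborel. ext T (V u) x = v (ext S u) x" if "u \<in> L2 S" for u
    unfolding V[OF that] by (intro ext_ae_class_L2on T L e that)
  have Vm: "V u \<in> L2 T" if "u \<in> L2 S" for u
    unfolding V[OF that] by (rule ae_class_L2[OF T L2on_L2f[OF L[OF e[OF that]]]])
  have inn: "L2_inner T (V u) (V w) = L2_inner S u w" if u: "u \<in> L2 S" "w \<in> L2 S" for u w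
  proof -
    have "ip (ext T (V u)) (ext T (V w)) = ip (v (ext S u)) (v (ext S w))"
    proof (intro ip_cong_AE ev u)
      show "ext T (V u) \<in> borel_measurable borel" "ext T (V w) \<in> borel_measurable borel"
        using Vm u by (intro L2f_measurable L2f_ext T; simp)+
      show "v (ext S u) \<in> borel_measurable borel" "v (ext S w) \<in> borel_measurable borel"
        using u by (auto intro: L2f_measurable[OF L2on_L2f[OF L[OF e]]])
    qed
    then show ?thesis using S T u by (simp add: L2_inner_ext ip e)
  qed
  have inj: "inj_on V (L2 S)"
  proof (rule inj_onI)
    fix u w assume u: "u \<in> L2 S" "w \<in> L2 S" and eq: "V u = V w"
    let ?f = "ext S u" and ?g = "ext S w"
    have f: "L2on S ?f" "L2on S ?g" using u e by auto
    note Lf = f[THEN L2on_L2f] and Lv = f[THEN L, THEN L2on_L2f]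
    have ae: "AE x in lborel. v ?f x = v ?g x"
      using eq u by (simp add: V ae_class_eq_iff[OF T L L] f)
    \<comment> \<open>The images agree almost everywhere, so the four inner products formed from
      \<open>?f\<close> and \<open>?g\<close> coincide and their squared distance is 0.\<close>
    have 1: "ip (v ?f) (v ?g) = ip (v ?f) (v ?f)" "ip (v ?g) (v ?f) = ip (v ?f) (v ?f)" "ip (v ?g) (v ?g) = ip (v ?f) (v ?f)"
      using ae Lv by (intro ip_cong_AE; auto intro: L2f_measurable elim: eventually_mono)+
    have "complex_of_real (nsq (\<lambda>x. ?f x - ?g x)) = ip ?f ?f - ip ?f ?g - (ip ?g ?f - ip ?g ?g)"
      unfolding ip_self[symmetric] using Lf by (simp add: ip_diff_left ip_diff_right L2f_diff)
    also have "\<dots> = 0"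
      using 1 ip f by simp
    finally have "nsq (\<lambda>x. ?f x - ?g x) = 0" by simp
    from nsq_eq_0[OF L2f_diff[OF Lf] this] have "AE x in lborel. ?f x = ?g x" by auto
    then have "ae_class S ?f = ae_class S ?g" by (simp add: ae_class_eq_iff S f)
    then show "u = w" using u by (simp add: ext_L2[OF S])
  qed
  have img: "V ` L2 S = L2 T"
  proof (intro equalityI subsetI)
    fix w assume "w \<in> V ` L2 S"
    then show "w \<in> L2 T" using Vm by auto
  next
    fix w assume w: "w \<in> L2 T"
    obtain f where f: "L2on S f" "AE x in lborel. v f x = ext T w x"
      using surj[of "ext T w"] ext_L2[OF T w] by auto
    have u: "ae_class S f \<in> L2 S" by (rule ae_class_L2[OF S L2on_L2f[OF f(1)]])
    have "AE x in lborel. v (ext S (ae_class S f)) x = v f x"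
      by (intro cong e u f ext_ae_class_L2on S)
    with f(2) have "AE x in lborel. v (ext S (ae_class S f)) x = ext T w x" by eventually_elim simp
    then have "V (ae_class S f) = ae_class T (ext T w)"
      unfolding V[OF u] by (intro ae_class_eqI T) (auto elim: eventually_mono)
    then show "w \<in> V ` L2 S" using u by (simp add: ext_L2[OF T w] image_iff) metis
  qed
  have ad: "V (L2_add S u w) = L2_add T (V u) (V w)" if u: "u \<in> L2 S" "w \<in> L2 S" for u w
  proof -
    have "AE x in lborel. ext S (L2_add S u w) x = ext S u x + ext S w x"
      unfolding L2_add_ext[OF S] by (intro ext_ae_class_L2on S L2on_add e u)
    then have "AE x in lborel. v (ext S (L2_add S u w)) x = v (\<lambda>x. ext S u x + ext S w x) x"
      by (intro cong e L2on_add L2_add_closed S u)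
    then have "AE x in lborel. v (ext S (L2_add S u w)) x = ext T (V u) x + ext T (V w) x"
      using add[OF e[OF u(1)] e[OF u(2)]] ev[OF u(1)] ev[OF u(2)] by eventually_elim simp
    then show ?thesis
      unfolding V[OF L2_add_closed[OF S u]] L2_add_ext[OF T] by (intro ae_class_eqI T) (auto elim: eventually_mono)
  qed
  have sc: "V (L2_scale S z u) = L2_scale T z (V u)" if u: "u \<in> L2 S" for u z
  proof -
    have "AE x in lborel. ext S (L2_scale S z u) x = z * ext S u x"
      unfolding L2_scale_ext[OF S] by (intro ext_ae_class_L2on S L2on_scale e u)
    then have "AE x in lborel. v (ext S (L2_scale S z u)) x = v (\<lambda>x. z * ext S u x) x"
      by (intro cong e L2on_scale L2_scale_closed S u)
    then have "AE x in lborel. v (ext S (L2_scale S z u)) x = z * ext T (V u) x"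
      using scale[OF e[OF u], of z] ev[OF u] by eventually_elim simp
    then show ?thesis
      unfolding V[OF L2_scale_closed[OF S u]] L2_scale_ext[OF T] by (intro ae_class_eqI T) (auto elim: eventually_mono)
  qed
  show ?thesis unfolding hilbert_iso_def bij_betw_def by (intro conjI ballI allI inj img ad sc inn)
qed

section \<open>Composition and inversion of isomorphisms and conjugations\<close>

lemma hilbert_iso_mem: "hilbert_iso S T V \<Longrightarrow> u \<in> L2 S \<Longrightarrow> V u \<in> L2 T"
  unfolding hilbert_iso_def by (blast dest: bij_betwE)

lemma hilbert_iso_comp:
  assumes V: "hilbert_iso S T V" and W: "hilbert_iso T U W"
  shows "hilbert_iso S U (W \<circ> V)"
proof -
  note m = hilbert_iso_mem[OF V]
  have 1: "bij_betw (W \<circ> V) (L2 S) (L2 U)"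
    using V W unfolding hilbert_iso_def by (blast intro: bij_betw_trans)
  have 2: "W (V (L2_scale S z u)) = L2_scale U z (W (V u))" if u: "u \<in> L2 S" for z u
    using V W u m[OF u] unfolding hilbert_iso_def by metis
  have 3: "W (V (L2_add S u v)) = L2_add U (W (V u)) (W (V v))" if u: "u \<in> L2 S" "v \<in> L2 S" for u v
    using V W u m[OF u(1)] m[OF u(2)] unfolding hilbert_iso_def by metis
  have 4: "L2_inner U (W (V u)) (W (V v)) = L2_inner S u v" if u: "u \<in> L2 S" "v \<in> L2 S" for u v
    using V W u m[OF u(1)] m[OF u(2)] unfolding hilbert_iso_def by metis
  show ?thesis unfolding hilbert_iso_def comp_def by (intro conjI ballI allI 1[unfolded comp_def] 2 3 4)
qed

lemma hilbert_iso_inv_into: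
  assumes S: "S \<in> sets borel" and V: "hilbert_iso S T V"
  shows "hilbert_iso T S (inv_into (L2 S) V)"
proof -
  let ?I = "inv_into (L2 S) V"
  have b: "bij_betw V (L2 S) (L2 T)" using V by (simp add: hilbert_iso_def)
  have I: "?I w \<in> L2 S" "V (?I w) = w" if "w \<in> L2 T" for w
    using b that by (auto simp: bij_betw_def inv_into_into f_inv_into_f)
  have inv: "?I (V u) = u" if "u \<in> L2 S" for u
    using b that by (simp add: bij_betw_def)
  show ?thesis
    unfolding hilbert_iso_def
  proof (intro conjI ballI allI)
    show "bij_betw ?I (L2 T) (L2 S)" by (rule bij_betw_inv_into[OF b])
    fix u v assume u: "u \<in> L2 T" and v: "v \<in> L2 T"
    show "?I (L2_add T u v) = L2_add S (?I u) (?I v)"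
      using V inv[OF L2_add_closed[OF S I(1)[OF u] I(1)[OF v]]] I u v by (simp add: hilbert_iso_def)
    show "L2_inner S (?I u) (?I v) = L2_inner T u v"
      using V I u v unfolding hilbert_iso_def by metis
  next
    fix z u assume u: "u \<in> L2 T"
    show "?I (L2_scale T z u) = L2_scale S z (?I u)"
      using V inv[OF L2_scale_closed[OF S I(1)[OF u]]] I u by (simp add: hilbert_iso_def)
  qed
qed

text \<open>Multiplying Y = V X V^-1 by V from the right removes the inverse; that \<open>Y\<close>
  preserves \<open>L2 T\<close> then follows from the intertwining relation.\<close>

lemma conjugate_via_iff:
  "conjugate_via S T V X Y \<longleftrightarrow>
     hilbert_iso S T V \<and> X ` L2 S \<subseteq> L2 S \<and> (\<forall>u\<in>L2 S. Y (V u) = V (X u))"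
proof (cases "hilbert_iso S T V")
  case True
  then have b: "bij_betw V (L2 S) (L2 T)" by (simp add: hilbert_iso_def)
  have I: "inv_into (L2 S) V w \<in> L2 S" "V (inv_into (L2 S) V w) = w" if "w \<in> L2 T" for w
    using b that by (auto simp: bij_betw_def inv_into_into f_inv_into_f)
  have inv: "inv_into (L2 S) V (V u) = u" if "u \<in> L2 S" for u
    using b that by (simp add: bij_betw_def)
  show ?thesis
  proof
    assume "conjugate_via S T V X Y"
    then show "hilbert_iso S T V \<and> X ` L2 S \<subseteq> L2 S \<and> (\<forall>u\<in>L2 S. Y (V u) = V (X u))"
      using inv hilbert_iso_mem[OF True] by (simp add: conjugate_via_def)
  next
    assume *: "hilbert_iso S T V \<and> X ` L2 S \<subseteq> L2 S \<and> (\<forall>u\<in>L2 S. Y (V u) = V (X u))"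
    then have Y: "Y w = V (X (inv_into (L2 S) V w))" if "w \<in> L2 T" for w
      using I[OF that] by metis
    moreover have "Y ` L2 T \<subseteq> L2 T"
      using Y * I hilbert_iso_mem[OF True] by (auto simp: image_subset_iff)
    ultimately show "conjugate_via S T V X Y" using * by (simp add: conjugate_via_def)
  qed
qed (simp add: conjugate_via_def)

lemma conjugate_viaD:
  assumes "conjugate_via S T V X Y"
  shows "hilbert_iso S T V" "\<And>u. u \<in> L2 S \<Longrightarrow> X u \<in> L2 S" "\<And>w. w \<in> L2 T \<Longrightarrow> Y w \<in> L2 T"
    "\<And>u. u \<in> L2 S \<Longrightarrow> Y (V u) = V (X u)"
    "\<And>w. w \<in> L2 T \<Longrightarrow> Y w = V (X (inv_into (L2 S) V w))"
proof -
  from assms show "hilbert_iso S T V" by (simp only: conjugate_via_def)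
  from assms have "X ` L2 S \<subseteq> L2 S" "Y ` L2 T \<subseteq> L2 T" by (simp_all only: conjugate_via_def)
  then show "\<And>u. u \<in> L2 S \<Longrightarrow> X u \<in> L2 S" "\<And>w. w \<in> L2 T \<Longrightarrow> Y w \<in> L2 T"
    by (simp_all only: image_subset_iff)
  from assms show "\<And>u. u \<in> L2 S \<Longrightarrow> Y (V u) = V (X u)" unfolding conjugate_via_iff by simp
  from assms show "\<And>w. w \<in> L2 T \<Longrightarrow> Y w = V (X (inv_into (L2 S) V w))" by (simp only: conjugate_via_def)
qed

lemma conjugate_via_comp:
  assumes 1: "conjugate_via S T V X Y" and 2: "conjugate_via T U W Y Z"
  shows "conjugate_via S U (W \<circ> V) X Z"
  unfolding conjugate_via_iff
proof (intro conjI ballI)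
  show "hilbert_iso S U (W \<circ> V)"
    by (rule hilbert_iso_comp[OF conjugate_viaD(1)[OF 1] conjugate_viaD(1)[OF 2]])
  show "X ` L2 S \<subseteq> L2 S" by (intro image_subsetI conjugate_viaD(2)[OF 1])
  fix u assume u: "u \<in> L2 S"
  have "V u \<in> L2 T" by (rule hilbert_iso_mem[OF conjugate_viaD(1)[OF 1] u])
  then show "Z ((W \<circ> V) u) = (W \<circ> V) (X u)"
    by (simp only: comp_apply conjugate_viaD(4)[OF 2] conjugate_viaD(4)[OF 1 u])
qed

lemma conjugate_via_inv_into:
  assumes S: "S \<in> sets borel" and c: "conjugate_via S T V X Y"
  shows "conjugate_via T S (inv_into (L2 S) V) Y X"
proof -
  note V = conjugate_viaD(1)[OF c]
  then have b: "bij_betw V (L2 S) (L2 T)" by (simp add: hilbert_iso_def)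
  have I: "inv_into (L2 S) V w \<in> L2 S" "V (inv_into (L2 S) V w) = w" if "w \<in> L2 T" for w
    using b that by (auto simp: bij_betw_def inv_into_into f_inv_into_f)
  have inv: "inv_into (L2 S) V (V u) = u" if "u \<in> L2 S" for u
    using b that by (simp add: bij_betw_def)
  show ?thesis
    unfolding conjugate_via_iff
  proof (intro conjI ballI)
    show "hilbert_iso T S (inv_into (L2 S) V)" by (rule hilbert_iso_inv_into[OF S V])
    show "Y ` L2 T \<subseteq> L2 T" by (intro image_subsetI conjugate_viaD(3)[OF c])
    fix w assume w: "w \<in> L2 T"
    have "X (inv_into (L2 S) V w) \<in> L2 S" by (rule conjugate_viaD(2)[OF c I(1)[OF w]])
    then show "X (inv_into (L2 S) V w) = inv_into (L2 S) V (Y w)"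
      by (simp only: conjugate_viaD(5)[OF c w] inv)
  qed
qed

lemma conjugate_via_cong:
  assumes "conjugate_via S T V X Y" "\<And>u. u \<in> L2 S \<Longrightarrow> X' u = X u" "\<And>u. u \<in> L2 T \<Longrightarrow> Y' u = Y u"
  shows "conjugate_via S T V X' Y'"
  unfolding conjugate_via_iff
proof (intro conjI ballI)
  note V = conjugate_viaD(1)[OF assms(1)]
  show "hilbert_iso S T V" by (rule V)
  show "X' ` L2 S \<subseteq> L2 S"
    by (intro image_subsetI) (simp only: assms(2) conjugate_viaD(2)[OF assms(1)])
  fix u assume u: "u \<in> L2 S"
  show "Y' (V u) = V (X' u)"
    by (simp only: assms(2)[OF u] assms(3)[OF hilbert_iso_mem[OF V u]] conjugate_viaD(4)[OF assms(1) u])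
qed

text \<open>Carries the sign produced by \<open>reflect01\<close> through the logarithmic change of
  variable.\<close>

lemma conjugate_via_neg:
  assumes S: "S \<in> sets borel" and c: "conjugate_via S T V X Y"
  shows "conjugate_via S T V (\<lambda>u. L2_scale S (-1) (X u)) (\<lambda>u. L2_scale T (-1) (Y u))"
  unfolding conjugate_via_iff
proof (intro conjI ballI)
  note V = conjugate_viaD(1)[OF c] and X = conjugate_viaD(2)[OF c] and Y = conjugate_viaD(4)[OF c]
  show "hilbert_iso S T V" by (rule V)
  show "(\<lambda>u. L2_scale S (- 1) (X u)) ` L2 S \<subseteq> L2 S"
    by (intro image_subsetI L2_scale_closed[OF S] X)
  fix u assume u: "u \<in> L2 S"
  have "\<forall>z. \<forall>u\<in>L2 S. V (L2_scale S z u) = L2_scale T z (V u)"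
    by (rule V[unfolded hilbert_iso_def, THEN conjunct2, THEN conjunct2, THEN conjunct1])
  from this[rule_format, OF X[OF u]] show "L2_scale T (- 1) (Y (V u)) = V (L2_scale S (- 1) (X u))"
    by (simp only: Y[OF u])
qed

section \<open>Identification of the Fourier transformation on classes\<close>

definition FFc :: "fclass \<Rightarrow> fclass" where
  "FFc u = ae_class UNIV (FF (ext UNIV u))"

lemma hilbert_iso_FFc: "hilbert_iso UNIV UNIV FFc"
proof (rule hilbert_isoI[where v=FF])
  show "\<exists>f. L2on UNIV f \<and> (AE x in lborel. FF f x = g x)" if "L2on UNIV g" for g
    using that FF_FI[of g] L2f_FI[of g] unfolding L2on_UNIV by blast
  show "AE x in lborel. FF f x = FF g x" if "L2on UNIV f" "L2on UNIV g" "AE x in lborel. f x = g x" for f g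
    using that by (intro FF_cong) (auto simp: L2on_UNIV)
qed (auto simp: FFc_def L2on_UNIV L2f_FF FF_add FF_scale ip_FF)

text \<open>\<open>fourier\<close> is a choice operator applied to its two characterising
  properties; \<open>FFc\<close> shows that they can be satisfied.\<close>

lemma fourier_spec:
  "hilbert_iso UNIV UNIV fourier"
  "L12 f \<Longrightarrow> fourier (ae_class UNIV f) = ae_class UNIV (FT0 f)"
proof -
  have sq: "square_int UNIV f \<and> integrable lborel f \<longleftrightarrow> L12 f" for f
    by (simp add: L12_def square_int_iff)
  have "FFc (ae_class UNIV f) = ae_class UNIV (FT0 f)" if f: "L12 f" for f
  proof -
    have f2: "L2f f" using f by (simp add: L12_def)
    have "AE x in lborel. FF (ext UNIV (ae_class UNIV f)) x = FF f x"
      by (intro FF_cong L2f_ext ae_class_L2 f2 ext_ae_class_UNIV) auto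
    moreover have "AE x in lborel. FF f x = FT0 f x"
      using f by (intro FF_eq_FT0) (auto simp: L12_def)
    ultimately have "AE x in lborel. FF (ext UNIV (ae_class UNIV f)) x = FT0 f x"
      by eventually_elim simp
    then show ?thesis
      unfolding FFc_def by (intro ae_class_eqI) auto
  qed
  moreover define P where "P F \<longleftrightarrow> hilbert_iso UNIV UNIV F \<and> (\<forall>f. square_int UNIV f \<and> integrable lborel f \<longrightarrow>
        F (ae_class UNIV f) =
        ae_class UNIV (\<lambda>x. of_real ((2 * pi) powr (-1/2)) *
          (LINT y|lborel. exp (- (\<i> * of_real (x * y))) * f y)))" for F
  ultimately have "P FFc"
    using hilbert_iso_FFc unfolding P_def sq FT0_def[abs_def] c0_def by (intro conjI allI impI)
  then have "P (SOME F. P F)" by (rule someI[of P FFc])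
  also have "(SOME F. P F) = fourier" unfolding fourier_def P_def ..
  finally have *: "P fourier" .
  show "hilbert_iso UNIV UNIV fourier" by (rule *[unfolded P_def, THEN conjunct1])
  show "fourier (ae_class UNIV f) = ae_class UNIV (FT0 f)" if "L12 f"
    unfolding FT0_def[abs_def] c0_def
    by (rule *[unfolded P_def sq, THEN conjunct2, rule_format, OF that])
qed

text \<open>Uniqueness: two isometries that agree on the integrable functions of L^2 agree
  everywhere, since these are dense.\<close>

lemma fourier_eq:
  assumes u: "u \<in> L2 UNIV"
  shows "fourier u = FFc u"
proof -
  define f where "f = ext UNIV u"
  define g where "g = ext UNIV (fourier u)"
  have U: "UNIV \<in> sets (borel :: real measure)" by simp
  have f: "L2f f" using u by (simp add: f_def L2f_ext)
  have fu: "fourier u \<in> L2 UNIV" using fourier_spec(1) u by (rule hilbert_iso_mem)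
  then have g: "L2f g" by (simp add: g_def L2f_ext)
  \<comment> \<open>The difference is pulled back by \<open>FI\<close>, so that orthogonality to all
    transforms \<open>FT0 h\<close> becomes orthogonality to every h with \<open>L12 h\<close>; the
    truncations of \<open>w\<close> itself are such h.\<close>
  define w where "w = FI (\<lambda>x. g x - FF f x)"
  have d: "L2f (\<lambda>x. g x - FF f x)" by (intro L2f_diff g L2f_FF f)
  then have w: "L2f w" by (simp add: w_def L2f_FI)
  have z: "ip h w = 0" if h: "L12 h" for h
  proof -
    have h2: "L2f h" using h by (simp add: L12_def)
    have hu: "ae_class UNIV h \<in> L2 UNIV" by (simp add: ae_class_L2 h2)
    have ft: "L2f (FT0 h)" by (rule L2f_FT0[OF h])
    note m = L2f_measurable[OF L2f_ext[OF U]]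
    have "integrable lborel h" using h by (simp add: L12_def)
    from FF_eq_FT0[OF h2 this] ext_ae_class_UNIV[OF ft]
    have ae: "AE x in lborel. FF h x = ext UNIV (ae_class UNIV (FT0 h)) x"
      by eventually_elim simp
    have "ip (FF h) g = ip (ext UNIV (fourier (ae_class UNIV h))) g"
      unfolding fourier_spec(2)[OF h] using ae
      by (intro ip_cong_AE m ae_class_L2 U ft L2f_measurable[OF L2f_FF[OF h2]] L2f_measurable[OF g]) auto
    also have "\<dots> = L2_inner UNIV (fourier (ae_class UNIV h)) (fourier u)"
      by (simp add: L2_inner_ext g_def)
    also have "\<dots> = L2_inner UNIV (ae_class UNIV h) u"
      using fourier_spec(1) u hu by (simp add: hilbert_iso_def)
    also have "\<dots> = ip (ext UNIV (ae_class UNIV h)) f"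
      by (simp add: L2_inner_ext f_def)
    also have "\<dots> = ip h f"
      by (intro ip_cong_AE m ext_ae_class_UNIV L2f_measurable hu h2 f) auto
    also have "\<dots> = ip (FF h) (FF f)" by (simp add: ip_FF h2 f)
    finally have "ip (FF h) (\<lambda>x. g x - FF f x) = 0"
      by (simp add: ip_diff_right L2f_FF h2 f g)
    then show ?thesis by (simp add: w_def ip_FF_FI h2 d)
  qed
  have "(\<lambda>n. ip (trunc n w) w) \<longlonglongrightarrow> ip w w"
    by (intro ip_tendsto w trunc_tendsto) (use L12_trunc[OF w] in \<open>auto simp: L12_def nsq_def\<close>)
  then have "(\<lambda>n. 0) \<longlonglongrightarrow> ip w w" by (simp add: z[OF L12_trunc[OF w]])
  then have "ip w w = 0" by (simp add: LIMSEQ_const_iff)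
  then have "ip (\<lambda>x. g x - FF f x) (\<lambda>x. g x - FF f x) = 0"
    unfolding w_def by (simp add: ip_FI d)
  then have "nsq (\<lambda>x. g x - FF f x) = 0" by (simp add: ip_self)
  from nsq_eq_0[OF d this] have "AE x in lborel. g x = FF f x" by auto
  then have "ae_class UNIV g = ae_class UNIV (FF f)"
    by (intro ae_class_eqI) auto
  then show ?thesis by (simp add: g_def f_def FFc_def ext_L2[OF U fu])
qed

lemma fourier_ae_class:
  assumes f: "L2f f"
  shows "fourier (ae_class UNIV f) = ae_class UNIV (FF f)"
proof -
  have "ae_class UNIV f \<in> L2 UNIV" by (simp add: ae_class_L2 f)
  then show ?thesis
    using FF_cong[OF L2f_ext f ext_ae_class_UNIV[OF f]]
    by (simp add: fourier_eq FFc_def) (intro ae_class_eqI; simp)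
qed

lemma fourier_inv_ae_class:
  assumes f: "L2f f"
  shows "fourier_inv (ae_class UNIV f) = ae_class UNIV (FI f)"
proof -
  have "fourier (ae_class UNIV (FI f)) = ae_class UNIV f"
    unfolding fourier_ae_class[OF L2f_FI[OF f]] using FF_FI[OF f] by (intro ae_class_eqI) auto
  moreover have "ae_class UNIV (FI f) \<in> L2 UNIV" by (simp add: ae_class_L2 f L2f_FI)
  moreover have "inj_on fourier (L2 UNIV)"
    using fourier_spec(1) by (simp add: hilbert_iso_def bij_betw_def)
  ultimately show ?thesis unfolding fourier_inv_def by (metis inv_into_f_f)
qed

section \<open>The factors of a Wiener-Hopf operator acting on representatives\<close>

lemma P_plus_ae_class:
  assumes f: "L2f f"
  shows "P_plus (ae_class UNIV f) = ae_class Rplus (\<lambda>x. indicator Rplus x * f x)"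
  unfolding P_plus_def using ext_ae_class_UNIV[OF f]
  by (intro ae_class_eqI) (auto simp: ext_def)

lemma P_plus_adj_eq: "P_plus_adj u = ae_class UNIV (ext Rplus u)"
  by (simp add: P_plus_adj_def ext_def[abs_def])

lemma mult_op_ae_class:
  assumes f: "L2f f"
  shows "mult_op \<kappa> (ae_class UNIV f) = ae_class UNIV (\<lambda>x. \<kappa> x * f x)"
  unfolding mult_op_def using ext_ae_class_UNIV[OF f]
  by (intro ae_class_eqI) (auto simp: ext_def)

lemma wiener_hopf_eq:
  assumes u: "u \<in> L2 Rplus" and [measurable]: "\<kappa> \<in> borel_measurable borel" and "\<And>x. cmod (\<kappa> x) \<le> C"
  shows "wiener_hopf \<kappa> u = ae_class Rplus (\<lambda>x. indicator Rplus x * FF (\<lambda>x. \<kappa> x * FI (ext Rplus u) x) x)"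
proof -
  have e: "L2f (ext Rplus u)" by (intro L2f_ext u) simp
  have k: "L2f (\<lambda>x. \<kappa> x * FI (ext Rplus u) x)"
    by (intro L2f_bounded_mult[where C=C] assms L2f_FI e)
  show ?thesis
    by (simp add: wiener_hopf_def P_plus_adj_eq fourier_inv_ae_class mult_op_ae_class fourier_ae_class P_plus_ae_class
        e k L2f_FI L2f_FF)
qed

section \<open>Weighted composition operators\<close>

text \<open>\<open>g\<close> maps S bijectively onto T with inverse \<open>k\<close>. The weight
  \<open>s\<close> is tied to the derivative in modulus only: besides square roots this admits the
  factor 1/(a - c x) of the Moebius action, which changes sign at the pole.\<close>

locale change_of_variable =
  fixes S T :: "real set" and g g' k :: "real \<Rightarrow> real" and s :: "real \<Rightarrow> complex"
  assumes S [measurable]: "S \<in> sets borel" and T [measurable]: "T \<in> sets borel"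
    and g_measurable [measurable]: "g \<in> borel_measurable borel"
    and g'_measurable [measurable]: "g' \<in> borel_measurable borel"
    and k_measurable [measurable]: "k \<in> borel_measurable borel"
    and s_measurable [measurable]: "s \<in> borel_measurable borel"
    and g_T: "\<And>x. x \<in> S \<Longrightarrow> g x \<in> T" and k_g: "\<And>x. x \<in> S \<Longrightarrow> k (g x) = x"
    and k_S: "\<And>y. y \<in> T \<Longrightarrow> k y \<in> S" and g_k: "\<And>y. y \<in> T \<Longrightarrow> g (k y) = y"
    and g_deriv: "\<And>x. x \<in> S \<Longrightarrow> (g has_real_derivative g' x) (at x)"
    and s_sq: "\<And>x. x \<in> S \<Longrightarrow> (cmod (s x))\<^sup>2 = \<bar>g' x\<bar>"
    and s_nz: "\<And>x. x \<in> S \<Longrightarrow> s x \<noteq> 0"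
begin

lemma inj_g: "inj_on g S"
  by (rule inj_on_inverseI[of S k]) (rule k_g)

lemma image_g: "g ` S = T"
  using g_T k_S g_k by (auto simp: image_iff) (metis k_S g_k)

text \<open>The substitution rule for absolutely integrable functions is applied to an indicator,
  which must have finite integral; hence \<open>B\<close> is bounded here, and
  \<open>distr_eq\<close> exhausts a Borel set by such pieces.\<close>

lemma emeasure_bounded:
  assumes [measurable]: "B \<in> sets borel" and bdd: "B \<subseteq> {- r..r}"
  shows "(\<integral>\<^sup>+x. ennreal (indicator S x * \<bar>g' x\<bar>) * indicator B (g x) \<partial>lborel) = emeasure lborel (T \<inter> B)"
proof -
  have fin: "emeasure lborel (T \<inter> B) < \<infinity>"
  proof -
    have "emeasure lborel (T \<inter> B) \<le> emeasure lborel {- r..r}"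
      using bdd by (intro emeasure_mono) auto
    also have "\<dots> < \<infinity>" by (simp add: emeasure_lborel_Icc_eq)
    finally show ?thesis .
  qed
  have "integrable lborel (indicator (T \<inter> B) :: real \<Rightarrow> real)"
    using fin by (intro integrable_real_indicator) auto
  also have "(indicator (T \<inter> B) :: real \<Rightarrow> real) = (\<lambda>y. indicator T y *\<^sub>R indicator B y)"
    by (auto split: split_indicator)
  finally have int: "integrable lborel (\<lambda>y. indicator T y *\<^sub>R (indicator B y :: real))" .
  then have si: "set_integrable lborel T (indicator B :: real \<Rightarrow> real)"
    by (simp add: set_integrable_def)
  then have f: "(indicator B :: real \<Rightarrow> real) absolutely_integrable_on g ` S"
    unfolding image_g set_integrable_def by (subst integrable_completion) auto
  have fi: "integral (g ` S) (indicator B :: real \<Rightarrow> real) = measure lborel (T \<inter> B)"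
  proof -
    have "integral T (indicator B :: real \<Rightarrow> real) = (LINT y:T|lborel. indicator B y)"
      using set_borel_integral_eq_integral(2)[OF si] by simp
    also have "\<dots> = (LINT y|lborel. indicator (T \<inter> B) y)"
      unfolding set_lebesgue_integral_def
      by (intro Bochner_Integration.integral_cong) (auto split: split_indicator)
    finally show ?thesis by (simp add: image_g)
  qed
  have "(\<lambda>x. \<bar>g' x\<bar> * indicator B (g x)) absolutely_integrable_on S \<and>
      integral S (\<lambda>x. \<bar>g' x\<bar> * indicator B (g x)) = measure lborel (T \<inter> B)"
  proof (rule has_absolute_integral_change_of_variables_1'[where S=S and g=g and g'=g' and f="indicator B", THEN iffD2])
    show "S \<in> sets lebesgue" by simp
    show "(g has_field_derivative g' x) (at x within S)" if "x \<in> S" for x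
      using g_deriv[OF that] by (rule DERIV_subset) simp
    show "inj_on g S" by (rule inj_g)
  qed (intro conjI f fi)
  then have h: "(\<lambda>x. \<bar>g' x\<bar> * indicator B (g x)) absolutely_integrable_on S"
    "integral S (\<lambda>x. \<bar>g' x\<bar> * indicator B (g x)) = measure lborel (T \<inter> B)" by auto
  have h': "integrable lborel (\<lambda>x. indicator S x *\<^sub>R (\<bar>g' x\<bar> * indicator B (g x)))"
    using h(1) unfolding set_integrable_def by (subst (asm) integrable_completion) auto
  then have hs: "set_integrable lborel S (\<lambda>x. \<bar>g' x\<bar> * indicator B (g x))"
    by (simp add: set_integrable_def)
  have "(\<integral>\<^sup>+x. ennreal (indicator S x * \<bar>g' x\<bar>) * indicator B (g x) \<partial>lborel)
      = (\<integral>\<^sup>+x. ennreal (indicator S x *\<^sub>R (\<bar>g' x\<bar> * indicator B (g x))) \<partial>lborel)"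
    by (intro nn_integral_cong) (auto split: split_indicator)
  also have "\<dots> = ennreal (LINT x|lborel. indicator S x *\<^sub>R (\<bar>g' x\<bar> * indicator B (g x)))"
    by (rule nn_integral_eq_integral[OF h']) auto
  also have "\<dots> = ennreal (measure lborel (T \<inter> B))"
    using set_borel_integral_eq_integral(2)[OF hs] h(2) by (simp add: set_lebesgue_integral_def)
  also have "\<dots> = emeasure lborel (T \<inter> B)"
    using fin by (simp add: emeasure_eq_ennreal_measure)
  finally show ?thesis .
qed

text \<open>The substitution rule as an identity of measures: nonnegative integrals, complex
  integrals and null sets can all be transported by it.\<close>

lemma distr_eq: "distr (density lborel (\<lambda>x. ennreal (indicator S x * \<bar>g' x\<bar>))) borel g = density lborel (indicator T)"
  (is "?M1 = ?M2")
proof (rule measure_eqI)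
  fix A assume "A \<in> sets ?M1"
  then have A [measurable]: "A \<in> sets borel" by simp
  define B where "B n = A \<inter> {- real n..real n}" for n
  have B [measurable]: "B n \<in> sets borel" for n unfolding B_def by simp
  have inc: "incseq B" unfolding B_def by (auto simp: incseq_def)
  have un: "(\<Union>n. B n) = A"
  proof (intro equalityI subsetI)
    fix x assume "x \<in> A"
    moreover obtain n :: nat where "\<bar>x\<bar> < real n" using reals_Archimedean2 by blast
    ultimately show "x \<in> (\<Union>n. B n)" by (auto simp: B_def intro!: exI[of _ n])
  qed (auto simp: B_def)
  have eq: "emeasure ?M1 (B n) = emeasure ?M2 (B n)" for n
  proof -
    have gB [measurable]: "g -` B n \<in> sets borel"
      using measurable_sets_borel[OF g_measurable B] by simp
    have "emeasure ?M1 (B n) = emeasure (density lborel (\<lambda>x. ennreal (indicator S x * \<bar>g' x\<bar>))) (g -` B n)"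
      by (subst emeasure_distr) auto
    also have "\<dots> = (\<integral>\<^sup>+x. ennreal (indicator S x * \<bar>g' x\<bar>) * indicator (B n) (g x) \<partial>lborel)"
      by (subst emeasure_density) (auto intro!: nn_integral_cong split: split_indicator)
    also have "\<dots> = emeasure lborel (T \<inter> B n)"
      by (rule emeasure_bounded[of _ "real n"]) (auto simp: B_def)
    also have "\<dots> = emeasure ?M2 (B n)"
      by (simp add: emeasure_density indicator_inter_arith[symmetric] nn_integral_indicator)
    finally show ?thesis .
  qed
  have "emeasure ?M1 A = (SUP n. emeasure ?M1 (B n))"
    using SUP_emeasure_incseq[of B ?M1] inc un by (auto simp: image_subset_iff)
  also have "\<dots> = emeasure ?M2 A"
    using SUP_emeasure_incseq[of B ?M2] inc un by (auto simp: image_subset_iff eq)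
  finally show "emeasure ?M1 A = emeasure ?M2 A" .
qed simp

lemma nn_integral_change:
  assumes [measurable]: "\<phi> \<in> borel_measurable borel"
  shows "(\<integral>\<^sup>+x. ennreal (indicator S x * \<bar>g' x\<bar>) * \<phi> (g x) \<partial>lborel) = (\<integral>\<^sup>+y. indicator T y * \<phi> y \<partial>lborel)"
proof -
  have "(\<integral>\<^sup>+y. \<phi> y \<partial>distr (density lborel (\<lambda>x. ennreal (indicator S x * \<bar>g' x\<bar>))) borel g)
      = (\<integral>\<^sup>+x. ennreal (indicator S x * \<bar>g' x\<bar>) * \<phi> (g x) \<partial>lborel)"
    by (subst nn_integral_distr, simp, simp, subst nn_integral_density) auto
  then show ?thesis
    unfolding distr_eq by (simp add: nn_integral_density)
qed

lemma integral_change: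
  fixes \<phi> :: "real \<Rightarrow> complex"
  assumes [measurable]: "\<phi> \<in> borel_measurable borel"
  shows "(LINT x|lborel. of_real (indicator S x * \<bar>g' x\<bar>) * \<phi> (g x)) = (LINT y|lborel. indicator T y * \<phi> y)"
proof -
  have "(LINT y|distr (density lborel (\<lambda>x. ennreal (indicator S x * \<bar>g' x\<bar>))) borel g. \<phi> y)
      = (LINT x|lborel. of_real (indicator S x * \<bar>g' x\<bar>) * \<phi> (g x))"
    by (subst integral_distr, simp, simp, subst integral_density) (auto simp: scaleR_conv_of_real)
  moreover have "(LINT y|density lborel (\<lambda>y. ennreal (indicator T y)). \<phi> y) = (LINT y|lborel. indicator T y *\<^sub>R \<phi> y)"
    by (subst integral_density) auto
  ultimately show ?thesis
    unfolding distr_eq by (simp add: ennreal_indicator scaleR_conv_of_real of_real_indicator)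
qed

text \<open>Null sets of T pull back to null sets of S because the density |g'| = |s|^2 is positive
  on S.\<close>

lemma AE_change:
  assumes "AE y in lborel. y \<in> T \<longrightarrow> P y"
  shows "AE x in lborel. x \<in> S \<longrightarrow> P (g x)"
proof -
  have "AE y in density lborel (indicator T). P y"
    using assms by (subst AE_density) (auto elim!: eventually_mono split: split_indicator_asm)
  then have "AE y in distr (density lborel (\<lambda>x. ennreal (indicator S x * \<bar>g' x\<bar>))) borel g. P y"
    unfolding distr_eq .
  then have "AE x in density lborel (\<lambda>x. ennreal (indicator S x * \<bar>g' x\<bar>)). P (g x)"
    by (rule AE_distrD[rotated]) simp
  then have "AE x in lborel. 0 < ennreal (indicator S x * \<bar>g' x\<bar>) \<longrightarrow> P (g x)"
    by (subst (asm) AE_density) auto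
  then show ?thesis
  proof eventually_elim
    case (elim x)
    have "0 < \<bar>g' x\<bar>" if "x \<in> S"
      using s_sq[OF that] s_nz[OF that] by (metis norm_eq_zero zero_less_power2)
    then show ?case using elim by auto
  qed
qed

section \<open>The weighted composition operator as a Hilbert space isomorphism\<close>

definition WC :: "(real \<Rightarrow> complex) \<Rightarrow> real \<Rightarrow> complex" where
  "WC f x = indicator S x * (s x * f (g x))"

lemma WC_measurable [measurable]:
  assumes [measurable]: "f \<in> borel_measurable borel"
  shows "WC f \<in> borel_measurable borel"
  unfolding WC_def by measurable

lemma WC_sq: "ennreal ((cmod (WC f x))\<^sup>2) = ennreal (indicator S x * \<bar>g' x\<bar>) * ennreal ((cmod (f (g x)))\<^sup>2)"
  by (auto simp: WC_def norm_mult power_mult_distrib s_sq ennreal_mult split: split_indicator)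

lemma L2on_WC:
  assumes f: "L2f f"
  shows "L2on S (WC f)"
proof -
  note [measurable] = L2f_measurable[OF f]
  have "(\<integral>\<^sup>+x. ennreal ((cmod (WC f x))\<^sup>2) \<partial>lborel) = (\<integral>\<^sup>+y. indicator T y * ennreal ((cmod (f y))\<^sup>2) \<partial>lborel)"
    unfolding WC_sq by (rule nn_integral_change) measurable
  also have "\<dots> \<le> (\<integral>\<^sup>+y. ennreal ((cmod (f y))\<^sup>2) \<partial>lborel)"
    by (intro nn_integral_mono) (auto split: split_indicator)
  also have "\<dots> = ennreal (nsq f)" by (rule nn_integral_nsq[OF f])
  finally have "(\<integral>\<^sup>+x. ennreal ((cmod (WC f x))\<^sup>2) \<partial>lborel) \<le> ennreal (nsq f)" .
  then have "L2f (WC f)" by (intro L2f_nn(1)[OF _ _ nsq_nonneg[of f]]) measurable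
  then show ?thesis by (simp add: L2on_def WC_def)
qed

lemma ip_WC:
  assumes f: "L2f f" and h: "L2f h"
  shows "ip (WC f) (WC h) = ip (\<lambda>y. indicator T y * f y) h"
proof -
  note [measurable] = L2f_measurable[OF f] L2f_measurable[OF h]
  have "cnj (WC f x) * WC h x = of_real (indicator S x * \<bar>g' x\<bar>) * (cnj (f (g x)) * h (g x))" for x
  proof (cases "x \<in> S")
    case True
    have "cnj (s x) * s x = of_real \<bar>g' x\<bar>"
      using s_sq[OF True] complex_norm_square[of "s x"] by (simp add: mult.commute)
    then show ?thesis using True by (simp add: WC_def ac_simps)
  qed (simp add: WC_def)
  then have "ip (WC f) (WC h) = (LINT x|lborel. of_real (indicator S x * \<bar>g' x\<bar>) * (cnj (f (g x)) * h (g x)))"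
    by (simp only: ip_def)
  also have "\<dots> = (LINT y|lborel. indicator T y * (cnj (f y) * h y))"
    by (rule integral_change) measurable
  also have "\<dots> = ip (\<lambda>y. indicator T y * f y) h"
    unfolding ip_def by (intro Bochner_Integration.integral_cong) (auto split: split_indicator)
  finally show ?thesis .
qed

lemma WC_cong:
  assumes "AE y in lborel. y \<in> T \<longrightarrow> f y = h y"
  shows "AE x in lborel. WC f x = WC h x"
  using AE_change[OF assms] by eventually_elim (auto simp: WC_def split: split_indicator)

lemma WC_add: "WC (\<lambda>x. f x + h x) x = WC f x + WC h x"
  by (simp add: WC_def algebra_simps)

lemma WC_scale: "WC (\<lambda>x. c * f x) x = c * WC f x"
  by (simp add: WC_def algebra_simps)

lemma WC_surj:
  assumes h: "L2on S h"
  shows "\<exists>f. L2on T f \<and> WC f = h"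
proof -
  note [measurable] = L2f_measurable[OF L2on_L2f[OF h]]
  define f where "f y = indicator T y * (h (k y) / s (k y))" for y
  have [measurable]: "f \<in> borel_measurable borel" unfolding f_def by measurable
  have eq: "WC f = h"
  proof
    fix x
    show "WC f x = h x"
      using h s_nz[of x] g_T[of x] k_g[of x] by (cases "x \<in> S") (auto simp: WC_def f_def L2on_def)
  qed
  have "(\<integral>\<^sup>+y. ennreal ((cmod (f y))\<^sup>2) \<partial>lborel) = (\<integral>\<^sup>+y. indicator T y * ennreal ((cmod (f y))\<^sup>2) \<partial>lborel)"
    by (intro nn_integral_cong) (auto simp: f_def split: split_indicator)
  also have "\<dots> = (\<integral>\<^sup>+x. ennreal ((cmod (WC f x))\<^sup>2) \<partial>lborel)"
    unfolding WC_sq by (rule nn_integral_change[symmetric]) measurable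
  also have "\<dots> = ennreal (nsq h)"
    unfolding eq by (rule nn_integral_nsq[OF L2on_L2f[OF h]])
  finally have "L2f f" by (intro L2f_nn(1)[OF _ _ nsq_nonneg[of h]]) auto
  then have "L2on T f" by (simp add: L2on_def f_def)
  with eq show ?thesis by blast
qed

lemma hilbert_iso_WC:
  assumes V: "\<And>u. u \<in> L2 T \<Longrightarrow> V u = ae_class S (WC (ext T u))"
  shows "hilbert_iso T S V"
proof (rule hilbert_isoI[where v=WC])
  show "ip (WC f) (WC h) = ip f h" if "L2on T f" "L2on T h" for f h
  proof -
    have "(\<lambda>y. indicator T y * f y) = f"
      using that(1) by (auto simp: L2on_def split: split_indicator)
    then show ?thesis using ip_WC[OF that[THEN L2on_L2f]] by simp
  qed
  show "AE x in lborel. WC f x = WC h x" if "AE x in lborel. f x = h x" for f h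
    using that by (intro WC_cong) auto
  show "\<exists>f. L2on T f \<and> (AE x in lborel. WC f x = h x)" if "L2on S h" for h
    using WC_surj[OF that] by auto
qed (auto simp: V WC_add WC_scale L2on_WC L2on_L2f)

end

section \<open>The Moebius action on square integrable functions\<close>

text \<open>F_A with A^-1 written out for determinant 1. At the pole a - c x = 0 the factor, and so
  the value, is 0 by the convention for division.\<close>

definition FA :: "real \<Rightarrow> real \<Rightarrow> real \<Rightarrow> real \<Rightarrow> (real \<Rightarrow> complex) \<Rightarrow> real \<Rightarrow> complex" where
  "FA a b c d f x = of_real (1 / (a - c * x)) * f ((d * x - b) / (a - c * x))"

locale sl2 =
  fixes a b c d :: real
  assumes det: "a * d - b * c = 1"
begin

lemma inverse: "sl2 d (- b) (- c) a"
  using det by unfold_locales (simp add: mult.commute)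

lemma denom: "a - c * x \<noteq> 0 \<Longrightarrow> d + c * ((d * x - b) / (a - c * x)) = 1 / (a - c * x)"
  using det by (simp add: field_simps)

lemma denom': "d + c * x \<noteq> 0 \<Longrightarrow> a - c * ((a * x + b) / (d + c * x)) = 1 / (d + c * x)"
  using det by (simp add: field_simps)

lemma moebius_inverse: "a - c * x \<noteq> 0 \<Longrightarrow> (a * ((d * x - b) / (a - c * x)) + b) / (d + c * ((d * x - b) / (a - c * x))) = x"
proof -
  assume nz: "a - c * x \<noteq> 0"
  have "a * ((d * x - b) / (a - c * x)) + b = (a * (d * x - b) + b * (a - c * x)) / (a - c * x)"
    using nz by (simp add: add_divide_distrib)
  also have "a * (d * x - b) + b * (a - c * x) = (a * d - b * c) * x" by (simp add: algebra_simps)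
  finally show ?thesis unfolding denom[OF nz] using nz by (simp add: det)
qed

text \<open>The Moebius map is a bijection between the complements of its pole and of the pole of
  its inverse, and its derivative is the determinant divided by (a - c x)^2.\<close>

sublocale change_of_variable "{x. a - c * x \<noteq> 0}" "{y. d + c * y \<noteq> 0}" "\<lambda>x. (d * x - b) / (a - c * x)"
  "\<lambda>x. 1 / (a - c * x)\<^sup>2" "\<lambda>y. (a * y + b) / (d + c * y)" "\<lambda>x. of_real (1 / (a - c * x))"
proof
  interpret i: sl2 d "- b" "- c" a by (rule inverse)
  show "(a * ((d * x - b) / (a - c * x)) + b) / (d + c * ((d * x - b) / (a - c * x))) = x"
    if "x \<in> {x. a - c * x \<noteq> 0}" for x using moebius_inverse[of x] that by simp
  show "(d * x - b) / (a - c * x) \<in> {y. d + c * y \<noteq> 0}" if "x \<in> {x. a - c * x \<noteq> 0}" for x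
    using that unfolding mem_Collect_eq denom[OF that[unfolded mem_Collect_eq]] by simp
  show "(a * x + b) / (d + c * x) \<in> {x. a - c * x \<noteq> 0}" if "x \<in> {y. d + c * y \<noteq> 0}" for x
    using that unfolding mem_Collect_eq denom'[OF that[unfolded mem_Collect_eq]] by simp
  show "(d * ((a * x + b) / (d + c * x)) - b) / (a - c * ((a * x + b) / (d + c * x))) = x"
    if "x \<in> {y. d + c * y \<noteq> 0}" for x using i.moebius_inverse[of x] that by simp
  show "((\<lambda>x. (d * x - b) / (a - c * x)) has_real_derivative 1 / (a - c * x)\<^sup>2) (at x)"
    if "x \<in> {x. a - c * x \<noteq> 0}" for x
  proof -
    have "((\<lambda>x. (d * x - b) / (a - c * x)) has_real_derivative
        (d * (a - c * x) - (d * x - b) * (- c)) / ((a - c * x) * (a - c * x))) (at x)"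
      using that by (auto intro!: derivative_eq_intros)
    also have "d * (a - c * x) - (d * x - b) * (- c) = a * d - b * c" by (simp add: algebra_simps)
    finally show ?thesis by (simp add: det power2_eq_square)
  qed
  show "(cmod (of_real (1 / (a - c * x))))\<^sup>2 = \<bar>1 / (a - c * x)\<^sup>2\<bar>" for x
    unfolding norm_of_real by (simp add: power_divide)
  show "complex_of_real (1 / (a - c * x)) \<noteq> 0" if "x \<in> {x. a - c * x \<noteq> 0}" for x
    using that unfolding of_real_eq_0_iff by simp
qed auto

lemma AE_denom: "AE x in lborel. a - c * x \<noteq> 0"
proof (cases "c = 0")
  case True
  then show ?thesis using det by auto
next
  case False
  have "AE x in lborel. x \<noteq> a / c" by (rule AE_lborel_singleton)
  then show ?thesis
  proof eventually_elim
    case (elim x)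
    then show ?case using False by (auto simp: field_simps)
  qed
qed

lemma FA_eq_WC: "AE x in lborel. FA a b c d f x = WC f x"
  using AE_denom
proof eventually_elim
  case (elim x)
  then show ?case unfolding FA_def WC_def by simp
qed

lemma FA_measurable [measurable]:
  assumes [measurable]: "f \<in> borel_measurable borel"
  shows "FA a b c d f \<in> borel_measurable borel"
  unfolding FA_def by measurable

lemma L2f_FA: "L2f f \<Longrightarrow> L2f (FA a b c d f)"
  by (rule L2f_cong_AE[OF L2on_L2f[OF L2on_WC] FA_measurable[OF L2f_measurable] FA_eq_WC])

lemma FA_add: "FA a b c d (\<lambda>x. f x + g x) x = FA a b c d f x + FA a b c d g x"
  by (simp add: FA_def distrib_left)

lemma FA_scale: "FA a b c d (\<lambda>x. z * f x) x = z * FA a b c d f x"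
  by (simp add: FA_def)

lemma FA_cong:
  assumes "AE x in lborel. f x = g x"
  shows "AE x in lborel. FA a b c d f x = FA a b c d g x"
proof -
  have "AE x in lborel. WC f x = WC g x" using assms by (intro WC_cong) auto
  then show ?thesis using FA_eq_WC[of f] FA_eq_WC[of g] by eventually_elim simp
qed

lemma FA_FA_inverse: "AE x in lborel. FA a b c d (FA d (- b) (- c) a f) x = f x"
  using AE_denom
proof eventually_elim
  case (elim x)
  define y where "y = (d * x - b) / (a - c * x)"
  have 1: "d - - c * y = 1 / (a - c * x)"
    using denom[OF elim] by (simp add: y_def)
  have 2: "(a * y - - b) / (d - - c * y) = x"
    using moebius_inverse[OF elim] by (simp add: y_def)
  have "FA d (- b) (- c) a f y = of_real (1 / (d - - c * y)) * f ((a * y - - b) / (d - - c * y))"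
    by (simp only: FA_def)
  also have "\<dots> = of_real (a - c * x) * f x"
    unfolding 2 unfolding 1 by simp
  finally show ?case
    unfolding FA_def[of a b c d] y_def[symmetric] using elim by (simp flip: of_real_mult of_real_diff)
qed

end

lemma (in sl2) ip_FA:
  assumes f: "L2f f" and h: "L2f h"
  shows "ip (FA a b c d f) (FA a b c d h) = ip f h"
proof -
  interpret i: sl2 d "- b" "- c" a by (rule inverse)
  note [measurable] = L2f_measurable[OF f] L2f_measurable[OF h]
  have "ip (FA a b c d f) (FA a b c d h) = ip (WC f) (WC h)"
    by (intro ip_cong_AE FA_eq_WC) measurable
  also have "\<dots> = ip (\<lambda>y. indicator {y. d + c * y \<noteq> 0} y * f y) h"
    by (rule ip_WC[OF f h])
  also have "\<dots> = ip f h"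
  proof (intro ip_cong_AE)
    show "AE x in lborel. indicator {y. d + c * y \<noteq> 0} x * f x = f x"
      using i.AE_denom by eventually_elim simp
  qed auto
  finally show ?thesis .
qed

text \<open>A unitary operator has its inverse as adjoint, and the inverse belongs to the inverse
  matrix.\<close>

lemma (in sl2) ip_FA_adjoint:
  assumes f: "L2f f" and h: "L2f h"
  shows "ip (FA a b c d f) h = ip f (FA d (- b) (- c) a h)"
proof -
  interpret i: sl2 d "- b" "- c" a by (rule inverse)
  note L = L2f_FA[OF f] h L2f_FA[OF i.L2f_FA[OF h]]
  have "ip (FA a b c d f) h = ip (FA a b c d f) (FA a b c d (FA d (- b) (- c) a h))"
    using FA_FA_inverse[of h] by (intro ip_cong_AE L2f_measurable L) auto
  also have "\<dots> = ip f (FA d (- b) (- c) a h)"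
    by (intro ip_FA f i.L2f_FA h)
  finally show ?thesis .
qed

section \<open>The Moebius action respects the Hardy space\<close>

definition ek :: "complex \<Rightarrow> real \<Rightarrow> complex" where
  "ek l y = indicator {0<..} y * exp (- (l * of_real y))"

lemma ek_measurable [measurable]: "ek l \<in> borel_measurable borel"
  unfolding ek_def by measurable

lemma cmod_ek: "cmod (ek l y) = indicator {0<..} y * exp (- (y * Re l))"
  by (simp add: ek_def norm_mult norm_exp_eq_Re mult.commute split: split_indicator)

lemma L12_ek:
  assumes "Re l > 0"
  shows "L12 (ek l)"
proof -
  have i: "integrable lborel (\<lambda>y. indicator {0<..} y *\<^sub>R exp (- (y * u)))" if "u > 0" for u :: real
    using integrable_I0i_exp_mscale[OF that] by (simp add: set_integrable_def)
  have "integrable lborel (ek l)"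
    by (rule Bochner_Integration.integrable_bound[OF i[OF assms]]) (auto simp: cmod_ek)
  moreover have "L2f (ek l)"
  proof (rule L2f_bound)
    show "integrable lborel (\<lambda>y. indicator {0<..} y *\<^sub>R exp (- (y * (2 * Re l))))"
      using assms by (intro i) simp
    show "AE y in lborel. (cmod (ek l y))\<^sup>2 \<le> indicator {0<..} y *\<^sub>R exp (- (y * (2 * Re l)))"
      by (auto simp: cmod_ek power_mult_distrib exp_double[symmetric] intro!: always_eventually split: split_indicator)
  qed measurable
  ultimately show ?thesis by (simp add: L12_def)
qed

lemma L2f_ek: "Re l > 0 \<Longrightarrow> L2f (ek l)"
  using L12_ek by (simp add: L12_def)

lemma integral_ek:
  assumes "Re l > 0"
  shows "(LINT y|lborel. ek l y) = 1 / l"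
proof -
  have l: "l \<noteq> 0" using assms by auto
  let ?F = "\<lambda>y::real. - exp (- (l * of_real y)) / l"
  have "(LBINT y=0..\<infinity>. exp (- (l * of_real y))) = 0 - (- 1 / l)"
  proof (rule interval_integral_FTC_integrable)
    show "(?F has_vector_derivative exp (- (l * of_real y))) (at y)" for y
    proof -
      have "((\<lambda>z. - exp (- (l * z)) / l) has_field_derivative exp (- (l * of_real y))) (at (of_real y))"
        using l by (auto intro!: derivative_eq_intros)
      then show ?thesis by (rule has_vector_derivative_real_field)
    qed
    have "((\<lambda>y::real. exp (- (y * Re l))) \<longlongrightarrow> 0) at_top"
      by (rule filterlim_compose[OF exp_at_bot])
        (use assms in \<open>auto simp: filterlim_uminus_at_bot intro: filterlim_tendsto_pos_mult_at_top filterlim_ident filterlim_at_top_mult_tendsto_pos\<close>)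
    then have "((\<lambda>y::real. norm (exp (- (l * of_real y)))) \<longlongrightarrow> 0) at_top"
      by (simp add: norm_exp_eq_Re mult.commute)
    then have "((\<lambda>y::real. exp (- (l * of_real y))) \<longlongrightarrow> 0) at_top"
      by (rule tendsto_norm_zero_cancel)
    then have "(?F \<longlongrightarrow> - 0 / l) at_top" by (intro tendsto_intros l)
    then show "((?F \<circ> real_of_ereal) \<longlongrightarrow> 0) (at_left \<infinity>)"
      by (simp add: ereal_tendsto_simps)
    have "(?F \<longlongrightarrow> ?F 0) (at_right 0)"
      using l by (intro tendsto_intros) auto
    then show "((?F \<circ> real_of_ereal) \<longlongrightarrow> - 1 / l) (at_right 0)"
      by (simp add: ereal_tendsto_simps zero_ereal_def)
    have "integrable lborel (ek l)" using L12_ek[OF assms] by (simp add: L12_def)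
    then show "set_integrable lborel (einterval 0 \<infinity>) (\<lambda>y. exp (- (l * of_real y)))"
      by (simp add: set_integrable_def ek_def[abs_def] scaleR_conv_of_real of_real_indicator einterval_def greaterThan_def)
  qed (auto intro!: continuous_intros)
  then show ?thesis
    by (simp add: ek_def interval_lebesgue_integral_0_infty set_lebesgue_integral_def scaleR_conv_of_real of_real_indicator)
qed

lemma FT0_ek:
  assumes "Re l > 0"
  shows "FT0 (ek l) (- t) = of_real c0 / (l - \<i> * of_real t)"
proof -
  have "exp (- (\<i> * of_real (- t * y))) * ek l y = ek (l - \<i> * of_real t) y" for y
    by (simp add: ek_def exp_add[symmetric] algebra_simps split: split_indicator)
  then have "FT0 (ek l) (- t) = of_real c0 * (LINT y|lborel. ek (l - \<i> * of_real t) y)"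
    by (simp only: FT0_def)
  then show ?thesis using assms by (simp add: integral_ek)
qed

lemma FI_ek: "Re l > 0 \<Longrightarrow> AE t in lborel. FI (ek l) t = of_real c0 / (l - \<i> * of_real t)"
  using FI_eq_FT0[of "ek l"] L12_ek[of l] by (simp add: L12_def FT0_ek)

text \<open>Multiplication by exp (-y) makes \<open>w\<close> integrable on the half-line. Along the
  vertical line l = 1 - i s the hypothesis says that the Fourier transform of this product vanishes,
  so the product does, by Plancherel.\<close>

lemma ek_total:
  assumes w: "L2f w" and z: "\<And>l. Re l > 0 \<Longrightarrow> ip (ek l) w = 0"
  shows "AE y in lborel. y > 0 \<longrightarrow> w y = 0"
proof -
  note [measurable] = L2f_measurable[OF w]
  define h where "h y = ek 1 y * w y" for y
  have h1: "integrable lborel h"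
    unfolding h_def by (intro L2f_integrable_mult L2f_ek w) simp
  have h2: "L2f h"
    unfolding h_def by (rule L2f_bounded_mult[OF w, where C=1]) (auto simp: cmod_ek split: split_indicator)
  have "FT0 h s = 0" for s
  proof -
    have "exp (- (\<i> * of_real (s * y))) * exp (- (1 * of_real y)) = cnj (exp (- ((1 - \<i> * of_real s) * of_real y)))" for y
      unfolding exp_cnj exp_add[symmetric] by (intro arg_cong[where f=exp]) (simp add: algebra_simps)
    then have "exp (- (\<i> * of_real (s * y))) * h y = cnj (ek (1 - \<i> * of_real s) y) * w y" for y
      by (simp only: h_def ek_def mult.assoc[symmetric]) (simp split: split_indicator)
    then have "FT0 h s = of_real c0 * ip (ek (1 - \<i> * of_real s)) w"
      by (simp only: FT0_def ip_def)
    then show ?thesis using z[of "1 - \<i> * of_real s"] by simp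
  qed
  then have "nsq (FT0 h) = 0" by (simp add: nsq_def)
  then have "nsq h = 0" using FT0_isometry[OF h1 h2] by simp
  from nsq_eq_0[OF h2 this] show ?thesis
    by eventually_elim (auto simp: h_def ek_def)
qed

context sl2
begin

text \<open>1/(l - i t) has its pole at t = -i l in the lower half-plane, and F_A moves it to A .
  (-i l). Writing the new pole as -i l' gives for l' the quotient considered here; its real part is
  Re l times the determinant, divided by |m|^2.\<close>

lemma Re_moebius:
  fixes l :: complex
  assumes l: "Re l > 0"
  defines "m \<equiv> of_real d - \<i> * l * of_real c"
  shows "m \<noteq> 0" "Re ((l * of_real a + \<i> * of_real b) / m) > 0"
proof -
  show m: "m \<noteq> 0"
  proof
    assume "m = 0"
    then have "Re m = 0" "Im m = 0" by auto
    then have "d + Im l * c = 0" "Re l * c = 0" by (auto simp: m_def)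
    then have "c = 0" "d = 0" using l by auto
    then show False using det by simp
  qed
  have "Re ((l * of_real a + \<i> * of_real b) * cnj m) = Re l * (a * d - b * c)"
    by (simp add: m_def algebra_simps)
  also have "\<dots> = Re l" by (simp add: det)
  finally have "Re ((l * of_real a + \<i> * of_real b) / m) = Re l / (cmod m)\<^sup>2"
    by (simp add: complex_div_cnj[of _ m] Re_divide_of_real del: of_real_power flip: of_real_power)
  then show "Re ((l * of_real a + \<i> * of_real b) / m) > 0" using l m by simp
qed

lemma FA_FI_ek:
  assumes l: "Re l > 0"
  shows "\<exists>l' z. Re l' > 0 \<and> (AE t in lborel. FA a b c d (FI (ek l)) t = z * FI (ek l') t)"
proof -
  define m where "m = of_real d - \<i> * l * of_real c"
  define l' where "l' = (l * of_real a + \<i> * of_real b) / m"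
  have m: "m \<noteq> 0" and l': "Re l' > 0"
    using Re_moebius[OF l] by (auto simp: m_def l'_def)
  have "AE t in lborel. FA a b c d (FI (ek l)) t = FA a b c d (\<lambda>t. of_real c0 / (l - \<i> * of_real t)) t"
    by (rule FA_cong[OF FI_ek[OF l]])
  then have "AE t in lborel. FA a b c d (FI (ek l)) t = (1 / m) * FI (ek l') t"
    using FI_ek[OF l'] AE_denom
  proof eventually_elim
    case (elim t)
    define r where "r = complex_of_real (a - c * t)"
    have r: "r \<noteq> 0" using elim(3) by (simp add: r_def del: of_real_diff of_real_mult)
    \<comment> \<open>The weight 1/(a - c t) cancels the denominator of the Moebius map; what
      remains is again of the form m (l' - i t), whence the constant 1/m.\<close>
    have 1: "r * (l - \<i> * of_real ((d * t - b) / (a - c * t))) = m * (l' - \<i> * of_real t)"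
    proof -
      have "r * (l - \<i> * of_real ((d * t - b) / (a - c * t))) = r * l - \<i> * of_real (d * t - b)"
        using r by (simp add: r_def right_diff_distrib del: of_real_diff of_real_mult)
      also have "\<dots> = m * l' - m * \<i> * of_real t"
      proof -
        have ml: "m * l' = l * of_real a + \<i> * of_real b" using m by (simp add: l'_def)
        show ?thesis unfolding ml by (simp add: r_def m_def algebra_simps)
      qed
      finally show ?thesis by (simp add: algebra_simps)
    qed
    have "FA a b c d (FI (ek l)) t = of_real c0 / (r * (l - \<i> * of_real ((d * t - b) / (a - c * t))))"
      unfolding elim(1) unfolding FA_def by (simp add: r_def del: of_real_diff of_real_mult)
    also have "\<dots> = of_real c0 / (m * (l' - \<i> * of_real t))" by (simp only: 1)
    also have "\<dots> = (1 / m) * FI (ek l') t" by (simp add: elim(2))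
    finally show ?case .
  qed
  with l' show ?thesis by blast
qed

section \<open>The Moebius action on the Fourier side and its invariant half-lines\<close>

definition J :: "(real \<Rightarrow> complex) \<Rightarrow> real \<Rightarrow> complex" where
  "J f = FF (FA a b c d (FI f))"

lemma L2f_J: "L2f f \<Longrightarrow> L2f (J f)"
  by (simp add: J_def L2f_FF L2f_FA L2f_FI)

lemma ip_J: "L2f f \<Longrightarrow> L2f g \<Longrightarrow> ip (J f) (J g) = ip f g"
  by (simp add: J_def ip_FF L2f_FA L2f_FI ip_FA ip_FI)

lemma J_cong:
  assumes f: "L2f f" and g: "L2f g" and "AE x in lborel. f x = g x"
  shows "AE x in lborel. J f x = J g x"
  unfolding J_def by (intro FF_cong FA_cong FI_cong L2f_FA L2f_FI assms)

lemma J_add: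
  assumes f: "L2f f" and g: "L2f g"
  shows "AE x in lborel. J (\<lambda>x. f x + g x) x = J f x + J g x"
proof -
  note L = L2f_FI[OF f] L2f_FI[OF g] L2f_FI[OF L2f_add[OF f g]]
  have "AE x in lborel. FA a b c d (FI (\<lambda>x. f x + g x)) x = FA a b c d (\<lambda>x. FI f x + FI g x) x"
    by (rule FA_cong[OF FI_add[OF f g]])
  then have "AE x in lborel. FA a b c d (FI (\<lambda>x. f x + g x)) x = FA a b c d (FI f) x + FA a b c d (FI g) x"
    by (simp only: FA_add)
  then have "AE x in lborel. J (\<lambda>x. f x + g x) x = FF (\<lambda>x. FA a b c d (FI f) x + FA a b c d (FI g) x) x"
    unfolding J_def by (intro FF_cong L2f_add L2f_FA L)
  then show ?thesis
    using FF_add[OF L2f_FA[OF L(1)] L2f_FA[OF L(2)]] by eventually_elim (simp add: J_def)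
qed

lemma J_scale:
  assumes f: "L2f f"
  shows "AE x in lborel. J (\<lambda>x. z * f x) x = z * J f x"
proof -
  note L = L2f_FI[OF f] L2f_FI[OF L2f_scale[OF f]]
  have "AE x in lborel. FA a b c d (FI (\<lambda>x. z * f x)) x = FA a b c d (\<lambda>x. z * FI f x) x"
    by (rule FA_cong[OF FI_scale[OF f]])
  then have "AE x in lborel. FA a b c d (FI (\<lambda>x. z * f x)) x = z * FA a b c d (FI f) x"
    by (simp only: FA_scale)
  then have "AE x in lborel. J (\<lambda>x. z * f x) x = FF (\<lambda>x. z * FA a b c d (FI f) x) x"
    unfolding J_def by (intro FF_cong L2f_scale L2f_FA L)
  then show ?thesis
    using FF_scale[OF L2f_FA[OF L(1)]] by eventually_elim (simp add: J_def)
qed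

text \<open>Tested against \<open>ek l\<close>, the adjoint of \<open>J\<close> belongs to the
  inverse matrix and turns \<open>ek l\<close> into a multiple of some \<open>ek l'\<close> on the
  Fourier side, to which a function living on the negative half-line is orthogonal.\<close>

lemma J_negative:
  assumes v: "L2f v" and v0: "AE y in lborel. y > 0 \<longrightarrow> v y = 0"
  shows "AE y in lborel. y > 0 \<longrightarrow> J v y = 0"
proof (rule ek_total[OF L2f_J[OF v]])
  interpret i: sl2 d "- b" "- c" a by (rule inverse)
  fix l :: complex assume l: "Re l > 0"
  obtain l' z where l': "Re l' > 0" and ae: "AE t in lborel. FA d (- b) (- c) a (FI (ek l)) t = z * FI (ek l') t"
    using i.FA_FI_ek[OF l] by blast
  note L = L2f_ek[OF l] L2f_FI[OF L2f_ek[OF l]] L2f_FI[OF L2f_ek[OF l']] L2f_FI[OF v]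
  have "ip (ek l) (J v) = ip (FI (ek l)) (FA a b c d (FI v))"
    unfolding J_def by (rule ip_FI_FF[symmetric]) (intro L L2f_FA)+
  also have "\<dots> = ip (FA d (- b) (- c) a (FI (ek l))) (FI v)"
    using i.ip_FA_adjoint[OF L(2,4)] by simp
  also have "\<dots> = ip (\<lambda>t. z * FI (ek l') t) (FI v)"
    by (intro ip_cong_AE L2f_measurable[OF i.L2f_FA[OF L(2)]] L2f_measurable[OF L2f_scale[OF L(3)]] L2f_measurable[OF L(4)] ae) simp
  also have "\<dots> = cnj z * ip (ek l') v"
    by (simp add: ip_scale_left ip_FI L2f_ek l' v)
  also have "ip (ek l') v = ip (\<lambda>x. 0) (\<lambda>x. 0)"
    unfolding ip_def
  proof (rule integral_cong_AE)
    show "(\<lambda>x. cnj (ek l' x) * v x) \<in> borel_measurable lborel"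
      using L2f_measurable[OF v] by measurable
    show "AE x in lborel. cnj (ek l' x) * v x = cnj 0 * 0"
      using v0 by eventually_elim (auto simp: ek_def split: split_indicator)
  qed simp
  finally show "ip (ek l) (J v) = 0" by (simp add: ip_def)
qed

text \<open>Duality: let v be the part of J u on the negative half-line. Its image under the inverse
  action stays there by \<open>J_negative\<close>, hence is orthogonal to u, and so v is orthogonal
  to J u, that is, to itself.\<close>

lemma J_positive:
  assumes u: "L2f u" and u0: "AE y in lborel. \<not> y > 0 \<longrightarrow> u y = 0"
  shows "AE y in lborel. \<not> y > 0 \<longrightarrow> J u y = 0"
proof -
  interpret i: sl2 d "- b" "- c" a by (rule inverse)
  define v where "v y = indicator {..0} y * J u y" for y
  have v: "L2f v" unfolding v_def by (intro L2f_indicator L2f_J u) simp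
  note L = L2f_FI[OF u] L2f_FI[OF v]
  have "ip v (J u) = ip (FI v) (FA a b c d (FI u))"
    unfolding J_def by (rule ip_FI_FF[symmetric]) (intro L L2f_FA v)+
  also have "\<dots> = ip (FA d (- b) (- c) a (FI v)) (FI u)"
    using i.ip_FA_adjoint[OF L(2,1)] by simp
  also have "\<dots> = ip (i.J v) u"
    unfolding i.J_def by (rule ip_FF_FI[symmetric]) (intro L i.L2f_FA u)+
  also have "\<dots> = ip (\<lambda>x. 0) (\<lambda>x. 0)"
    unfolding ip_def
  proof (rule integral_cong_AE)
    show "(\<lambda>x. cnj (i.J v x) * u x) \<in> borel_measurable lborel"
      using L2f_measurable[OF u] L2f_measurable[OF i.L2f_J[OF v]] by measurable
    have "AE y in lborel. y > 0 \<longrightarrow> i.J v y = 0"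
      by (rule i.J_negative[OF v]) (auto simp: v_def)
    then show "AE x in lborel. cnj (i.J v x) * u x = cnj 0 * 0"
      using u0 by eventually_elim (auto simp: not_less)
  qed simp
  finally have "ip v (J u) = 0" by (simp add: ip_def)
  moreover have "ip v (J u) = ip v v"
    unfolding ip_def by (intro Bochner_Integration.integral_cong) (auto simp: v_def split: split_indicator)
  ultimately have "nsq v = 0" by (simp add: ip_self)
  from nsq_eq_0[OF v this] show ?thesis
    by eventually_elim (auto simp: v_def)
qed

text \<open>Both half-lines are invariant, so \<open>J\<close> commutes with the projection.
  Compressing \<open>J\<close> to the half-line therefore loses nothing: this makes F'_A unitary and
  lets it intertwine compressed multipliers.\<close>

theorem J_indicator:
  assumes f: "L2f f"
  shows "AE y in lborel. J (\<lambda>y. indicator {0<..} y * f y) y = indicator {0<..} y * J f y"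
proof -
  let ?p = "\<lambda>y. indicator {0<..} y * f y" and ?n = "\<lambda>y. indicator {..0} y * f y"
  have p: "L2f ?p" and n: "L2f ?n" by (intro L2f_indicator f; simp)+
  have "(\<lambda>y. ?p y + ?n y) = f" by (auto split: split_indicator)
  then have "AE y in lborel. J f y = J ?p y + J ?n y" using J_add[OF p n] by simp
  moreover have "AE y in lborel. \<not> y > 0 \<longrightarrow> J ?p y = 0" by (rule J_positive[OF p]) auto
  moreover have "AE y in lborel. y > 0 \<longrightarrow> J ?n y = 0" by (rule J_negative[OF n]) auto
  ultimately show ?thesis
    by eventually_elim (auto split: split_indicator)
qed

lemma J_inverse:
  assumes f: "L2f f"
  shows "AE y in lborel. J (sl2.J d (- b) (- c) a f) y = f y"
proof -
  interpret i: sl2 d "- b" "- c" a by (rule inverse)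
  note L = L2f_FI[OF f]
  note L' = i.L2f_FA[OF L]
  have "AE y in lborel. FI (i.J f) y = FA d (- b) (- c) a (FI f) y"
    unfolding i.J_def by (rule FI_FF[OF L'])
  from FA_cong[OF this] FA_FA_inverse[of "FI f"]
  have "AE y in lborel. FA a b c d (FI (i.J f)) y = FI f y" by eventually_elim simp
  then have "AE y in lborel. J (i.J f) y = FF (FI f) y"
    unfolding J_def by (intro FF_cong L2f_FA L2f_FI i.L2f_J f)
  then show ?thesis using FF_FI[OF f] by eventually_elim simp
qed

end

section \<open>Fourier multipliers under the Moebius action\<close>

definition MF :: "(real \<Rightarrow> complex) \<Rightarrow> (real \<Rightarrow> complex) \<Rightarrow> real \<Rightarrow> complex" where
  "MF \<kappa> f = FF (\<lambda>t. \<kappa> t * FI f t)"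

lemma L2f_MF:
  assumes "L2f f" "\<kappa> \<in> borel_measurable borel" "\<And>x. cmod (\<kappa> x) \<le> C"
  shows "L2f (MF \<kappa> f)"
  unfolding MF_def by (intro L2f_FF L2f_bounded_mult[where C=C] L2f_FI assms)

lemma MF_cong:
  assumes f: "L2f f" "L2f g" and k: "\<kappa> \<in> borel_measurable borel" "\<And>x. cmod (\<kappa> x) \<le> C" and ae: "AE x in lborel. f x = g x"
  shows "AE x in lborel. MF \<kappa> f x = MF \<kappa> g x"
  unfolding MF_def
proof (intro FF_cong L2f_bounded_mult[where C=C] L2f_FI f k)
  show "AE x in lborel. \<kappa> x * FI f x = \<kappa> x * FI g x"
    using FI_cong[OF f ae] by eventually_elim simp
qed

text \<open>Composition with A^-1 acts separately on the symbol and on the function, the weight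
  going with the function.\<close>

lemma (in sl2) J_MF:
  assumes f: "L2f f"
    and k: "\<kappa> \<in> borel_measurable borel" "\<And>x. cmod (\<kappa> x) \<le> C"
    and k': "\<kappa>' \<in> borel_measurable borel" "\<And>x. cmod (\<kappa>' x) \<le> C"
    and eq: "AE x in lborel. \<kappa>' x = \<kappa> ((d * x - b) / (a - c * x))"
  shows "AE x in lborel. J (MF \<kappa> f) x = MF \<kappa>' (J f) x"
proof -
  let ?h = "\<lambda>t. \<kappa> t * FI f t"
  have h: "L2f ?h" by (intro L2f_bounded_mult[where C=C] L2f_FI f k)
  note L = L2f_FI[OF f]
  note LA = L2f_FA[OF L] L2f_FI[OF L2f_J[OF f]]
  have 1: "AE x in lborel. FA a b c d (FI (MF \<kappa> f)) x = FA a b c d ?h x"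
    unfolding MF_def by (rule FA_cong[OF FI_FF[OF h]])
  have 2: "AE x in lborel. FI (J f) x = FA a b c d (FI f) x"
    unfolding J_def by (rule FI_FF[OF LA(1)])
  have 3: "AE x in lborel. FA a b c d (FI (MF \<kappa> f)) x = \<kappa>' x * FI (J f) x"
    using 1 2 eq by eventually_elim (simp add: FA_def)
  show ?thesis
    unfolding J_def[of "MF \<kappa> f"] MF_def[of \<kappa>']
    by (intro FF_cong L2f_FA L2f_FI L2f_MF[where C=C] f k L2f_bounded_mult[where C=C] L2f_J k' 3)
qed

section \<open>The unitaries $F'_A$ and Wiener-Hopf operators\<close>

text \<open>\<open>matrix_inv\<close> is a choice; the adjugate shows that the choice is possible,
  and associativity that it is the adjugate.\<close>

lemma matrix_inv_2:
  fixes A :: "real^2^2"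
  assumes "det A = 1"
  shows "matrix_inv A = vector [vector [A$2$2, - A$1$2], vector [- A$2$1, A$1$1]]" (is "_ = ?B")
proof -
  have d: "A$1$1 * A$2$2 - A$1$2 * A$2$1 = 1" using assms by (simp add: det_2)
  have B: "A ** ?B = mat 1 \<and> ?B ** A = mat 1"
    using d by (simp add: vec_eq_iff forall_2 matrix_matrix_mult_def sum_2 mat_def algebra_simps)
  then have "A ** matrix_inv A = mat 1 \<and> matrix_inv A ** A = mat 1"
    unfolding matrix_inv_def by (rule someI[where P="\<lambda>A'. A ** A' = mat 1 \<and> A' ** A = mat 1"])
  then have "matrix_inv A ** (A ** ?B) = ?B"
    unfolding matrix_mul_assoc by simp
  then show ?thesis
    using B by simp
qed

lemma moebius_matrix_inv:
  "det A = 1 \<Longrightarrow> moebius (matrix_inv A) x = (A$2$2 * x - A$1$2) / (A$1$1 - A$2$1 * x)"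
  by (simp add: moebius_def matrix_inv_2)

lemma sl2_det: "det (A :: real^2^2) = 1 \<Longrightarrow> sl2 (A$1$1) (A$1$2) (A$2$1) (A$2$2)"
  by unfold_locales (simp add: det_2)

lemma F_op_ae_class:
  assumes A: "det A = 1" and f: "L2f f"
  shows "F_op A (ae_class UNIV f) = ae_class UNIV (FA (A$1$1) (A$1$2) (A$2$1) (A$2$2) f)"
proof -
  interpret sl2 "A$1$1" "A$1$2" "A$2$1" "A$2$2" by (rule sl2_det[OF A])
  show ?thesis
    unfolding F_op_def
  proof (rule ae_class_eqI)
    show "AE x in lborel. x \<in> UNIV \<longrightarrow>
        of_real (1 / (- A$2$1 * x + A$1$1)) * rep (ae_class UNIV f) (moebius (matrix_inv A) x)
        = FA (A$1$1) (A$1$2) (A$2$1) (A$2$2) f x"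
      using FA_cong[OF ext_ae_class_UNIV[OF f]]
      by eventually_elim (simp add: FA_def ext_def moebius_matrix_inv[OF A])
  qed simp
qed

abbreviation JA :: "real^2^2 \<Rightarrow> (real \<Rightarrow> complex) \<Rightarrow> real \<Rightarrow> complex" where
  "JA A \<equiv> sl2.J (A$1$1) (A$1$2) (A$2$1) (A$2$2)"

lemma F_op'_eq:
  assumes A: "det A = 1" and u: "u \<in> L2 Rplus"
  shows "F_op' A u = ae_class Rplus (\<lambda>x. indicator Rplus x * JA A (ext Rplus u) x)"
proof -
  interpret sl2 "A$1$1" "A$1$2" "A$2$1" "A$2$2" by (rule sl2_det[OF A])
  have e: "L2f (ext Rplus u)" by (intro L2f_ext u) simp
  show ?thesis
    by (simp add: F_op'_def P_plus_adj_eq fourier_inv_ae_class F_op_ae_class A fourier_ae_class P_plus_ae_class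
        e L2f_FI L2f_FF L2f_FA J_def)
qed

lemma L2on_indicator_eq: "L2on S f \<Longrightarrow> (\<lambda>x. indicator S x * f x) = f"
  by (auto simp: L2on_def split: split_indicator)

lemma JA_L2on:
  assumes A: "det A = 1" and f: "L2on Rplus f"
  shows "AE x in lborel. indicator Rplus x * JA A f x = JA A f x"
proof -
  interpret sl2 "A$1$1" "A$1$2" "A$2$1" "A$2$2" by (rule sl2_det[OF A])
  show ?thesis
    using J_indicator[OF L2on_L2f[OF f]] unfolding L2on_indicator_eq[OF f] by eventually_elim simp
qed

lemma hilbert_iso_F_op':
  assumes A: "det A = 1"
  shows "hilbert_iso Rplus Rplus (F_op' A)"
proof -
  interpret sl2 "A$1$1" "A$1$2" "A$2$1" "A$2$2" by (rule sl2_det[OF A])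
  interpret i: sl2 "A$2$2" "- (A$1$2)" "- (A$2$1)" "A$1$1" by (rule inverse)
  let ?v = "\<lambda>f x. indicator Rplus x * J f x"
  note ae = JA_L2on[OF A]
  have L: "L2on Rplus (?v f)" if "L2on Rplus f" for f
    using that by (intro L2on_indicator L2f_J L2on_L2f) auto
  show ?thesis
  proof (rule hilbert_isoI[where v="?v"])
    show "F_op' A u = ae_class Rplus (?v (ext Rplus u))" if "u \<in> L2 Rplus" for u
      by (rule F_op'_eq[OF A that])
    show "L2on Rplus (?v f)" if "L2on Rplus f" for f by (rule L[OF that])
    show "AE x in lborel. ?v f x = ?v g x"
      if fg: "L2on Rplus f" "L2on Rplus g" "AE x in lborel. f x = g x" for f g
      using J_cong[OF fg(1,2)[THEN L2on_L2f] fg(3)] by eventually_elim simp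
    show "AE x in lborel. ?v (\<lambda>x. f x + g x) x = ?v f x + ?v g x"
      if fg: "L2on Rplus f" "L2on Rplus g" for f g
      using J_add[OF fg[THEN L2on_L2f]] by eventually_elim (simp add: distrib_left)
    show "AE x in lborel. ?v (\<lambda>x. c * f x) x = c * ?v f x" if f: "L2on Rplus f" for c f
      using J_scale[OF L2on_L2f[OF f], of c] by eventually_elim simp
    show "ip (?v f) (?v g) = ip f g" if fg: "L2on Rplus f" "L2on Rplus g" for f g
    proof -
      have "ip (?v f) (?v g) = ip (J f) (J g)"
        using fg by (intro ip_cong_AE ae L2f_measurable[OF L2on_L2f[OF L]] L2f_measurable[OF L2f_J[OF L2on_L2f]])
      then show ?thesis using fg by (simp add: ip_J L2on_L2f)
    qed
    show "\<exists>f. L2on Rplus f \<and> (AE x in lborel. ?v f x = g x)" if g: "L2on Rplus g" for g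
    proof (intro exI conjI)
      note Lg = L2on_L2f[OF g]
      \<comment> \<open>The preimage comes from the inverse matrix; cutting it off changes nothing
        almost everywhere, as \<open>i.J\<close> preserves the half-line too.\<close>
      let ?f = "\<lambda>x. indicator Rplus x * i.J g x"
      show f: "L2on Rplus ?f" by (intro L2on_indicator i.L2f_J Lg) simp
      have "AE x in lborel. i.J g x = ?f x"
        using i.J_indicator[OF Lg] by (simp add: L2on_indicator_eq[OF g])
      from J_cong[OF i.L2f_J[OF Lg] L2on_L2f[OF f] this] J_inverse[OF Lg]
      show "AE x in lborel. ?v ?f x = g x"
      proof eventually_elim
        case (elim x)
        then show ?case using g by (auto simp: L2on_def split: split_indicator)
      qed
    qed
  qed simp_all
qed

lemma wiener_hopf_MF:
  assumes "u \<in> L2 Rplus" "\<kappa> \<in> borel_measurable borel" "\<And>x. cmod (\<kappa> x) \<le> C"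
  shows "wiener_hopf \<kappa> u = ae_class Rplus (\<lambda>x. indicator Rplus x * MF \<kappa> (ext Rplus u) x)"
  unfolding MF_def by (rule wiener_hopf_eq[OF assms])

lemma wiener_hopf_mem:
  assumes "u \<in> L2 Rplus" "\<kappa> \<in> borel_measurable borel" "\<And>x. cmod (\<kappa> x) \<le> C"
  shows "wiener_hopf \<kappa> u \<in> L2 Rplus"
  unfolding wiener_hopf_MF[OF assms]
  by (intro ae_class_L2 L2f_indicator L2f_MF[where C=C] L2f_ext assms) auto

theorem conjugate_via_F_op':
  assumes A: "det A = 1"
    and k: "\<kappa> \<in> borel_measurable borel" "\<And>x. cmod (\<kappa> x) \<le> C"
    and k': "\<kappa>' \<in> borel_measurable borel" "\<And>x. cmod (\<kappa>' x) \<le> C"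
    and eq: "AE x in lborel. \<kappa>' x = \<kappa> (moebius (matrix_inv A) x)"
  shows "conjugate_via Rplus Rplus (F_op' A) (wiener_hopf \<kappa>) (wiener_hopf \<kappa>')"
  unfolding conjugate_via_iff
proof (intro conjI ballI image_subsetI)
  interpret sl2 "A$1$1" "A$1$2" "A$2$1" "A$2$2" by (rule sl2_det[OF A])
  show iso: "hilbert_iso Rplus Rplus (F_op' A)" by (rule hilbert_iso_F_op'[OF A])
  fix u assume u: "u \<in> L2 Rplus"
  show W: "wiener_hopf \<kappa> u \<in> L2 Rplus" by (rule wiener_hopf_mem[OF u k])
  have V: "F_op' A u \<in> L2 Rplus" by (rule hilbert_iso_mem[OF iso u])
  let ?e = "ext Rplus u"
  have R: "Rplus \<in> sets (borel :: real measure)" by simp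
  have e1: "L2on Rplus ?e" by (rule ext_L2(1)[OF R u])
  note e = L2on_L2f[OF e1]
  note eV = L2f_ext[OF R V] and eW = L2f_ext[OF R W]
  have m: "L2f (MF \<kappa> ?e)" by (rule L2f_MF[OF e k])
  have "AE x in lborel. ext Rplus (F_op' A u) x = indicator Rplus x * J ?e x"
    unfolding F_op'_eq[OF A u] by (intro ext_ae_class_L2on L2on_indicator L2f_J e R)
  with JA_L2on[OF A e1] have "AE x in lborel. ext Rplus (F_op' A u) x = J ?e x"
    by eventually_elim simp
  from MF_cong[OF eV L2f_J[OF e] k' this] J_MF[OF e k k' eq[unfolded moebius_matrix_inv[OF A]]]
  have 1: "AE x in lborel. MF \<kappa>' (ext Rplus (F_op' A u)) x = J (MF \<kappa> ?e) x"
    by eventually_elim simp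
  have "AE x in lborel. ext Rplus (wiener_hopf \<kappa> u) x = indicator Rplus x * MF \<kappa> ?e x"
    unfolding wiener_hopf_MF[OF u k] by (intro ext_ae_class_L2on L2on_indicator m R)
  from J_cong[OF eW L2f_indicator[OF m R] this] J_indicator[OF m]
  have 2: "AE x in lborel. J (ext Rplus (wiener_hopf \<kappa> u)) x = indicator Rplus x * J (MF \<kappa> ?e) x"
    by eventually_elim simp
  show "wiener_hopf \<kappa>' (F_op' A u) = F_op' A (wiener_hopf \<kappa> u)"
    unfolding wiener_hopf_MF[OF V k'] F_op'_eq[OF A W]
  proof (rule ae_class_eqI[OF R])
    show "AE x in lborel. x \<in> Rplus \<longrightarrow> indicator Rplus x * MF \<kappa>' (ext Rplus (F_op' A u)) x
        = indicator Rplus x * J (ext Rplus (wiener_hopf \<kappa> u)) x"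
      using 1 2 by eventually_elim simp
  qed
qed

section \<open>The operator $2K-I$ as a Wiener-Hopf operator\<close>

lemma integral_exp_ii_sinc:
  "(LINT t|lborel. indicator {-1..1} t * exp (\<i> * of_real (w * t))) = of_real (2 * sinc w)"
proof (cases "w = 0")
  case True
  have "(LINT t|lborel. indicator {-1..1::real} t * exp (\<i> * of_real (w * t))) = (LINT t|lborel. of_real (indicator {-1..1::real} t))"
    using True by (intro Bochner_Integration.integral_cong) (auto split: split_indicator)
  also have "\<dots> = of_real (LINT t|lborel. indicator {-1..1::real} t)"
    by (intro integral_of_real integrable_real_indicator) (auto simp: emeasure_lborel_Icc_eq)
  finally show ?thesis using True by simp
next
  case False
  let ?F = "\<lambda>t::real. exp (\<i> * of_real (w * t)) / (\<i> * of_real w)"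
  have "(LINT t|lborel. indicator {-1..1} t *\<^sub>R exp (\<i> * of_real (w * t))) = ?F 1 - ?F (-1)"
  proof (rule integral_FTC_atLeastAtMost)
    show "(?F has_vector_derivative exp (\<i> * of_real (w * t))) (at t within {-1..1})" for t
    proof -
      have "((\<lambda>z. exp (\<i> * (of_real w * z)) / (\<i> * of_real w)) has_field_derivative exp (\<i> * (of_real w * of_real t))) (at (of_real t))"
        using False by (auto intro!: derivative_eq_intros simp: mult.commute[of _ \<i>] mult.left_commute)
      from has_vector_derivative_real_field[OF this] show ?thesis by simp
    qed
  qed (auto intro!: continuous_intros)
  also have "\<dots> = of_real (2 * sinc w)"
    using False by (simp add: sin_exp_eq field_simps flip: sin_of_real)
  finally show ?thesis by (simp add: scaleR_conv_of_real of_real_indicator)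
qed

text \<open>The value at x is the inner product of a modulated indicator with FI e. Moving
  \<open>FI\<close> to the other side transforms the indicator into a shifted sinc, with the
  constant 2 c0^2 = 1/pi.\<close>

lemma MF_indicator_eq:
  assumes e: "L2f e"
  shows "AE x in lborel. MF (indicator {-1..1}) e x = (LINT y|lborel. of_real (1 / pi * sinc (x - y)) * e y)"
proof -
  let ?h = "\<lambda>t. indicator {-1..1} t * FI e t"
  have h2: "L2f ?h" by (intro L2f_indicator L2f_FI e) simp
  have h1: "integrable lborel ?h"
    by (intro L2f_integrable_mult L2f_indicator_Icc L2f_FI e)
  have "FT0 ?h x = (LINT y|lborel. of_real (1 / pi * sinc (x - y)) * e y)" for x
  proof -
    let ?q = "\<lambda>t. of_real c0 * exp (\<i> * of_real (x * t)) * indicator {-1..1} t"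
    have q2: "L2f ?q"
      by (rule L2f_bounded_mult[OF L2f_indicator_Icc, where C=c0])
        (use c0_pos in \<open>auto simp: norm_mult simp del: of_real_mult\<close>)
    have q1: "integrable lborel ?q"
    proof (rule Bochner_Integration.integrable_bound)
      show "integrable lborel (\<lambda>t::real. c0 * indicator {-1..1} t)" by simp
    qed (use c0_pos in \<open>auto simp: norm_mult simp del: of_real_mult split: split_indicator\<close>)
    have "FT0 ?h x = ip ?q (FI e)"
      unfolding FT0_def ip_def Bochner_Integration.integral_mult_right_zero[symmetric]
      by (intro Bochner_Integration.integral_cong) (auto simp: exp_cnj split: split_indicator)
    also have "\<dots> = ip (FF ?q) e" by (rule ip_FF_FI[OF q2 e, symmetric])
    also have "\<dots> = ip (FT0 ?q) e"
      using L2f_measurable[OF e] L2f_measurable[OF q2]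
      by (intro ip_cong_AE FF_eq_FT0 q1 q2 L2f_measurable[OF L2f_FF[OF q2]]) auto
    also have "FT0 ?q = (\<lambda>y. of_real (1 / pi * sinc (x - y)))"
    proof
      fix y
      have "exp (- (\<i> * of_real (y * t))) * ?q t = of_real c0 * (indicator {-1..1} t * exp (\<i> * of_real ((x - y) * t)))" for t
        by (auto simp: exp_add[symmetric] algebra_simps split: split_indicator)
      then have "FT0 ?q y = of_real c0 * (of_real c0 * of_real (2 * sinc (x - y)))"
        unfolding FT0_def integral_exp_ii_sinc[symmetric]
        by (simp only: Bochner_Integration.integral_mult_right_zero)
      also have "\<dots> = of_real (c0 * c0 * (2 * sinc (x - y)))" by simp
      also have "c0 * c0 * (2 * sinc (x - y)) = 1 / pi * sinc (x - y)" by (simp add: c0_sq)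
      finally show "FT0 ?q y = of_real (1 / pi * sinc (x - y))" .
    qed
    finally show ?thesis by (simp add: ip_def)
  qed
  then show ?thesis using FF_eq_FT0[OF h2 h1] by (simp add: MF_def)
qed

lemma twoK_minus_I_eq:
  assumes u: "u \<in> L2 Rplus"
  shows "twoK_minus_I u = wiener_hopf (\<lambda>x. 2 * indicator {-1..1} x - 1) u"
proof -
  let ?\<kappa> = "\<lambda>x::real. 2 * indicator {-1..1} x - 1 :: complex"
  let ?e = "ext Rplus u"
  have R: "Rplus \<in> sets (borel :: real measure)" by simp
  have e: "L2f ?e" by (rule L2f_ext[OF R u])
  have k: "?\<kappa> \<in> borel_measurable borel" "\<And>x. cmod (?\<kappa> x) \<le> 1"
    by (auto split: split_indicator)
  have k1: "(indicator {-1..1} :: real \<Rightarrow> complex) \<in> borel_measurable borel" "\<And>x. cmod (indicator {-1..1::real} x) \<le> 1"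
    by (rule borel_measurable_indicator) (auto split: split_indicator)
  have m: "L2f (MF (indicator {-1..1}) ?e)" by (rule L2f_MF[OF e k1])
  have K: "K_op u = ae_class Rplus (MF (indicator {-1..1}) ?e)"
    unfolding K_op_def
  proof (rule ae_class_eqI[OF R])
    have *: "(LINT y|leb Rplus. of_real (1 / pi * sinc (x - y)) * rep u y) = (LINT y|lborel. of_real (1 / pi * sinc (x - y)) * ?e y)" for x
      unfolding integral_leb[OF R]
      by (intro Bochner_Integration.integral_cong) (auto simp: ext_def split: split_indicator)
    show "AE x in lborel. x \<in> Rplus \<longrightarrow>
        (LINT y|leb Rplus. of_real (1 / pi * sinc (x - y)) * rep u y) = MF (indicator {-1..1}) ?e x"
      using MF_indicator_eq[OF e]
    proof eventually_elim
      case (elim x)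
      show ?case unfolding * elim by (rule impI) (rule refl)
    qed
  qed
  have 1: "AE x in lborel. ext Rplus (K_op u) x = indicator Rplus x * MF (indicator {-1..1}) ?e x"
    unfolding K by (rule ext_ae_class[OF R m])
  have "L2f (ext Rplus (K_op u))" unfolding K by (intro L2f_ext R ae_class_L2 m)
  then have 2: "AE x in lborel. ext Rplus (L2_scale Rplus 2 (K_op u)) x = indicator Rplus x * (2 * ext Rplus (K_op u) x)"
    unfolding L2_scale_ext[OF R] by (intro ext_ae_class[OF R] L2f_scale)
  have 3: "AE x in lborel. ext Rplus (L2_scale Rplus (-1) u) x = indicator Rplus x * (-1 * ?e x)"
    unfolding L2_scale_ext[OF R] by (intro ext_ae_class[OF R] L2f_scale e)
  let ?h = "\<lambda>t. indicator {-1..1} t * FI ?e t"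
  have h: "L2f ?h" by (intro L2f_indicator L2f_FI e) simp
  have "(\<lambda>t. ?\<kappa> t * FI ?e t) = (\<lambda>t. 2 * ?h t + -1 * FI ?e t)" by (auto simp: algebra_simps)
  then have Meq: "MF ?\<kappa> ?e = FF (\<lambda>t. 2 * ?h t + -1 * FI ?e t)" by (simp only: MF_def)
  have 4: "AE x in lborel. MF ?\<kappa> ?e x = 2 * MF (indicator {-1..1}) ?e x - ?e x"
    unfolding Meq using FF_add[OF L2f_scale[OF h, of 2] L2f_scale[OF L2f_FI[OF e], of "-1"]] FF_scale[OF h, of 2]
      FF_scale[OF L2f_FI[OF e], of "-1"] FF_FI[OF e]
    by eventually_elim (simp add: MF_def)
  show ?thesis
    unfolding twoK_minus_I_def L2_add_ext[OF R] wiener_hopf_MF[OF u k]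
  proof (rule ae_class_eqI[OF R])
    show "AE x in lborel. x \<in> Rplus \<longrightarrow> ext Rplus (L2_scale Rplus 2 (K_op u)) x + ext Rplus (L2_scale Rplus (-1) u) x
        = indicator Rplus x * MF ?\<kappa> ?e x"
      using 1 2 3 4 by eventually_elim (simp add: algebra_simps)
  qed
qed

section \<open>The Hilbert transformation on the line\<close>

text \<open>The Hilbert transformation of the line, introduced as a multiplier;
  \<open>AE_principal_value\<close> shows that it is the principal value with the factor 1/(i pi).
  The minus sign belongs to the order of \<open>FF\<close> and \<open>FI\<close> in
  \<open>MF\<close>.\<close>

definition HT :: "(real \<Rightarrow> complex) \<Rightarrow> real \<Rightarrow> complex" where
  "HT = MF (\<lambda>t. - of_real (sgn t))"

lemma sgn_multiplier:
  "(\<lambda>t::real. - complex_of_real (sgn t)) \<in> borel_measurable borel" "cmod (- complex_of_real (sgn t)) \<le> 1"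
proof -
  have "(\<lambda>t::real. if t = 0 then 0 else if 0 < t then 1 else - 1 :: real) \<in> borel_measurable borel"
    by measurable
  then have [measurable]: "(sgn :: real \<Rightarrow> real) \<in> borel_measurable borel"
    by (simp add: sgn_if[abs_def])
  show "(\<lambda>t::real. - complex_of_real (sgn t)) \<in> borel_measurable borel" by measurable
  show "cmod (- complex_of_real (sgn t)) \<le> 1" by (simp add: sgn_if)
qed

lemma L2f_HT: "L2f f \<Longrightarrow> L2f (HT f)"
  unfolding HT_def by (rule L2f_MF[OF _ sgn_multiplier])

lemma HT_cong: "L2f f \<Longrightarrow> L2f g \<Longrightarrow> AE x in lborel. f x = g x \<Longrightarrow> AE x in lborel. HT f x = HT g x"
  unfolding HT_def by (rule MF_cong[OF _ _ sgn_multiplier])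

lemma FF_reflect:
  assumes f: "L2f f"
  shows "AE x in lborel. FF (\<lambda>x. f (- x)) x = FI f x"
proof -
  obtain a where a: "FF_approx f (FF f) a" using FF_approx_FF[OF f] by blast
  have "FF_approx (\<lambda>x. f (- x)) (FI f) (\<lambda>n x. a n (- x))"
    unfolding FF_approx_def
  proof (intro conjI allI)
    show "L12 (\<lambda>x. a n (- x))" for n
      using a lborel_integrable_real_affine[of "a n" "-1" 0]
      by (auto simp: FF_approx_def L12_def intro: L2f_reflect)
    have "nsq (\<lambda>x. a n (- x) - f (- x)) = nsq (\<lambda>x. a n x - f x)" for n
      by (rule nsq_reflect)
    then show "(\<lambda>n. nsq (\<lambda>x. a n (- x) - f (- x))) \<longlonglongrightarrow> 0"
      using a by (simp add: FF_approx_def)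
    have "nsq (\<lambda>x. FT0 (\<lambda>x. a n (- x)) x - FI f x) = nsq (\<lambda>x. FT0 (a n) x - FF f x)" for n
      unfolding FT0_reflect FI_def by (rule nsq_reflect)
    then show "(\<lambda>n. nsq (\<lambda>x. FT0 (\<lambda>x. a n (- x)) x - FI f x)) \<longlonglongrightarrow> 0"
      using a by (simp add: FF_approx_def)
  qed
  then show ?thesis by (intro FF_unique L2f_reflect L2f_FI f)
qed

text \<open>sgn is odd and reflection exchanges \<open>FF\<close> with \<open>FI\<close>, so the
  multiplier changes sign. In this order the multiplier acts on \<open>FF f\<close>, which is where
  \<open>J\<close> acts.\<close>

lemma HT_eq_FI:
  assumes f: "L2f f"
  shows "AE x in lborel. HT f x = FI (\<lambda>t. of_real (sgn t) * FF f t) x"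
proof -
  let ?q = "\<lambda>t. of_real (sgn t) * FF f t"
  have "L2f (\<lambda>t. - of_real (sgn t) * FF f t)"
    by (rule L2f_bounded_mult[OF L2f_FF[OF f] sgn_multiplier])
  from L2f_uminus[OF this] have q: "L2f ?q" by simp
  have "HT f = FF (\<lambda>t. ?q (- t))"
    by (simp add: HT_def MF_def FI_def sgn_minus)
  then show ?thesis using FF_reflect[OF q] by simp
qed

text \<open>Off 0, sgn is twice the indicator of the positive half-line minus 1, so multiplication
  by it commutes with \<open>J\<close> by \<open>J_indicator\<close>.\<close>

theorem (in sl2) HT_FA:
  assumes f: "L2f f"
  shows "AE x in lborel. HT (FA a b c d f) x = FA a b c d (HT f) x"
proof -
  define p where "p = FF f"
  have p: "L2f p" unfolding p_def by (rule L2f_FF[OF f])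
  have fp: "AE x in lborel. FI p x = f x" unfolding p_def by (rule FI_FF[OF f])
  note Af = L2f_FA[OF f]
  let ?s = "\<lambda>q t. of_real (sgn t) * q t"
  have s: "L2f (?s q)" if "L2f q" for q
    using L2f_uminus[OF L2f_bounded_mult[OF that sgn_multiplier]] by simp
  have Jp: "AE x in lborel. J p x = FF (FA a b c d f) x"
    unfolding J_def by (intro FF_cong L2f_FA L2f_FI p f FA_cong fp)
  have "AE x in lborel. J (?s p) x = ?s (J p) x"
  proof -
    define P where "P t = indicator {0<..} t * p t" for t
    define A where "A t = 2 * P t" for t
    define B where "B t = -1 * p t" for t
    have P: "L2f P" unfolding P_def by (intro L2f_indicator p) simp
    have A: "L2f A" unfolding A_def by (rule L2f_scale[OF P])
    have B: "L2f B" unfolding B_def by (rule L2f_scale[OF p])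
    have nz: "AE t::real in lborel. t \<noteq> 0" by (rule AE_lborel_singleton)
    then have "AE t in lborel. ?s p t = A t + B t"
      by eventually_elim (auto simp: A_def B_def P_def sgn_if split: split_indicator)
    then have 1: "AE x in lborel. J (?s p) x = J (\<lambda>t. A t + B t) x"
      by (intro J_cong s p L2f_add A B)
    have 2: "AE x in lborel. J (\<lambda>t. A t + B t) x = J A x + J B x" by (rule J_add[OF A B])
    have 3: "AE x in lborel. J A x = 2 * J P x" unfolding A_def by (rule J_scale[OF P])
    have 4: "AE x in lborel. J B x = -1 * J p x" unfolding B_def by (rule J_scale[OF p])
    have 5: "AE x in lborel. J P x = indicator {0<..} x * J p x" unfolding P_def by (rule J_indicator[OF p])
    show ?thesis
      using 1 2 3 4 5 nz
    proof eventually_elim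
      case (elim x)
      have "J (?s p) x = 2 * (indicator {0<..} x * J p x) + -1 * J p x"
        unfolding elim(1-5) ..
      moreover have "2 * (indicator {0<..} x * J p x) + -1 * J p x = of_real (sgn x) * J p x"
        using elim(6) by (cases "x > 0") (simp_all add: sgn_if)
      ultimately show ?case by (rule trans)
    qed
  qed
  then have Js: "AE x in lborel. J (?s p) x = ?s (FF (FA a b c d f)) x"
    using Jp by eventually_elim simp
  have "AE x in lborel. FA a b c d (HT f) x = FA a b c d (FI (?s p)) x"
    using HT_eq_FI[OF f] unfolding p_def by (rule FA_cong)
  moreover have "AE x in lborel. FI (J (?s p)) x = FA a b c d (FI (?s p)) x"
    unfolding J_def by (intro FI_FF L2f_FA L2f_FI s p)
  moreover have "AE x in lborel. FI (J (?s p)) x = FI (?s (FF (FA a b c d f))) x"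
    by (intro FI_cong L2f_J s L2f_FF Af p Js)
  moreover have "AE x in lborel. HT (FA a b c d f) x = FI (?s (FF (FA a b c d f))) x"
    by (rule HT_eq_FI[OF Af])
  ultimately show ?thesis by eventually_elim simp
qed

section \<open>Principal values\<close>

text \<open>Conjugate Poisson kernel at height \<open>e\<close>, again without the factor
  1/pi.\<close>

definition qkern :: "real \<Rightarrow> real \<Rightarrow> real" where
  "qkern e s = s / (s\<^sup>2 + e\<^sup>2)"

lemma qkern_measurable [measurable]: "qkern e \<in> borel_measurable borel"
  unfolding qkern_def by measurable

lemma L2f_qkern:
  assumes e: "e > 0"
  shows "L2f (\<lambda>y. of_real (qkern e (y - x)))"
proof (rule L2f_bound)
  show "integrable lborel (\<lambda>y. (1 / e) * pkern e (y - x))"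
    by (intro integrable_mult_right integrable_pkern e)
  show "AE y in lborel. (cmod (of_real (qkern e (y - x))))\<^sup>2 \<le> (1 / e) * pkern e (y - x)"
  proof (intro always_eventually allI)
    fix y
    define s where "s = y - x"
    have p: "s\<^sup>2 + e\<^sup>2 > 0" using e by (intro add_nonneg_pos) auto
    have "(qkern e s)\<^sup>2 = s\<^sup>2 / (s\<^sup>2 + e\<^sup>2) * (1 / (s\<^sup>2 + e\<^sup>2))"
      by (simp add: qkern_def power_divide power2_eq_square[of "s\<^sup>2 + e\<^sup>2"])
    also have "\<dots> \<le> 1 * (1 / (s\<^sup>2 + e\<^sup>2))"
      using p by (intro mult_right_mono) auto
    also have "\<dots> = (1 / e) * pkern e s" using e by (simp add: pkern_def)
    finally show "(cmod (of_real (qkern e (y - x))))\<^sup>2 \<le> (1 / e) * pkern e (y - x)"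
      by (simp add: s_def)
  qed
qed measurable

text \<open>The harmonic extension of \<^term>\<open>HT f\<close> is the conjugate harmonic extension of \<^term>\<open>f\<close>: on the Fourier
  side both sides are multiplications, by \<open>exp (- e \<bar>t\<bar>) * - sgn t\<close>.\<close>

lemma pkern_HT:
  assumes f: "L2f f" and e: "e > 0"
  shows "1 / of_real pi * (LINT y|lborel. of_real (pkern e (y - x)) * HT f y)
    = 1 / (\<i> * of_real pi) * (LINT y|lborel. of_real (qkern e (y - x)) * f y)"
proof -
  \<comment> \<open>With these parameters \<open>ek l\<close> and the reflected \<open>ek l'\<close>
    are the two halves of exp (-e |t| + i x t). The sum of their transforms is 2 c0 times the
    Poisson kernel, the difference, negative half minus positive half, 2 i c0 times its
    conjugate.\<close>
  define l where "l = of_real e - \<i> * of_real x"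
  define l' where "l' = of_real e + \<i> * of_real x"
  have l: "Re l > 0" "Re l' > 0" using e by (auto simp: l_def l'_def)
  let ?p = "ek l" and ?n = "\<lambda>t. ek l' (- t)"
  have p: "L12 ?p" by (rule L12_ek[OF l(1)])
  have n: "L12 ?n"
    using L12_ek[OF l(2)] lborel_integrable_real_affine[of "ek l'" "-1" 0]
    by (auto simp: L12_def intro: L2f_reflect)
  have p2: "L2f ?p" and n2: "L2f ?n" using p n by (auto simp: L12_def)
  have Fp: "FT0 ?p y = of_real c0 / (l + \<i> * of_real y)" for y
    using FT0_ek[OF l(1), of "- y"] by simp
  have Fn: "FT0 ?n y = of_real c0 / (l' - \<i> * of_real y)" for y
    unfolding FT0_reflect by (rule FT0_ek[OF l(2)])
  have nz: "l + \<i> * of_real y \<noteq> 0" "l' - \<i> * of_real y \<noteq> 0" for y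
  proof -
    have "Re (l + \<i> * of_real y) > 0" "Re (l' - \<i> * of_real y) > 0" using l by auto
    then show "l + \<i> * of_real y \<noteq> 0" "l' - \<i> * of_real y \<noteq> 0" by (metis less_irrefl zero_complex.sel(1))+
  qed
  have prod: "(l + \<i> * of_real y) * (l' - \<i> * of_real y) = of_real ((y - x)\<^sup>2 + e\<^sup>2)" for y
    by (simp add: l_def l'_def algebra_simps power2_eq_square)
  have frac: "z / A + z / B = z * (A + B) / (A * B)" "z / B - z / A = z * (A - B) / (A * B)"
    if "A \<noteq> 0" "B \<noteq> 0" for z A B :: complex
    using that by (simp_all add: field_simps)
  have ipF: "ip (FT0 q) w = ip q (FI w)" if "L12 q" "L2f w" for q w
  proof -
    have q: "L2f q" "integrable lborel q" using that by (auto simp: L12_def)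
    have "ip (FT0 q) w = ip (FF q) w"
      using FF_eq_FT0[OF q] L2f_measurable[OF q(1)] L2f_measurable[OF that(2)] L2f_measurable[OF L2f_FF[OF q(1)]]
      by (intro ip_cong_AE) (auto elim: eventually_mono)
    then show ?thesis by (simp add: ip_FF_FI q that)
  qed
  note w = L2f_HT[OF f]
  have FIw: "AE t in lborel. FI (HT f) t = - of_real (sgn t) * FI f t"
    unfolding HT_def MF_def by (intro FI_FF L2f_bounded_mult[OF L2f_FI[OF f] sgn_multiplier])
  have sw: "ip ?p (FI (HT f)) = - ip ?p (FI f)" "ip ?n (FI (HT f)) = ip ?n (FI f)"
  proof -
    note [measurable] = L2f_measurable[OF L2f_FI[OF w]] L2f_measurable[OF L2f_FI[OF f]]
    have "ip ?p (FI (HT f)) = (LINT t|lborel. - (cnj (?p t) * FI f t))"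
      unfolding ip_def using FIw
      by (intro integral_cong_AE) (auto elim!: eventually_mono simp: ek_def sgn_if split: split_indicator)
    then show "ip ?p (FI (HT f)) = - ip ?p (FI f)" by (simp add: ip_def)
    show "ip ?n (FI (HT f)) = ip ?n (FI f)"
      unfolding ip_def using FIw
      by (intro integral_cong_AE) (auto elim!: eventually_mono simp: ek_def sgn_if split: split_indicator)
  qed
  have "ip (\<lambda>y. FT0 ?p y + FT0 ?n y) (HT f) = ip (\<lambda>y. FT0 ?n y - FT0 ?p y) f"
    using p n w f by (simp add: ip_add_left ip_diff_left L2f_FT0 ipF sw)
  moreover have "FT0 ?p y + FT0 ?n y = of_real (c0 * 2) * of_real (pkern e (y - x))" for y
  proof -
    have "FT0 ?p y + FT0 ?n y = of_real c0 * ((l + \<i> * of_real y) + (l' - \<i> * of_real y)) / ((l + \<i> * of_real y) * (l' - \<i> * of_real y))"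
      unfolding Fp Fn by (rule frac(1)[OF nz])
    also have "(l + \<i> * of_real y) + (l' - \<i> * of_real y) = of_real (2 * e)" by (simp add: l_def l'_def)
    finally show ?thesis unfolding prod by (simp add: pkern_def)
  qed
  moreover have "FT0 ?n y - FT0 ?p y = of_real (c0 * 2) * (\<i> * of_real (qkern e (y - x)))" for y
  proof -
    have "FT0 ?n y - FT0 ?p y = of_real c0 * ((l + \<i> * of_real y) - (l' - \<i> * of_real y)) / ((l + \<i> * of_real y) * (l' - \<i> * of_real y))"
      unfolding Fp Fn by (rule frac(2)[OF nz])
    also have "(l + \<i> * of_real y) - (l' - \<i> * of_real y) = 2 * \<i> * of_real (y - x)" by (simp add: l_def l'_def algebra_simps)
    finally show ?thesis unfolding prod by (simp add: qkern_def)
  qed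
  ultimately have "ip (\<lambda>y. of_real (c0 * 2) * of_real (pkern e (y - x))) (HT f)
      = ip (\<lambda>y. of_real (c0 * 2) * (\<i> * of_real (qkern e (y - x)))) f" by simp
  then have "cnj (of_real (c0 * 2)) * ip (\<lambda>y. of_real (pkern e (y - x))) (HT f)
      = cnj (of_real (c0 * 2)) * (cnj \<i> * ip (\<lambda>y. of_real (qkern e (y - x))) f)"
    unfolding ip_scale_left[of "of_real (c0 * 2)" "\<lambda>y. of_real (pkern e (y - x))"]
      ip_scale_left[of "of_real (c0 * 2)" "\<lambda>y. \<i> * of_real (qkern e (y - x))"]
      ip_scale_left[of \<i> "\<lambda>y. of_real (qkern e (y - x))"] .
  moreover have "cnj (of_real (c0 * 2)) \<noteq> 0" using c0_pos by simp
  ultimately have "ip (\<lambda>y. of_real (pkern e (y - x))) (HT f) = cnj \<i> * ip (\<lambda>y. of_real (qkern e (y - x))) f"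
    by (simp only: mult_cancel_left) blast
  then show ?thesis by (simp add: ip_def divide_simps mult.commute[of _ \<i>])
qed

lemma pkern_average_tendsto:
  assumes g: "L2f g" and lim: "((\<lambda>e. LINT y|lborel. pkern e (y - x) * cmod (g y - g x)) \<longlongrightarrow> 0) (at_right 0)"
  shows "((\<lambda>e. 1 / of_real pi * (LINT y|lborel. of_real (pkern e (y - x)) * g y)) \<longlongrightarrow> g x) (at_right 0)"
proof (rule Lim_transform2[OF tendsto_const], rule Lim_null_comparison)
  show "((\<lambda>e. 1 / pi * (LINT y|lborel. pkern e (y - x) * cmod (g y - g x))) \<longlongrightarrow> 0) (at_right 0)"
    using tendsto_mult_right_zero[OF lim] .
  have "eventually (\<lambda>e. e > (0::real)) (at_right 0)"
    by (simp add: eventually_at_right_less)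
  then show "eventually (\<lambda>e. norm (g x - 1 / of_real pi * (LINT y|lborel. of_real (pkern e (y - x)) * g y))
      \<le> 1 / pi * (LINT y|lborel. pkern e (y - x) * cmod (g y - g x))) (at_right 0)"
  proof eventually_elim
    fix e :: real assume e: "e > 0"
    note i1 = integrable_pkern_diff[OF e g, of x "g x"]
    have i2: "integrable lborel (\<lambda>y. of_real (pkern e (y - x)) * g x)"
      using integrable_of_real[OF integrable_pkern[OF e, of x]] by (intro integrable_mult_left) auto
    have "(LINT y|lborel. of_real (pkern e (y - x)) * g y)
        = (LINT y|lborel. of_real (pkern e (y - x)) * (g y - g x) + of_real (pkern e (y - x)) * g x)"
      by (simp add: algebra_simps)
    also have "\<dots> = (LINT y|lborel. of_real (pkern e (y - x)) * (g y - g x)) + of_real pi * g x"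
      using i1 i2 integral_pkern[OF e, of x] by (subst Bochner_Integration.integral_add) auto
    finally have "norm (g x - 1 / of_real pi * (LINT y|lborel. of_real (pkern e (y - x)) * g y))
        = 1 / pi * norm (LINT y|lborel. of_real (pkern e (y - x)) * (g y - g x))"
      by (simp add: distrib_left norm_divide)
    also have "\<dots> \<le> 1 / pi * (LINT y|lborel. pkern e (y - x) * cmod (g y - g x))"
    proof (intro mult_left_mono)
      show "norm (LINT y|lborel. of_real (pkern e (y - x)) * (g y - g x)) \<le> (LINT y|lborel. pkern e (y - x) * cmod (g y - g x))"
        by (intro Bochner_Integration.integral_norm_bound_integral i1 integrable_pkern_diff_norm e g)
          (simp add: norm_mult pkern_nonneg e)
    qed simp
    finally show "norm (g x - 1 / of_real pi * (LINT y|lborel. of_real (pkern e (y - x)) * g y))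
      \<le> 1 / pi * (LINT y|lborel. pkern e (y - x) * cmod (g y - g x))" .
  qed
qed

section \<open>Truncated kernels and principal values\<close>

definition trkern :: "real \<Rightarrow> real \<Rightarrow> real" where
  "trkern e s = (if e < \<bar>s\<bar> then 1 / s else 0)"

lemma trkern_measurable [measurable]: "trkern e \<in> borel_measurable borel"
  unfolding trkern_def by measurable

text \<open>For |s| > e the difference is e^2 / (s (s^2 + e^2)), and one factor e is at most |s|;
  for |s| <= e only \<open>qkern\<close> is left, whose numerator is at most e in modulus.\<close>

lemma trkern_qkern_le:
  assumes e: "e > 0"
  shows "\<bar>trkern e s - qkern e s\<bar> \<le> pkern e s"
proof -
  have p: "s\<^sup>2 + e\<^sup>2 > 0" using e by (intro add_nonneg_pos) auto
  show ?thesis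
  proof (cases "e < \<bar>s\<bar>")
    case True
    then have s: "s \<noteq> 0" using e by auto
    have "trkern e s - qkern e s = e\<^sup>2 / (s * (s\<^sup>2 + e\<^sup>2))"
      using True s p by (simp add: trkern_def qkern_def divide_simps power2_eq_square)
    then have "\<bar>trkern e s - qkern e s\<bar> = e * (e / (\<bar>s\<bar> * (s\<^sup>2 + e\<^sup>2)))"
      using e p by (simp add: abs_mult power2_eq_square)
    also have "\<dots> \<le> \<bar>s\<bar> * (e / (\<bar>s\<bar> * (s\<^sup>2 + e\<^sup>2)))"
      using True e p by (intro mult_right_mono) auto
    also have "\<dots> = pkern e s" using s by (simp add: pkern_def)
    finally show ?thesis .
  next
    case False
    then show ?thesis using p e by (simp add: trkern_def qkern_def pkern_def divide_right_mono)
  qed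
qed

text \<open>The difference of the kernels is odd and integrable, so its integral is 0 and g x may be
  subtracted from g; the Poisson kernel then dominates.\<close>

lemma truncated_minus_conjugate_tendsto:
  assumes g: "L2f g" and lim: "((\<lambda>e. LINT y|lborel. pkern e (y - x) * cmod (g y - g x)) \<longlongrightarrow> 0) (at_right 0)"
  shows "((\<lambda>e. (LINT y|lborel. of_real (trkern e (y - x)) * g y) - (LINT y|lborel. of_real (qkern e (y - x)) * g y)) \<longlongrightarrow> 0) (at_right 0)"
proof (rule Lim_null_comparison[OF _ lim])
  have "eventually (\<lambda>e. e > (0::real)) (at_right 0)"
    by (simp add: eventually_at_right_less)
  then show "eventually (\<lambda>e. norm ((LINT y|lborel. of_real (trkern e (y - x)) * g y) - (LINT y|lborel. of_real (qkern e (y - x)) * g y))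
      \<le> (LINT y|lborel. pkern e (y - x) * cmod (g y - g x))) (at_right 0)"
  proof eventually_elim
    fix e :: real assume e: "e > 0"
    note [measurable] = L2f_measurable[OF g]
    define D where "D s = trkern e s - qkern e s" for s
    have [measurable]: "D \<in> borel_measurable borel" unfolding D_def by measurable
    have D: "\<bar>D s\<bar> \<le> pkern e s" for s unfolding D_def by (rule trkern_qkern_le[OF e])
    have iD: "integrable lborel (\<lambda>y. D (y - x))"
      by (rule Bochner_Integration.integrable_bound[OF integrable_pkern[OF e, of x]])
        (auto intro!: always_eventually order_trans[OF D abs_ge_self])
    have "(LINT s|lborel. D s) = (LINT s|lborel. D (- s))"
      by (subst lborel_integral_real_affine[where c="-1" and t=0]) auto
    also have "(\<lambda>s. D (- s)) = (\<lambda>s. - D s)"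
      by (auto simp: D_def trkern_def qkern_def)
    finally have "(LINT s|lborel. D s) = 0" by simp
    moreover have "(LINT y|lborel. D (y - x)) = (LINT s|lborel. D s)"
      by (subst lborel_integral_real_affine[where c=1 and t=x]) auto
    ultimately have D0: "(LINT y|lborel. D (y - x)) = 0" by (rule trans[rotated])
    have i1: "integrable lborel (\<lambda>y. of_real (D (y - x)) * (g y - g x))"
      by (rule Bochner_Integration.integrable_bound[OF integrable_pkern_diff_norm[OF e g, of x "g x"]])
        (auto simp: norm_mult abs_mult intro!: always_eventually mult_right_mono order_trans[OF D abs_ge_self])
    have i2: "integrable lborel (\<lambda>y. of_real (D (y - x)) * g x)"
      using integrable_of_real[OF iD] by (intro integrable_mult_left) auto
    have i3: "integrable lborel (\<lambda>y. of_real (D (y - x)) * g y)"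
      using Bochner_Integration.integrable_add[OF i1 i2] by (simp add: algebra_simps)
    have i4: "integrable lborel (\<lambda>y. of_real (qkern e (y - x)) * g y)"
      by (intro L2f_integrable_mult L2f_qkern e g)
    have tr: "of_real (trkern e (y - x)) * g y = of_real (D (y - x)) * g y + of_real (qkern e (y - x)) * g y" for y
      by (simp add: D_def algebra_simps)
    have "(LINT y|lborel. of_real (trkern e (y - x)) * g y) - (LINT y|lborel. of_real (qkern e (y - x)) * g y)
        = (LINT y|lborel. of_real (D (y - x)) * g y)"
      unfolding tr using i3 i4 by simp
    also have "\<dots> = (LINT y|lborel. of_real (D (y - x)) * (g y - g x) + of_real (D (y - x)) * g x)"
      by (simp add: algebra_simps)
    also have "\<dots> = (LINT y|lborel. of_real (D (y - x)) * (g y - g x))"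
      using i1 i2 D0 by (subst Bochner_Integration.integral_add) auto
    also have "norm \<dots> \<le> (LINT y|lborel. pkern e (y - x) * cmod (g y - g x))"
      by (intro Bochner_Integration.integral_norm_bound_integral i1 integrable_pkern_diff_norm e g)
        (auto simp: norm_mult intro!: mult_right_mono D)
    finally show "norm ((LINT y|lborel. of_real (trkern e (y - x)) * g y) - (LINT y|lborel. of_real (qkern e (y - x)) * g y))
      \<le> (LINT y|lborel. pkern e (y - x) * cmod (g y - g x))" .
  qed
qed

theorem AE_principal_value:
  assumes f: "L2f f"
  shows "AE x in lborel. ((\<lambda>e. 1 / (\<i> * of_real pi) * (LINT y|lborel. of_real (trkern e (y - x)) * f y)) \<longlongrightarrow> HT f x) (at_right 0)"
  using AE_pkern_tendsto[OF f] AE_pkern_tendsto[OF L2f_HT[OF f]]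
proof eventually_elim
  case (elim x)
  let ?T = "\<lambda>e. LINT y|lborel. of_real (trkern e (y - x)) * f y" and ?Q = "\<lambda>e. LINT y|lborel. of_real (qkern e (y - x)) * f y"
  have "((\<lambda>e. 1 / of_real pi * (LINT y|lborel. of_real (pkern e (y - x)) * HT f y)) \<longlongrightarrow> HT f x) (at_right 0)"
    by (rule pkern_average_tendsto[OF L2f_HT[OF f] elim(2)])
  moreover have "eventually (\<lambda>e. 1 / of_real pi * (LINT y|lborel. of_real (pkern e (y - x)) * HT f y) = 1 / (\<i> * of_real pi) * ?Q e) (at_right 0)"
    using eventually_at_right_less by (rule eventually_mono) (rule pkern_HT[OF f])
  ultimately have Q: "((\<lambda>e. 1 / (\<i> * of_real pi) * ?Q e) \<longlongrightarrow> HT f x) (at_right 0)"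
    by (rule Lim_transform_eventually)
  have "((\<lambda>e. 1 / (\<i> * of_real pi) * (?T e - ?Q e)) \<longlongrightarrow> 0) (at_right 0)"
    by (rule tendsto_mult_right_zero[OF truncated_minus_conjugate_tendsto[OF f elim(1)]])
  from tendsto_add[OF Q this] show ?case
    by (simp add: right_diff_distrib)
qed

text \<open>\<open>hilbert_transf\<close> collects all measurable functions that are the limit
  almost everywhere. Since the limit exists almost everywhere and is unique, this set is a single
  class.\<close>

lemma hilbert_transf_eq:
  assumes u: "u \<in> L2 (einterval a b)"
  shows "hilbert_transf a b u = ae_class (einterval a b) (HT (ext (einterval a b) u))"
proof -
  let ?S = "einterval a b"
  have S: "?S \<in> sets borel" by (rule borel_einterval)
  have e: "L2f (ext ?S u)" by (rule L2f_ext[OF S u])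
  let ?T = "\<lambda>x e. 1 / (\<i> * of_real pi) *
             (LINT y|leb {y \<in> ?S. e < \<bar>y - x\<bar>}. rep u y / of_real (y - x))"
  have T: "?T x e = 1 / (\<i> * of_real pi) * (LINT y|lborel. of_real (trkern e (y - x)) * ext ?S u y)" for x e
  proof -
    have "{y \<in> ?S. e < \<bar>y - x\<bar>} = ?S \<inter> {y. e < \<bar>y - x\<bar>}" by auto
    also have "\<dots> \<in> sets borel" using S by (intro sets.Int) measurable
    finally have m: "{y \<in> ?S. e < \<bar>y - x\<bar>} \<in> sets borel" .
    have "indicator {y \<in> ?S. e < \<bar>y - x\<bar>} y * (rep u y / of_real (y - x)) = of_real (trkern e (y - x)) * ext ?S u y" for y
      by (simp add: trkern_def ext_def split: split_indicator)
    then show ?thesis unfolding integral_leb[OF m] by (simp only:)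
  qed
  have lim: "AE x in leb ?S. (?T x \<longlongrightarrow> HT (ext ?S u) x) (at_right 0)"
    unfolding AE_leb[OF S] T using AE_principal_value[OF e] by eventually_elim simp
  have "(AE x in leb ?S. (?T x \<longlongrightarrow> h x) (at_right 0)) \<longleftrightarrow> (AE x in leb ?S. h x = HT (ext ?S u) x)" for h
  proof
    assume "AE x in leb ?S. (?T x \<longlongrightarrow> h x) (at_right 0)"
    with lim show "AE x in leb ?S. h x = HT (ext ?S u) x"
      by eventually_elim (rule tendsto_unique[OF trivial_limit_at_right_real])
  next
    assume "AE x in leb ?S. h x = HT (ext ?S u) x"
    with lim show "AE x in leb ?S. (?T x \<longlongrightarrow> h x) (at_right 0)"
      by eventually_elim simp
  qed
  then show ?thesis unfolding hilbert_transf_def ae_class_def by simp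
qed

section \<open>The Hilbert transformations of intervals\<close>

lemma einterval_0_inf: "einterval 0 \<infinity> = Rplus"
  by (auto simp: einterval_def)

lemma hilbert_transf_Rplus_eq:
  assumes u: "u \<in> L2 Rplus"
  shows "hilbert_transf 0 \<infinity> u = wiener_hopf (\<lambda>t. - of_real (sgn t)) u"
proof -
  have "hilbert_transf 0 \<infinity> u = ae_class Rplus (HT (ext Rplus u))"
    using hilbert_transf_eq[of u 0 \<infinity>] u by (simp only: einterval_0_inf)
  also have "\<dots> = ae_class Rplus (\<lambda>x. indicator Rplus x * HT (ext Rplus u) x)"
    by (rule ae_class_eqI) auto
  finally show ?thesis
    unfolding HT_def wiener_hopf_MF[OF u sgn_multiplier] .
qed

text \<open>A and -A give the same map but opposite operators \<open>FA\<close>;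
  \<open>S_pos\<close> selects the one whose weight 1/(a - c x) is the positive square root of the
  derivative of \<gamma>, as in \<open>Gamma_ab\<close>. By \<open>S_iff\<close>, S is the preimage
  of the half-line.\<close>

locale moebius_interval = sl2 a b c d for a b c d :: real +
  fixes S :: "real set" and \<gamma> :: "real \<Rightarrow> real"
  assumes openS: "open S"
    and S_pos: "\<And>x. x \<in> S \<Longrightarrow> a - c * x > 0"
    and S_gamma: "\<And>x. x \<in> S \<Longrightarrow> \<gamma> x = (d * x - b) / (a - c * x)"
    and S_iff: "\<And>x. a - c * x \<noteq> 0 \<Longrightarrow> x \<in> S \<longleftrightarrow> (d * x - b) / (a - c * x) > 0"
begin

lemma S_borel: "S \<in> sets borel"
  using openS by simp

lemma deriv_gamma:
  assumes x: "x \<in> S"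
  shows "sqrt \<bar>deriv \<gamma> x\<bar> = 1 / (a - c * x)"
proof -
  have "((\<lambda>x. (d * x - b) / (a - c * x)) has_real_derivative 1 / (a - c * x)\<^sup>2) (at x)"
    using S_pos[OF x] by (intro g_deriv) auto
  then have "(\<gamma> has_real_derivative 1 / (a - c * x)\<^sup>2) (at x)"
    by (rule has_field_derivative_transform_within_open[OF _ openS x]) (simp add: S_gamma)
  then have "deriv \<gamma> x = 1 / (a - c * x)\<^sup>2" by (rule DERIV_imp_deriv)
  then show ?thesis using S_pos[OF x] by (simp add: real_sqrt_divide)
qed

lemma L2on_FA:
  assumes f: "L2on Rplus f"
  shows "L2on S (FA a b c d f)"
  unfolding L2on_def
proof (intro conjI allI impI)
  show "L2f (FA a b c d f)" by (rule L2f_FA[OF L2on_L2f[OF f]])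
  fix x assume x: "x \<notin> S"
  show "FA a b c d f x = 0"
  proof (cases "a - c * x = 0")
    \<comment> \<open>At the pole \<open>FA\<close> vanishes by the convention 1/0 = 0.\<close>
    case True
    then show ?thesis unfolding FA_def by (simp only: True) simp
  next
    case False
    then have "(d * x - b) / (a - c * x) \<notin> Rplus" using x S_iff[OF False] by simp
    then have "f ((d * x - b) / (a - c * x)) = 0" using f unfolding L2on_def by blast
    then show ?thesis unfolding FA_def by simp
  qed
qed

lemma FA_surj:
  assumes g: "L2on S g"
  shows "\<exists>f. L2on Rplus f \<and> (AE x in lborel. FA a b c d f x = g x)"
proof (intro exI conjI)
  interpret i: sl2 d "- b" "- c" a by (rule inverse)
  let ?f = "FA d (- b) (- c) a g"
  show "AE x in lborel. FA a b c d ?f x = g x" by (rule FA_FA_inverse)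
  show "L2on Rplus ?f"
    unfolding L2on_def
  proof (intro conjI allI impI)
    show "L2f ?f" by (rule i.L2f_FA[OF L2on_L2f[OF g]])
    fix y assume y: "y \<notin> Rplus"
    show "?f y = 0"
    proof (cases "d + c * y = 0")
      case True
      have "d - - c * y = 0" using True by simp
      then show ?thesis unfolding FA_def by (simp only: \<open>d - - c * y = 0\<close>) simp
    next
      case False
      define x where "x = (a * y - - b) / (d - - c * y)"
      have nz: "a - c * x \<noteq> 0"
        using denom'[OF False] False by (simp add: x_def)
      have "(d * x - b) / (a - c * x) = y"
        using i.moebius_inverse[of y] False by (simp add: x_def)
      then have "x \<notin> S" using S_iff[OF nz] y by simp
      then have "g x = 0" using g by (simp add: L2on_def)
      then show ?thesis unfolding FA_def x_def[symmetric] by simp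
    qed
  qed
qed

text \<open>\<open>G\<close> is \<open>FA\<close> on functions supported in the half-line; it moves
  supports into S and commutes with \<open>HT\<close> by \<open>HT_FA\<close>. Restricting to S
  after \<open>FA\<close> amounts to restricting to the half-line before it.\<close>

theorem conjugate_via_interval:
  assumes G: "\<And>u. G u = ae_class S (\<lambda>t. of_real (sqrt \<bar>deriv \<gamma> t\<bar>) * rep u (\<gamma> t))"
    and X: "\<And>u. u \<in> L2 Rplus \<Longrightarrow> X u = ae_class Rplus (HT (ext Rplus u))"
    and Y: "\<And>u. u \<in> L2 S \<Longrightarrow> Y u = ae_class S (HT (ext S u))"
  shows "conjugate_via Rplus S G X Y"
proof -
  have R: "Rplus \<in> sets (borel :: real measure)" by simp
  note S = S_borel
  have G_eq: "G u = ae_class S (FA a b c d (ext Rplus u))" for u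
    unfolding G
  proof (intro ae_class_eqI S always_eventually allI impI)
    fix t assume t: "t \<in> S"
    have "(d * t - b) / (a - c * t) > 0" using S_iff[of t] S_pos[OF t] t by simp
    then show "of_real (sqrt \<bar>deriv \<gamma> t\<bar>) * rep u (\<gamma> t) = FA a b c d (ext Rplus u) t"
      unfolding FA_def deriv_gamma[OF t] S_gamma[OF t] ext_def by simp
  qed
  have iso: "hilbert_iso Rplus S G"
  proof (rule hilbert_isoI[where v="FA a b c d"])
    show "ip (FA a b c d f) (FA a b c d g) = ip f g" if "L2on Rplus f" "L2on Rplus g" for f g
      using that by (intro ip_FA L2on_L2f)
    show "AE x in lborel. FA a b c d f x = FA a b c d g x" if "AE x in lborel. f x = g x" for f g
      using that by (rule FA_cong)
  qed (auto simp: G_eq FA_add FA_scale L2on_FA FA_surj S)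
  show ?thesis
    unfolding conjugate_via_iff
  proof (intro conjI iso ballI image_subsetI)
    fix u assume u: "u \<in> L2 Rplus"
    let ?e = "ext Rplus u"
    have e1: "L2on Rplus ?e" by (rule ext_L2(1)[OF R u])
    note e = L2on_L2f[OF e1]
    have Gu: "G u \<in> L2 S" by (rule hilbert_iso_mem[OF iso u])
    show "X u \<in> L2 Rplus" unfolding X[OF u] by (intro ae_class_L2 R L2f_HT e)
    have "AE x in lborel. ext S (G u) x = FA a b c d ?e x"
      unfolding G_eq by (rule ext_ae_class_L2on[OF S L2on_FA[OF e1]])
    from HT_cong[OF L2f_ext[OF S Gu] L2f_FA[OF e] this] HT_FA[OF e]
    have 1: "AE x in lborel. HT (ext S (G u)) x = FA a b c d (HT ?e) x" by eventually_elim simp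
    have "AE x in lborel. ext Rplus (ae_class Rplus (HT ?e)) x = indicator Rplus x * HT ?e x"
      by (rule ext_ae_class[OF R L2f_HT[OF e]])
    from FA_cong[OF this]
    have 2: "AE x in lborel. FA a b c d (ext Rplus (X u)) x = FA a b c d (\<lambda>x. indicator Rplus x * HT ?e x) x"
      unfolding X[OF u] .
    have 3: "FA a b c d (\<lambda>x. indicator Rplus x * HT ?e x) x = FA a b c d (HT ?e) x" if x: "x \<in> S" for x
      using S_iff[of x] S_pos[OF x] x by (simp add: FA_def)
    show "Y (G u) = G (X u)"
      unfolding Y[OF Gu] G_eq[of "X u"]
    proof (rule ae_class_eqI[OF S])
      show "AE x in lborel. x \<in> S \<longrightarrow> HT (ext S (G u)) x = FA a b c d (ext Rplus (X u)) x"
        using 1 2 by eventually_elim (simp add: 3)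
    qed
  qed
qed

end

lemma conjugate_via_Gamma_ab:
  assumes ab: "a < b" "\<not> (a = -\<infinity> \<and> b = \<infinity>)"
  shows "conjugate_via Rplus (einterval a b) (Gamma_ab a b) (hilbert_transf 0 \<infinity>) (hilbert_transf a b)"
proof -
  have X: "hilbert_transf 0 \<infinity> u = ae_class Rplus (HT (ext Rplus u))" if "u \<in> L2 Rplus" for u
    using hilbert_transf_eq[of u 0 \<infinity>] that by (simp only: einterval_0_inf)
  have *: "conjugate_via Rplus (einterval a b) (Gamma_ab a b) (hilbert_transf 0 \<infinity>) (hilbert_transf a b)"
    if "moebius_interval p q r w (einterval a b) (gamma_fun a b)" for p q r w
    using moebius_interval.conjugate_via_interval[OF that Gamma_ab_def X hilbert_transf_eq] .
  show ?thesis
  proof (cases a)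
    case (real a')
    note a = this
    show ?thesis
    proof (cases b)
      case (real b')
      have ab': "a' < b'" using ab(1) a real by simp
      \<comment> \<open>The matrix of (x - a')/(b' - x) has determinant b' - a'; division by
        \<open>k\<close> makes it 1.\<close>
      define k where "k = sqrt (b' - a')"
      have k: "k > 0" "k * k = b' - a'" using ab' by (auto simp: k_def)
      have den: "b' / k - 1 / k * x = (b' - x) / k" for x by (simp add: diff_divide_distrib)
      have num: "1 / k * x - a' / k = (x - a') / k" for x by (simp add: diff_divide_distrib)
      have quot: "(1 / k * x - a' / k) / (b' / k - 1 / k * x) = (x - a') / (b' - x)" for x
        unfolding den num using k(1) by simp
      have "moebius_interval (b' / k) (a' / k) (1 / k) (1 / k) (einterval a b) (gamma_fun a b)"
      proof
        show "b' / k * (1 / k) - a' / k * (1 / k) = 1"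
          using k ab' by (simp add: field_simps)
        show "open (einterval a b)" by simp
        fix x
        show "x \<in> einterval a b \<Longrightarrow> 0 < b' / k - 1 / k * x"
          unfolding den using k a real by (simp add: einterval_def)
        show "gamma_fun a b x = (1 / k * x - a' / k) / (b' / k - 1 / k * x)"
          unfolding quot using a real by (simp add: gamma_fun_def)
        assume "b' / k - 1 / k * x \<noteq> 0"
        show "x \<in> einterval a b \<longleftrightarrow> 0 < (1 / k * x - a' / k) / (b' / k - 1 / k * x)"
          unfolding quot using a real ab' by (auto simp: einterval_def zero_less_divide_iff)
      qed
      then show ?thesis by (rule *)
    next
      case PInf
      have "moebius_interval 1 a' 0 1 (einterval a b) (gamma_fun a b)"
      proof
        show "open (einterval a b)" by simp
      qed (auto simp: a PInf einterval_def gamma_fun_def)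
      then show ?thesis by (rule *)
    qed (use ab in simp)
  next
    case MInf
    then obtain b' where b: "b = ereal b'" using ab by (cases b) auto
    \<comment> \<open>A^-1 has to send x to 1/(b' - x), which determines d = 0 and b = -1 once c =
      1.\<close>
    have "moebius_interval b' (-1) 1 0 (einterval a b) (gamma_fun a b)"
    proof
      show "open (einterval a b)" by simp
    qed (auto simp: b MInf einterval_def gamma_fun_def zero_less_divide_iff)
    then show ?thesis by (rule *)
  qed (use ab in simp)
qed

section \<open>From \<open>twoK_minus_I\<close> to the Hilbert transformation of the
  half-line\<close>

lemma det_B_mat: "det B_mat = 1"
  by (simp add: B_mat_def det_2 field_simps)

lemma moebius_B_mat: "moebius (matrix_inv B_mat) x = (x + 1) / (1 - x)"
proof -
  have n: "B_mat$2$2 * x - B_mat$1$2 = 1 / sqrt 2 * (x + 1)"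
    by (simp add: B_mat_def add_divide_distrib)
  have d: "B_mat$1$1 - B_mat$2$1 * x = 1 / sqrt 2 * (1 - x)"
    by (simp add: B_mat_def diff_divide_distrib)
  show ?thesis
    unfolding moebius_matrix_inv[OF det_B_mat] n d by simp
qed

lemma conjugate_via_F_op'_B:
  "conjugate_via Rplus Rplus (F_op' B_mat) twoK_minus_I (hilbert_transf 0 \<infinity>)"
proof -
  have k: "(\<lambda>x::real. 2 * indicator {-1..1} x - 1 :: complex) \<in> borel_measurable borel"
    "cmod (2 * indicator {-1..1} x - 1) \<le> 1" for x :: real
    by measurable (auto split: split_indicator)
  have "conjugate_via Rplus Rplus (F_op' B_mat) (wiener_hopf (\<lambda>x. 2 * indicator {-1..1} x - 1))
     (wiener_hopf (\<lambda>t. - of_real (sgn t)))"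
  proof (rule conjugate_via_F_op'[OF det_B_mat k sgn_multiplier])
    \<comment> \<open>(x + 1)/(1 - x) lies in [-1,1] exactly for negative x, apart from 0, where sgn
      vanishes, and the pole 1.\<close>
    have "AE x in lborel. x \<noteq> (0::real)" "AE x in lborel. x \<noteq> (1::real)"
      by (rule AE_lborel_singleton)+
    then show "AE x in lborel. - complex_of_real (sgn x) = 2 * indicator {-1..1} (moebius (matrix_inv B_mat) x) - 1"
    proof eventually_elim
      case (elim x)
      have "(x + 1) / (1 - x) \<in> {-1..1} \<longleftrightarrow> x < 0"
        using elim by (auto simp: divide_le_eq le_divide_eq)
      then show ?case
        unfolding moebius_B_mat using elim by (auto simp: sgn_if indicator_def)
    qed
  qed
  then show ?thesis
    by (rule conjugate_via_cong) (auto simp: twoK_minus_I_eq hilbert_transf_Rplus_eq)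
qed

theorem conjugate_via_Lambda:
  assumes "a < b" "\<not> (a = -\<infinity> \<and> b = \<infinity>)"
  shows "conjugate_via Rplus (einterval a b) (Lambda a b) twoK_minus_I (hilbert_transf a b)"
  unfolding Lambda_def by (rule conjugate_via_comp[OF conjugate_via_F_op'_B conjugate_via_Gamma_ab[OF assms]])

section \<open>The reflection of the unit interval\<close>

lemma einterval_0_1: "einterval 0 1 = {0<..<1}"
  by (auto simp: einterval_def)

text \<open>The reflection occurs on the line, where \<open>HT\<close> acts on extensions by zero,
  and on (0,1), where it is an isomorphism of classes.\<close>

interpretation reflection: change_of_variable UNIV UNIV "\<lambda>x. 1 - x" "\<lambda>x. -1" "\<lambda>x. 1 - x" "\<lambda>x. 1"
  by unfold_locales (auto intro!: derivative_eq_intros)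

interpretation reflection01: change_of_variable "{0<..<1}" "{0<..<1}" "\<lambda>x. 1 - x" "\<lambda>x. -1" "\<lambda>x. 1 - x" "\<lambda>x. 1"
  by unfold_locales (auto intro!: derivative_eq_intros)

text \<open>Substituting 1 - y in the truncated integrals reverses the sign of the odd kernel, and
  the principal values inherit it.\<close>

lemma HT_reflect:
  assumes f: "L2f f"
  shows "AE x in lborel. HT (\<lambda>x. f (1 - x)) x = - HT f (1 - x)"
proof -
  have r: "L2f (\<lambda>x. f (1 - x))"
    using L2on_L2f[OF reflection.L2on_WC[OF f]] by (simp add: reflection.WC_def[abs_def])
  have "AE x in lborel. ((\<lambda>e. 1 / (\<i> * of_real pi) * (LINT y|lborel. of_real (trkern e (y - (1 - x))) * f y)) \<longlongrightarrow> HT f (1 - x)) (at_right 0)"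
    using reflection.AE_change[of "\<lambda>x. ((\<lambda>e. 1 / (\<i> * of_real pi) * (LINT y|lborel. of_real (trkern e (y - x)) * f y)) \<longlongrightarrow> HT f x) (at_right 0)"]
      AE_principal_value[OF f] by simp
  then show ?thesis
    using AE_principal_value[OF r]
  proof eventually_elim
    case (elim x)
    have odd: "trkern e (- s) = - trkern e s" for e s by (simp add: trkern_def)
    have "(LINT y|lborel. of_real (trkern e (y - x)) * f (1 - y)) = - (LINT y|lborel. of_real (trkern e (y - (1 - x))) * f y)" for e
    proof -
      have "(LINT y|lborel. of_real (trkern e (y - x)) * f (1 - y)) = (LINT y|lborel. of_real (trkern e (- (y - (1 - x)))) * f y)"
        by (subst lborel_integral_real_affine[where c="-1" and t=1]) (auto simp: algebra_simps)
      then show ?thesis unfolding odd by simp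
    qed
    then have "((\<lambda>e. - (1 / (\<i> * of_real pi) * (LINT y|lborel. of_real (trkern e (y - (1 - x))) * f y))) \<longlongrightarrow> HT (\<lambda>x. f (1 - x)) x) (at_right 0)"
      using elim(2) by simp
    moreover have "((\<lambda>e. - (1 / (\<i> * of_real pi) * (LINT y|lborel. of_real (trkern e (y - (1 - x))) * f y))) \<longlongrightarrow> - HT f (1 - x)) (at_right 0)"
      by (rule tendsto_minus[OF elim(1)])
    ultimately show ?case by (rule tendsto_unique[OF trivial_limit_at_right_real])
  qed
qed

lemma conjugate_via_reflect01:
  "conjugate_via {0<..<1} {0<..<1} reflect01 (hilbert_transf 0 1) (\<lambda>u. L2_scale {0<..<1} (-1) (hilbert_transf 0 1 u))"
proof -
  let ?S = "{0<..<1::real}"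
  have S: "?S \<in> sets borel" by simp
  have WC: "reflect01 u = ae_class ?S (reflection01.WC (ext ?S u))" for u
    unfolding reflect01_def by (intro ae_class_eqI S) (auto simp: reflection01.WC_def ext_def)
  have iso: "hilbert_iso ?S ?S reflect01"
    by (rule reflection01.hilbert_iso_WC[OF WC])
  note H = hilbert_transf_eq[of _ 0 1, unfolded einterval_0_1]
  show ?thesis
    unfolding conjugate_via_iff
  proof (intro conjI iso ballI image_subsetI)
    fix u assume u: "u \<in> L2 ?S"
    let ?e = "ext ?S u"
    have e1: "L2on ?S ?e" by (rule ext_L2(1)[OF S u])
    note e = L2on_L2f[OF e1]
    show "hilbert_transf 0 1 u \<in> L2 ?S" unfolding H[OF u] by (intro ae_class_L2 S L2f_HT e)
    have Ru: "reflect01 u \<in> L2 ?S" by (rule hilbert_iso_mem[OF iso u])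
    have r: "L2f (\<lambda>x. ?e (1 - x))"
      using L2on_L2f[OF reflection.L2on_WC[OF e]] by (simp add: reflection.WC_def[abs_def])
    have "L2on ?S (\<lambda>x. ?e (1 - x))" using r by (auto simp: L2on_def ext_def)
    from ext_ae_class_L2on[OF S this]
    have "AE x in lborel. ext ?S (reflect01 u) x = ?e (1 - x)"
      unfolding WC reflection01.WC_def
      by (subst ae_class_eqI[OF S, where g="\<lambda>x. ?e (1 - x)"]) auto
    from HT_cong[OF L2f_ext[OF S Ru] r this] HT_reflect[OF e]
    have 1: "AE x in lborel. HT (ext ?S (reflect01 u)) x = - HT ?e (1 - x)" by eventually_elim simp
    have 2: "AE x in lborel. ext ?S (hilbert_transf 0 1 (reflect01 u)) x = indicator ?S x * HT (ext ?S (reflect01 u)) x"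
      unfolding H[OF Ru] by (intro ext_ae_class S L2f_HT L2f_ext Ru)
    have "AE x in lborel. ext ?S (hilbert_transf 0 1 u) x = indicator ?S x * HT ?e x"
      unfolding H[OF u] by (intro ext_ae_class S L2f_HT e)
    then have "AE x in lborel. x \<in> UNIV \<longrightarrow> ext ?S (hilbert_transf 0 1 u) (1 - x) = indicator ?S (1 - x) * HT ?e (1 - x)"
      by (intro reflection.AE_change) simp
    then have 3: "AE x in lborel. ext ?S (hilbert_transf 0 1 u) (1 - x) = indicator ?S x * HT ?e (1 - x)"
      by eventually_elim (auto split: split_indicator)
    show "L2_scale ?S (-1) (hilbert_transf 0 1 (reflect01 u)) = reflect01 (hilbert_transf 0 1 u)"
      unfolding L2_scale_ext[OF S] WC[of "hilbert_transf 0 1 u"]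
    proof (rule ae_class_eqI[OF S])
      show "AE x in lborel. x \<in> ?S \<longrightarrow> -1 * ext ?S (hilbert_transf 0 1 (reflect01 u)) x
          = reflection01.WC (ext ?S (hilbert_transf 0 1 u)) x"
        using 1 2 3 by eventually_elim (simp add: reflection01.WC_def)
    qed
  qed
qed

section \<open>The Fourier transform of the hyperbolic secant\<close>

interpretation exponential: change_of_variable UNIV Rplus exp exp ln "\<lambda>v. of_real (exp (v / 2))"
  by unfold_locales (auto intro!: derivative_eq_intros simp: exp_double[symmetric])

text \<open>The integrand of Euler's integral for \<open>Gamma z\<close> after the substitution t =
  exp v, with the Jacobian included.\<close>

definition gexp :: "complex \<Rightarrow> real \<Rightarrow> complex" where
  "gexp z v = exp (z * of_real v - of_real (exp v))"

lemma gexp_measurable [measurable]: "gexp z \<in> borel_measurable borel"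
  unfolding gexp_def by measurable

lemma integral_gexp:
  assumes z: "Re z > 0"
  shows "(LINT v|lborel. gexp z v) = Gamma z"
proof -
  define f where "f t = exp ((z - 1) * of_real (ln t)) * of_real (exp (- t))" for t :: real
  have [measurable]: "f \<in> borel_measurable borel" unfolding f_def by measurable
  have eq: "complex_of_real t powr (z - 1) / of_real (exp t) = f t" if "t \<in> Rplus" for t
    using that by (simp add: f_def powr_def Ln_of_real exp_minus divide_inverse mult.commute)
  have "f absolutely_integrable_on Rplus"
    using absolutely_integrable_Gamma_integral'[OF z] eq
    by (rule set_integrable_cong[THEN iffD1, rotated -1, OF _ refl refl]) auto
  then have "integrable lborel (\<lambda>t. indicator Rplus t *\<^sub>R f t)"
    unfolding set_integrable_def by (subst (asm) integrable_completion) auto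
  then have si: "set_integrable lborel Rplus f" by (simp add: set_integrable_def)
  have "integral Rplus f = Gamma z"
    using has_integral_eq[OF _ Gamma_integral_complex'[OF z], of f] eq by (metis integral_unique)
  then have G: "(LINT t|lborel. indicator Rplus t * f t) = Gamma z"
    using set_borel_integral_eq_integral(2)[OF si]
    by (simp add: set_lebesgue_integral_def scaleR_conv_of_real of_real_indicator)
  have "(LINT v|lborel. of_real (indicator UNIV v * \<bar>exp v\<bar>) * f (exp v)) = Gamma z"
    unfolding G[symmetric] by (rule exponential.integral_change) measurable
  moreover have "of_real (indicator UNIV v * \<bar>exp v\<bar>) * f (exp v) = gexp z v" for v :: real
    by (simp add: f_def gexp_def exp_of_real[symmetric] exp_add[symmetric] algebra_simps del: exp_of_real)
  ultimately show ?thesis by simp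
qed

text \<open>A non-integrable function would have integral 0 by convention, but \<open>Gamma\<close>
  has no zeros.\<close>

lemma integrable_gexp:
  assumes z: "Re z > 0"
  shows "integrable lborel (gexp z)"
proof (rule ccontr)
  assume "\<not> integrable lborel (gexp z)"
  then have "Gamma z = 0" using integral_gexp[OF z] by (simp add: not_integrable_integral_eq)
  then show False using z by (auto simp: Gamma_eq_zero_iff elim!: nonpos_Ints_cases)
qed

lemma integral_exp_gumbel:
  assumes l: "l > 0"
  shows "(LINT b|lborel. of_real (exp b * exp (- (exp b * l)))) = complex_of_real (1 / l)"
proof -
  have "(LINT b|lborel. of_real (indicator UNIV b * \<bar>exp b\<bar>) * of_real (exp (- (exp b * l)))) = (LINT y|lborel. indicator Rplus y * complex_of_real (exp (- (y * l))))"
    by (rule exponential.integral_change) measurable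
  also have "\<dots> = (LINT y|lborel. ek (of_real l) y)"
    by (intro Bochner_Integration.integral_cong) (auto simp: ek_def mult.commute simp flip: exp_of_real)
  also have "\<dots> = complex_of_real (1 / l)" using l by (subst integral_ek) auto
  finally show ?thesis by simp
qed

text \<open>The product Gamma (1 - z) Gamma (z) is written as a double integral. Shifting the second
  variable by the first leaves z only in the factor exp (z v), so the first integration is
  elementary and produces 1/(1 + exp v); the reflection formula evaluates the product.\<close>

theorem integral_logistic:
  assumes z: "0 < Re z" "Re z < 1"
  shows "(LINT v|lborel. exp (z * of_real v) / of_real (1 + exp v)) = of_real pi / sin (of_real pi * z)"
proof -
  have z': "Re (1 - z) > 0" using z by simp
  let ?K = "\<lambda>b v. gexp (1 - z) b * gexp z (b + v)"
  have sh: "(LINT v|lborel. f (b + v)) = (LINT v|lborel. f v)" for f :: "real \<Rightarrow> complex" and b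
    by (subst lborel_integral_real_affine[where c=1 and t=b and f=f]) auto
  have shi: "integrable lborel (\<lambda>v. f (b + v))" if "integrable lborel f" for f :: "real \<Rightarrow> complex" and b
    using lborel_integrable_real_affine[OF that, of 1 b] by simp
  have int: "integrable (lborel \<Otimes>\<^sub>M lborel) (case_prod ?K)"
  proof (rule lborel_pair.Fubini_integrable)
    show "case_prod ?K \<in> borel_measurable (lborel \<Otimes>\<^sub>M lborel)" by measurable
    have "(LINT v|lborel. cmod (?K b v)) = cmod (gexp (1 - z) b) * (LINT v|lborel. cmod (gexp z v))" for b
    proof -
      have "(LINT v|lborel. cmod (gexp z (b + v))) = (LINT v|lborel. cmod (gexp z v))"
        by (subst lborel_integral_real_affine[where c=1 and t=b and f="\<lambda>v. cmod (gexp z v)"]) auto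
      then show ?thesis by (simp add: norm_mult)
    qed
    then show "integrable lborel (\<lambda>b. LINT v|lborel. norm (case_prod ?K (b, v)))"
      using integrable_norm[OF integrable_gexp[OF z']] by simp
    show "AE b in lborel. integrable lborel (\<lambda>v. case_prod ?K (b, v))"
      using shi[OF integrable_gexp[OF z(1)]] by simp
  qed
  have "Gamma (1 - z) * Gamma z = (LINT b|lborel. LINT v|lborel. ?K b v)"
    by (simp add: sh integral_gexp[OF z(1)] integral_gexp[OF z'])
  also have "\<dots> = (LINT v|lborel. LINT b|lborel. ?K b v)"
    by (rule lborel_pair.Fubini_integral[OF int, symmetric])
  also have "\<dots> = (LINT v|lborel. exp (z * of_real v) / of_real (1 + exp v))"
  proof (intro Bochner_Integration.integral_cong refl)
    fix v :: real
    have "?K b v = exp (z * of_real v) * of_real (exp b * exp (- (exp b * (1 + exp v))))" for b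
    proof -
      have "?K b v = exp (((1 - z) * of_real b - of_real (exp b)) + (z * of_real (b + v) - of_real (exp (b + v))))"
        by (simp only: gexp_def exp_add)
      also have "((1 - z) * of_real b - of_real (exp b)) + (z * of_real (b + v) - of_real (exp (b + v)))
          = z * of_real v + of_real (b + - (exp b * (1 + exp v)))"
        by (simp add: exp_add algebra_simps)
      finally show ?thesis by (simp only: exp_add exp_of_real)
    qed
    then have "(LINT b|lborel. ?K b v) = exp (z * of_real v) * (LINT b|lborel. of_real (exp b * exp (- (exp b * (1 + exp v)))))"
      by (simp only: Bochner_Integration.integral_mult_right_zero)
    also have "(LINT b|lborel. of_real (exp b * exp (- (exp b * (1 + exp v))))) = complex_of_real (1 / (1 + exp v))"
      by (rule integral_exp_gumbel) (simp add: add_pos_pos)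
    finally show "(LINT b|lborel. ?K b v) = exp (z * of_real v) / of_real (1 + exp v)" by simp
  qed
  finally show ?thesis using Gamma_reflection_complex[of z] by (simp add: mult.commute)
qed

text \<open>Half the hyperbolic secant of pi u / 2, scaled so that its Fourier transform is a
  multiple of 1/cosh.\<close>

definition qs :: "real \<Rightarrow> real" where
  "qs u = 1 / (exp (pi * u / 2) + exp (- (pi * u / 2)))"

lemma qs_measurable [measurable]: "qs \<in> borel_measurable borel"
  unfolding qs_def by measurable

lemma qs_pos: "qs u > 0"
  by (simp add: qs_def add_pos_pos)

lemma qs_le: "qs u \<le> exp (- (pi * \<bar>u\<bar> / 2))"
proof -
  have "exp (pi * \<bar>u\<bar> / 2) \<le> exp (pi * u / 2) + exp (- (pi * u / 2))"
    by (cases "u \<ge> 0") auto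
  then have "qs u \<le> 1 / exp (pi * \<bar>u\<bar> / 2)"
    unfolding qs_def by (intro divide_left_mono mult_pos_pos add_pos_pos) auto
  then show ?thesis by (simp add: exp_minus inverse_eq_divide)
qed

text \<open>A common majorant for \<open>qs\<close> and for u times \<open>qs\<close>, hence also
  for the difference quotients in \<open>FT0_u_qs\<close>; the rate 1/2 is possible because pi >
  3.\<close>

definition lap :: "real \<Rightarrow> real" where
  "lap u = exp (- (\<bar>u\<bar> / 2))"

lemma qs_le_lap: "qs u \<le> lap u" and u_qs_le_lap: "\<bar>u\<bar> * qs u \<le> lap u"
proof -
  have p: "3 * \<bar>u\<bar> \<le> pi * \<bar>u\<bar>" using pi_gt3 by (intro mult_right_mono) auto
  have "exp (- (pi * \<bar>u\<bar> / 2)) \<le> lap u" using p by (simp add: lap_def)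
  with qs_le show "qs u \<le> lap u" by (rule order_trans)
  have "\<bar>u\<bar> \<le> exp \<bar>u\<bar>" using exp_ge_add_one_self[of "\<bar>u\<bar>"] by linarith
  then have "\<bar>u\<bar> * qs u \<le> exp \<bar>u\<bar> * exp (- (pi * \<bar>u\<bar> / 2))"
    using qs_le qs_pos[of u] by (intro mult_mono) auto
  also have "\<dots> = exp (\<bar>u\<bar> + - (pi * \<bar>u\<bar> / 2))" by (simp only: mult_exp_exp)
  also have "\<dots> \<le> lap u" using p by (simp add: lap_def)
  finally show "\<bar>u\<bar> * qs u \<le> lap u" .
qed

lemma L12_lap: "L12 (\<lambda>u. of_real (lap u))"
proof -
  have r: "L12 (\<lambda>u. ek (1/2) (- u))"
    using L12_ek[of "1/2"] lborel_integrable_real_affine[of "ek (1/2)" "-1" 0]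
    by (auto simp: L12_def intro: L2f_reflect)
  have s: "L12 (\<lambda>u. ek (1/2) u + ek (1/2) (- u))"
    by (intro L12_add r L12_ek) simp
  have [measurable]: "lap \<in> borel_measurable borel" unfolding lap_def by measurable
  have "AE u::real in lborel. u \<noteq> 0" by (rule AE_lborel_singleton)
  then have ae: "AE u in lborel. complex_of_real (lap u) = ek (1/2) u + ek (1/2) (- u)"
    by eventually_elim (auto simp: ek_def lap_def abs_if exp_of_real[symmetric] split: split_indicator)
  have "integrable lborel (\<lambda>u. complex_of_real (lap u))"
    by (rule integrable_cong_AE[THEN iffD2, OF _ _ ae]) (use s in \<open>auto simp: L12_def\<close>)
  moreover have "L2f (\<lambda>u. complex_of_real (lap u))"
    by (rule L2f_cong_AE[OF _ _ ae]) (use s in \<open>simp_all add: L12_def\<close>)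
  ultimately show ?thesis by (simp add: L12_def)
qed

lemma L12_le_lap:
  assumes [measurable]: "f \<in> borel_measurable borel" and le: "\<And>u. cmod (f u) \<le> lap u"
  shows "L12 f"
proof -
  have l: "integrable lborel (\<lambda>u. complex_of_real (lap u))" "L2f (\<lambda>u. complex_of_real (lap u))"
    using L12_lap by (auto simp: L12_def)
  have "integrable lborel f"
    by (rule Bochner_Integration.integrable_bound[OF l(1)]) (auto intro!: always_eventually order_trans[OF le])
  moreover have "L2f f"
    by (rule L2f_bound[OF _ L2f_integrable[OF l(2)]]) (auto intro!: always_eventually power_mono order_trans[OF le])
  ultimately show ?thesis by (simp add: L12_def)
qed

lemma L12_qs: "L12 (\<lambda>u. of_real (qs u))"
  using qs_le_lap qs_pos by (intro L12_le_lap) (auto simp: abs_of_pos)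

lemma L12_u_qs: "L12 (\<lambda>u. - \<i> * of_real u * of_real (qs u))"
  using u_qs_le_lap qs_pos by (intro L12_le_lap) (auto simp: norm_mult abs_of_pos)

lemma FT0_qs: "FT0 (\<lambda>u. of_real (qs u)) (- t) = of_real (c0 / cosh t)"
proof -
  \<comment> \<open>The substitution u = -v/pi brings the integral to logistic form with Re z = 1/2,
    where sin (pi z) = cos (i t) = cosh t.\<close>
  define z where "z = 1 / 2 - \<i> * of_real (t / pi)"
  have "(LINT u|lborel. exp (\<i> * of_real (t * u)) * of_real (qs u))
      = of_real (1 / pi) * (LINT v|lborel. exp (\<i> * of_real (t * (- v / pi))) * of_real (qs (- v / pi)))"
  proof -
    have a: "0 + (- 1 / pi) * v = - v / pi" for v by simp
    have nz: "- 1 / pi \<noteq> 0" and ab: "\<bar>- 1 / pi\<bar> = 1 / pi" by simp_all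
    show ?thesis
      using lborel_integral_real_affine[OF nz, of "\<lambda>u. exp (\<i> * of_real (t * u)) * complex_of_real (qs u)" 0]
      by (simp only: a ab scaleR_conv_of_real)
  qed
  also have "(\<lambda>v. exp (\<i> * of_real (t * (- v / pi))) * complex_of_real (qs (- v / pi))) = (\<lambda>v. exp (z * of_real v) / of_real (1 + exp v))"
  proof
    fix v :: real
    have "qs (- v / pi) = exp (v / 2) / (1 + exp v)"
    proof -
      have "1 + exp v = exp (v / 2) * (exp (- (v / 2)) + exp (v / 2))"
        by (simp add: distrib_left exp_add[symmetric])
      then show ?thesis by (simp add: qs_def add.commute)
    qed
    moreover have "exp (z * of_real v) = exp (\<i> * of_real (t * (- v / pi))) * of_real (exp (v / 2))"
      by (simp add: z_def exp_add[symmetric] algebra_simps flip: exp_of_real)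
    ultimately show "exp (\<i> * of_real (t * (- v / pi))) * complex_of_real (qs (- v / pi)) = exp (z * of_real v) / of_real (1 + exp v)"
      by simp
  qed
  also have "of_real (1 / pi) * (LINT v|lborel. exp (z * of_real v) / of_real (1 + exp v)) = 1 / sin (of_real pi * z)"
    by (subst integral_logistic) (auto simp: z_def)
  also have "sin (of_real pi * z) = of_real (cosh t)"
  proof -
    have "of_real pi * z = of_real pi / 2 - \<i> * of_real t" by (simp add: z_def algebra_simps)
    then have "sin (of_real pi * z) = cos (\<i> * of_real t)" by (simp add: sin_diff)
    also have "\<dots> = of_real (cosh t)"
      by (simp add: cos_exp_eq cosh_field_def mult.assoc[symmetric] add.commute flip: exp_of_real)
    finally show ?thesis .
  qed
  finally show ?thesis by (simp add: FT0_def)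
qed

text \<open>Differentiation of \<open>FT0_qs\<close> under the integral sign, along a null sequence
  \<open>h\<close> so that dominated convergence applies: |exp (i h u) - 1| / h <= |u|, and |u|
  \<open>qs u\<close> is at most \<open>lap u\<close>.\<close>

lemma FT0_u_qs: "FT0 (\<lambda>u. - \<i> * of_real u * of_real (qs u)) (- t) = of_real (tanh t * (c0 / cosh t))"
proof -
  define h where "h n = inverse (real (Suc n))" for n
  have hp: "h n > 0" for n by (simp add: h_def)
  let ?\<Phi> = "\<lambda>t. LINT u|lborel. exp (\<i> * of_real (t * u)) * of_real (qs u)"
  have q1: "integrable lborel (\<lambda>u. exp (\<i> * of_real (t * u)) * of_real (qs u))" for t
    using FT0_integrable[of "\<lambda>u. of_real (qs u)" "- t"] L12_qs by (simp add: L12_def)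
  have \<Phi>: "?\<Phi> t = of_real (1 / cosh t)" for t
  proof -
    have "of_real c0 * ?\<Phi> t = FT0 (\<lambda>u. of_real (qs u)) (- t)" by (simp add: FT0_def)
    also have "\<dots> = of_real c0 * of_real (1 / cosh t)" by (simp add: FT0_qs)
    finally show ?thesis using c0_pos by (simp only: mult_cancel_left) auto
  qed
  let ?d = "\<lambda>n u. (exp (\<i> * of_real ((t + h n) * u)) * of_real (qs u) - exp (\<i> * of_real (t * u)) * of_real (qs u)) / of_real (h n)"
  have h0: "h \<longlonglongrightarrow> 0" unfolding h_def by (rule LIMSEQ_inverse_real_of_nat)
  have hf: "filterlim h (at 0) sequentially"
    using h0 hp by (auto simp: filterlim_at less_imp_neq[symmetric] intro!: always_eventually)
  have hfc: "filterlim (\<lambda>n. complex_of_real (h n)) (at 0) sequentially"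
    unfolding filterlim_at
  proof (intro conjI always_eventually allI UNIV_I)
    show "complex_of_real (h n) \<noteq> 0" for n using hp[of n] by simp
    show "(\<lambda>n. complex_of_real (h n)) \<longlonglongrightarrow> 0"
      using tendsto_of_real[OF h0, where ?'a=complex] by (simp only: of_real_0)
  qed
  have L1: "(\<lambda>n. LINT u|lborel. ?d n u) \<longlonglongrightarrow> (LINT u|lborel. exp (\<i> * of_real (t * u)) * (\<i> * of_real u * of_real (qs u)))"
  proof (rule integral_dominated_convergence[where w=lap])
    have "((\<lambda>s. exp (\<i> * (s * of_real u)) * of_real (qs u)) has_field_derivative exp (\<i> * (of_real t * of_real u)) * (\<i> * of_real u * of_real (qs u))) (at (of_real t))" for u
      by (auto intro!: derivative_eq_intros)
    then have "((\<lambda>h. (exp (\<i> * ((of_real t + h) * of_real u)) * of_real (qs u) - exp (\<i> * (of_real t * of_real u)) * of_real (qs u)) / h)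
        \<longlongrightarrow> exp (\<i> * (of_real t * of_real u)) * (\<i> * of_real u * of_real (qs u))) (at 0)" for u
      unfolding DERIV_def .
    from filterlim_compose[OF this hfc]
    show "AE u in lborel. (\<lambda>n. ?d n u) \<longlonglongrightarrow> exp (\<i> * of_real (t * u)) * (\<i> * of_real u * of_real (qs u))"
      by (intro always_eventually allI) (simp only: of_real_add of_real_mult)
    show "AE u in lborel. norm (?d n u) \<le> lap u" for n
    proof (intro always_eventually allI)
      fix u
      have "cmod (exp (\<i> * of_real (h n * u)) - 1) \<le> \<bar>h n * u\<bar>"
        using iexp_approx1[of "h n * u" 0] by simp
      then have b: "cmod (exp (\<i> * of_real (h n * u)) - 1) / h n \<le> \<bar>u\<bar>"
        using hp[of n] by (simp add: abs_mult field_simps)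
      have "?d n u = exp (\<i> * of_real (t * u)) * ((exp (\<i> * of_real (h n * u)) - 1) / of_real (h n)) * of_real (qs u)"
        by (simp add: exp_add algebra_simps diff_divide_distrib)
      then have "norm (?d n u) = cmod (exp (\<i> * of_real (h n * u)) - 1) / h n * qs u"
        using qs_pos[of u] hp[of n] by (simp add: norm_mult norm_divide del: of_real_mult)
      also have "\<dots> \<le> \<bar>u\<bar> * qs u" using b qs_pos[of u] by (intro mult_right_mono) auto
      also have "\<dots> \<le> lap u" by (rule u_qs_le_lap)
      finally show "norm (?d n u) \<le> lap u" .
    qed
    have "integrable lborel (\<lambda>u. complex_of_real (lap u))" using L12_lap by (simp add: L12_def)
    then show "integrable lborel lap" by (simp only: complex_of_real_integrable_eq)
  qed measurable
  have e: "(LINT u|lborel. ?d n u) = (of_real (1 / cosh (t + h n)) - of_real (1 / cosh t)) / of_real (h n)" for n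
    using q1 \<Phi> by (simp only: Bochner_Integration.integral_divide_zero Bochner_Integration.integral_diff)
  have L2: "(\<lambda>n. (complex_of_real (1 / cosh (t + h n)) - of_real (1 / cosh t)) / of_real (h n)) \<longlonglongrightarrow> of_real (- (tanh t / cosh t))"
  proof -
    have "((\<lambda>s. 1 / cosh s) has_real_derivative - (tanh t / cosh t)) (at t)"
      by (auto intro!: derivative_eq_intros simp: tanh_def power2_eq_square field_simps)
    then have "((\<lambda>h. (1 / cosh (t + h) - 1 / cosh t) / h) \<longlongrightarrow> - (tanh t / cosh t)) (at 0)"
      by (simp add: DERIV_def)
    from tendsto_of_real[OF filterlim_compose[OF this hf], where ?'a=complex] show ?thesis
      by (simp only: of_real_divide of_real_diff)
  qed
  have "(LINT u|lborel. exp (\<i> * of_real (t * u)) * (\<i> * of_real u * of_real (qs u))) = of_real (- (tanh t / cosh t))"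
    by (rule LIMSEQ_unique[OF L1[unfolded e] L2])
  moreover have "FT0 (\<lambda>u. - \<i> * of_real u * of_real (qs u)) (- t)
      = of_real c0 * - (LINT u|lborel. exp (\<i> * of_real (t * u)) * (\<i> * of_real u * of_real (qs u)))"
    unfolding FT0_def Bochner_Integration.integral_minus[symmetric] by simp
  ultimately show ?thesis by simp
qed

section \<open>The Hilbert transformation in logarithmic coordinates\<close>

text \<open>Partial fractions of 1/((y - x)(y + c)). Left of x the domain is compact; right of x the
  integrand is nonnegative, which gives integrability together with the value. The terms ln e at the
  two cuts cancel.\<close>

lemma truncated_integral_resolvent:
  assumes x: "x > 0" and c: "c > 0" and e: "0 < e" "e < x"
  shows "(LINT y|lborel. trkern e (y - x) * (indicator Rplus y / (y + c)))
    = (ln (x + e + c) - ln (x - e + c) - ln x + ln c) / (x + c)"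
proof -
  let ?g = "\<lambda>y. 1 / ((y - x) * (y + c))"
  let ?F1 = "\<lambda>y. (ln (x - y) - ln (y + c)) / (x + c)" and ?F2 = "\<lambda>y. (ln (y - x) - ln (y + c)) / (x + c)"
  have cont: "continuous_on {0..x - e} ?g"
    using x c e by (intro continuous_intros) auto
  have i1: "integrable lborel (\<lambda>y. indicator {0..x - e} y * ?g y)"
    using borel_integrable_atLeastAtMost'[OF cont] by (simp add: set_integrable_def)
  have v1: "(LINT y|lborel. indicator {0..x - e} y * ?g y) = ?F1 (x - e) - ?F1 0"
  proof -
    have "(LINT y|lborel. indicator {0..x - e} y *\<^sub>R ?g y) = ?F1 (x - e) - ?F1 0"
    proof (rule integral_FTC_atLeastAtMost[OF _ _ cont])
      show "0 \<le> x - e" using e by simp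
      fix y assume y: "0 \<le> y" "y \<le> x - e"
      have "(?F1 has_real_derivative ((0 - 1) / (x - y) - 1 / (y + c)) / (x + c)) (at y)"
        using y x c e by (auto intro!: derivative_eq_intros simp: divide_simps)
      also have "((0 - 1) / (x - y) - 1 / (y + c)) / (x + c) = ?g y"
      proof -
        have nz: "x - y \<noteq> 0" "y - x \<noteq> 0" "y + c \<noteq> 0" "x + c \<noteq> 0" using y x c e by auto
        have "(0 - 1) / (x - y) - 1 / (y + c) = (x + c) / ((y - x) * (y + c))"
          using nz by (simp add: divide_simps) (simp add: algebra_simps)
        then show ?thesis using nz by simp
      qed
      finally show "(?F1 has_vector_derivative ?g y) (at y within {0..x - e})"
        by (simp add: has_real_derivative_iff_has_vector_derivative has_vector_derivative_at_within)
    qed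
    then show ?thesis by simp
  qed
  have "((\<lambda>y. ln (1 - (x + c) / (y + c))) \<longlongrightarrow> ln (1 - 0)) at_top"
  proof (intro tendsto_ln tendsto_diff tendsto_const)
    have "filterlim (\<lambda>y. y + c) at_top at_top"
      by (rule filterlim_tendsto_add_at_top[OF tendsto_const filterlim_ident, of c, simplified add.commute])
    then show "((\<lambda>y. (x + c) / (y + c)) \<longlongrightarrow> 0) at_top"
      by (intro tendsto_divide_0[OF tendsto_const] filterlim_at_top_imp_at_infinity)
  qed simp
  moreover have "eventually (\<lambda>y. ln (1 - (x + c) / (y + c)) = ln (y - x) - ln (y + c)) at_top"
    using eventually_gt_at_top[of x]
  proof eventually_elim
    case (elim y)
    have "1 - (x + c) / (y + c) = (y - x) / (y + c)" using elim x c by (simp add: divide_simps)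
    then show ?case using elim x c by (simp add: ln_div)
  qed
  ultimately have "((\<lambda>y. ln (y - x) - ln (y + c)) \<longlongrightarrow> 0) at_top"
    by (simp add: tendsto_cong)
  then have lim: "(?F2 \<longlongrightarrow> 0) at_top" by (rule tendsto_divide_zero)
  have pos: "?g y \<ge> 0" if "x + e \<le> y" for y using that x c e by simp
  have nn: "(\<integral>\<^sup>+y. ennreal (?g y) * indicator {x + e..} y \<partial>lborel) = ennreal (0 - ?F2 (x + e))"
  proof (rule nn_integral_FTC_atLeast[OF _ _ pos lim])
    fix y assume y: "x + e \<le> y"
    have nz: "y - x > 0" "y + c > 0" "x + c > 0" using y x c e by auto
    have "(?F2 has_real_derivative (1 / (y - x) - 1 / (y + c)) / (x + c)) (at y)"
      using nz by (auto intro!: derivative_eq_intros simp: divide_simps)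
    also have "(1 / (y - x) - 1 / (y + c)) / (x + c) = ?g y"
    proof -
      have "1 / (y - x) - 1 / (y + c) = (x + c) / ((y - x) * (y + c))"
        using nz by (simp add: divide_simps)
      then show ?thesis using nz by simp
    qed
    finally show "(?F2 has_real_derivative ?g y) (at y)" .
  qed measurable
  have F2: "0 - ?F2 (x + e) \<ge> 0"
  proof -
    have "ln e \<le> ln (x + e + c)" using x c e by (subst ln_le_cancel_iff) auto
    then show ?thesis using x c by (simp add: divide_nonpos_pos)
  qed
  have hb: "has_bochner_integral lborel (\<lambda>y. indicator {x + e..} y * ?g y) (0 - ?F2 (x + e))"
  proof (rule has_bochner_integral_nn_integral[OF _ _ F2])
    show "AE y in lborel. 0 \<le> indicator {x + e..} y * ?g y"
      using pos by (auto split: split_indicator)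
    have "(\<integral>\<^sup>+y. ennreal (indicator {x + e..} y * ?g y) \<partial>lborel) = (\<integral>\<^sup>+y. ennreal (?g y) * indicator {x + e..} y \<partial>lborel)"
      by (intro nn_integral_cong) (auto split: split_indicator)
    then show "(\<integral>\<^sup>+y. ennreal (indicator {x + e..} y * ?g y) \<partial>lborel) = ennreal (0 - ?F2 (x + e))"
      unfolding nn .
  qed measurable
  \<comment> \<open>The two closed intervals differ from the truncated half-line only in these
    endpoints.\<close>
  have "AE y in lborel. y \<noteq> 0" "AE y in lborel. y \<noteq> x - e" "AE y in lborel. y \<noteq> x + e"
    by (rule AE_lborel_singleton)+
  then have ae: "AE y in lborel. trkern e (y - x) * (indicator Rplus y / (y + c))
      = indicator {0..x - e} y * ?g y + indicator {x + e..} y * ?g y"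
    by eventually_elim (use e in \<open>auto simp: trkern_def abs_if split: split_indicator if_splits\<close>)
  have "(LINT y|lborel. trkern e (y - x) * (indicator Rplus y / (y + c)))
      = (LINT y|lborel. indicator {0..x - e} y * ?g y + indicator {x + e..} y * ?g y)"
    by (rule integral_cong_AE[OF _ _ ae]) measurable
  also have "\<dots> = (?F1 (x - e) - ?F1 0) + (0 - ?F2 (x + e))"
    unfolding Bochner_Integration.integral_add[OF i1 integrable.intros[OF hb]] v1 has_bochner_integral_integral_eq[OF hb] ..
  also have "\<dots> = (ln (x + e + c) - ln (x - e + c) - ln x + ln c) / (x + c)"
    by (simp add: diff_divide_distrib add_divide_distrib)
  finally show ?thesis .
qed

lemma principal_value_resolvent:
  assumes x: "x > 0" and c: "c > 0"
  shows "((\<lambda>e. LINT y|lborel. trkern e (y - x) * (indicator Rplus y / (y + c))) \<longlongrightarrow> - ln (x / c) / (x + c)) (at_right 0)"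
proof (rule Lim_transform_eventually)
  have "((\<lambda>e. (ln (x + e + c) - ln (x - e + c) - ln x + ln c) / (x + c)) \<longlongrightarrow>
      (ln (x + 0 + c) - ln (x - 0 + c) - ln x + ln c) / (x + c)) (at_right 0)"
    using x c by (intro tendsto_intros) auto
  then show "((\<lambda>e. (ln (x + e + c) - ln (x - e + c) - ln x + ln c) / (x + c)) \<longlongrightarrow> - ln (x / c) / (x + c)) (at_right 0)"
    using x c by (simp add: ln_div)
  have "eventually (\<lambda>e. 0 < e \<and> e < x) (at_right 0)"
    using x unfolding eventually_at_right_field by (intro exI[of _ x]) auto
  then show "eventually (\<lambda>e. (ln (x + e + c) - ln (x - e + c) - ln x + ln c) / (x + c)
      = (LINT y|lborel. trkern e (y - x) * (indicator Rplus y / (y + c)))) (at_right 0)"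
  proof eventually_elim
    case (elim e)
    show ?case by (rule truncated_integral_resolvent[OF x c, symmetric]) (use elim in auto)
  qed
qed

text \<open>The change of variable of \<open>Gamma_log\<close> on the whole half-line: it connects
  L^2(R) with L^2 of the half-line, where the Hilbert transformation becomes a multiplier. The
  interval (0,1) corresponds to u > 0 and is reached by compression.\<close>

interpretation logarithm: change_of_variable Rplus UNIV "\<lambda>t. - (1 / pi) * ln t" "\<lambda>t. - 1 / (pi * t)"
  "\<lambda>u. exp (- (pi * u))" "\<lambda>t. of_real ((pi * t) powr (-1/2))"
proof
  show "((\<lambda>t. - (1 / pi) * ln t) has_real_derivative - 1 / (pi * t)) (at t)" if "t \<in> Rplus" for t
    using that by (auto intro!: derivative_eq_intros)
  show "(cmod (of_real ((pi * t) powr (-1/2))))\<^sup>2 = \<bar>- 1 / (pi * t)\<bar>" if "t \<in> Rplus" for t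
    using that unfolding norm_of_real by (simp add: powr_minus_divide powr_half_sqrt power_divide abs_mult)
qed auto

interpretation logarithm01: change_of_variable "{0<..<1}" Rplus "\<lambda>t. - (1 / pi) * ln t" "\<lambda>t. - 1 / (pi * t)"
  "\<lambda>u. exp (- (pi * u))" "\<lambda>t. of_real ((pi * t) powr (-1/2))"
proof
  show "- (1 / pi) * ln t \<in> Rplus" if "t \<in> {0<..<1}" for t
    using that by (simp add: mult_pos_neg ln_less_zero divide_neg_pos)
  show "((\<lambda>t. - (1 / pi) * ln t) has_real_derivative - 1 / (pi * t)) (at t)" if "t \<in> {0<..<1}" for t
    using that by (auto intro!: derivative_eq_intros)
  show "(cmod (of_real ((pi * t) powr (-1/2))))\<^sup>2 = \<bar>- 1 / (pi * t)\<bar>" if "t \<in> {0<..<1}" for t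
    using that unfolding norm_of_real by (simp add: powr_minus_divide powr_half_sqrt power_divide abs_mult)
qed auto

definition EL :: "(real \<Rightarrow> complex) \<Rightarrow> real \<Rightarrow> complex" where
  "EL f t = indicator Rplus t * (of_real ((pi * t) powr (-1/2)) * f (- (1 / pi) * ln t))"

lemma EL_eq: "logarithm.WC = EL"
  by (intro ext) (simp only: logarithm.WC_def EL_def)

lemmas L2on_EL = logarithm.L2on_WC[unfolded EL_eq]
  and ip_EL = logarithm.ip_WC[unfolded EL_eq]
  and EL_cong = logarithm.WC_cong[unfolded EL_eq]
  and EL_surj = logarithm.WC_surj[unfolded EL_eq]

text \<open>\<open>EL\<close> maps these shifts to multiples of 1/(t + c) with c = exp (-pi
  \<tau>).\<close>

definition qsh :: "real \<Rightarrow> real \<Rightarrow> complex" where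
  "qsh \<tau> u = of_real (qs (u - \<tau>))"

text \<open>What the multiplier tanh makes of \<open>qsh\<close>, by
  \<open>MF_tanhc_qsh\<close>.\<close>

definition uqsh :: "real \<Rightarrow> real \<Rightarrow> complex" where
  "uqsh \<tau> u = - \<i> * of_real (u - \<tau>) * of_real (qs (u - \<tau>))"

lemma L12_shift: "L12 f \<Longrightarrow> L12 (\<lambda>u. f (u - \<tau>))"
proof -
  assume f: "L12 f"
  have i: "integrable lborel f" and m [measurable]: "f \<in> borel_measurable borel"
    and i2: "integrable lborel (\<lambda>x. (cmod (f x))\<^sup>2)"
    using f by (auto simp: L12_def L2f_def)
  have "integrable lborel (\<lambda>u. f (u - \<tau>))" "integrable lborel (\<lambda>u. (cmod (f (u - \<tau>)))\<^sup>2)"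
    using lborel_integrable_real_affine[OF i, of 1 "- \<tau>"] lborel_integrable_real_affine[OF i2, of 1 "- \<tau>"] by simp_all
  then show ?thesis by (simp add: L12_def L2f_def)
qed

lemma FT0_shift: "FT0 (\<lambda>u. f (u - \<tau>)) (- t) = exp (\<i> * of_real (t * \<tau>)) * FT0 f (- t)"
proof -
  have "(LINT u|lborel. exp (- (\<i> * of_real (- t * u))) * f (u - \<tau>)) = (LINT u|lborel. exp (- (\<i> * of_real (- t * (\<tau> + 1 * u)))) * f (\<tau> + 1 * u - \<tau>))"
    by (subst lborel_integral_real_affine[where c=1 and t=\<tau>]) simp_all
  also have "\<dots> = (LINT u|lborel. exp (\<i> * of_real (t * \<tau>)) * (exp (- (\<i> * of_real (- t * u))) * f u))"
  proof -
    have "exp (- (\<i> * of_real (- t * (\<tau> + 1 * u)))) = exp (\<i> * of_real (t * \<tau>)) * exp (- (\<i> * of_real (- t * u)))" for u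
      unfolding exp_add[symmetric] by (intro arg_cong[where f=exp]) (simp add: algebra_simps)
    then show ?thesis by (simp only: mult.assoc) simp
  qed
  also have "\<dots> = exp (\<i> * of_real (t * \<tau>)) * (LINT u|lborel. exp (- (\<i> * of_real (- t * u))) * f u)"
    by (rule Bochner_Integration.integral_mult_right_zero)
  finally show ?thesis by (simp only: FT0_def mult.left_commute)
qed

lemma L12_qsh: "L12 (qsh \<tau>)" and L12_uqsh: "L12 (uqsh \<tau>)"
  using L12_shift[OF L12_qs, of \<tau>] L12_shift[OF L12_u_qs, of \<tau>] by (simp_all add: qsh_def[abs_def] uqsh_def[abs_def])

lemma L2f_qsh: "L2f (qsh \<tau>)" and L2f_uqsh: "L2f (uqsh \<tau>)"
  using L12_qsh L12_uqsh by (auto simp: L12_def)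

lemma FI_qsh: "AE t in lborel. FI (qsh \<tau>) t = exp (\<i> * of_real (t * \<tau>)) * of_real (c0 / cosh t)"
proof -
  have "FT0 (qsh \<tau>) (- t) = exp (\<i> * of_real (t * \<tau>)) * of_real (c0 / cosh t)" for t
    unfolding qsh_def[abs_def] FT0_shift[of "\<lambda>u. of_real (qs u)"] FT0_qs ..
  then show ?thesis
    using FI_eq_FT0[of "qsh \<tau>"] L12_qsh[of \<tau>] by (simp add: L12_def)
qed

definition tanhc :: "real \<Rightarrow> complex" where
  "tanhc t = of_real (tanh t)"

lemma tanhc_multiplier: "tanhc \<in> borel_measurable borel" "cmod (tanhc t) \<le> 1"
proof -
  have "continuous_on UNIV (\<lambda>t::real. of_real (tanh t) :: complex)"
    by (intro continuous_intros) auto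
  then show "tanhc \<in> borel_measurable borel"
    unfolding tanhc_def[abs_def] by (rule borel_measurable_continuous_onI)
  show "cmod (tanhc t) \<le> 1" using tanh_real_bounds[of t] by (auto simp: tanhc_def)
qed

lemma MF_tanhc_qsh: "AE u in lborel. MF tanhc (qsh \<tau>) u = uqsh \<tau> u"
proof -
  have "FT0 (uqsh \<tau>) (- t) = exp (\<i> * of_real (t * \<tau>)) * of_real (tanh t * (c0 / cosh t))" for t
    unfolding uqsh_def[abs_def] FT0_shift[of "\<lambda>u. - \<i> * of_real u * of_real (qs u)"] FT0_u_qs ..
  then have "AE t in lborel. FI (uqsh \<tau>) t = exp (\<i> * of_real (t * \<tau>)) * of_real (tanh t * (c0 / cosh t))"
    using FI_eq_FT0[of "uqsh \<tau>"] L12_uqsh[of \<tau>] by (simp add: L12_def)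
  with FI_qsh[of \<tau>] have "AE t in lborel. tanhc t * FI (qsh \<tau>) t = FI (uqsh \<tau>) t"
    by eventually_elim (simp add: tanhc_def)
  then have "AE u in lborel. MF tanhc (qsh \<tau>) u = FF (FI (uqsh \<tau>)) u"
    unfolding MF_def by (intro FF_cong L2f_bounded_mult[OF L2f_FI[OF L2f_qsh] tanhc_multiplier] L2f_FI L2f_uqsh)
  then show ?thesis
    using FF_FI[OF L2f_uqsh[of \<tau>]] by eventually_elim simp
qed

text \<open>On the Fourier side the shifts are the exponentials exp (i t \<tau>) times a multiple of
  1/cosh. Orthogonality to all of them makes the Fourier transform of FI w / cosh vanish, and 1/cosh
  has no zeros.\<close>

lemma qsh_total:
  assumes w: "L2f w" and z: "\<And>\<tau>. ip (qsh \<tau>) w = 0"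
  shows "AE u in lborel. w u = 0"
proof -
  define s where "s t = complex_of_real (c0 / cosh t)" for t
  note W = L2f_FI[OF w]
  have s_eq: "s = (\<lambda>t. FT0 (\<lambda>u. of_real (qs u)) (- t))" by (auto simp: s_def FT0_qs)
  have s2: "L2f s" unfolding s_eq by (intro L2f_reflect L2f_FT0 L12_qs)
  have sb: "cmod (s t) \<le> c0" for t
  proof -
    have "c0 / cosh t \<le> c0 / 1" using c0_pos cosh_real_ge_1[of t] by (intro divide_left_mono) auto
    then show ?thesis using c0_pos unfolding s_def norm_of_real by simp
  qed
  let ?h = "\<lambda>t. s t * FI w t"
  have h1: "integrable lborel ?h" by (rule L2f_integrable_mult[OF s2 W])
  have h2: "L2f ?h" by (rule L2f_bounded_mult[OF W L2f_measurable[OF s2] sb])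
  have "FT0 ?h \<tau> = 0" for \<tau>
  proof -
    let ?e = "\<lambda>t. exp (\<i> * of_real (t * \<tau>)) * s t"
    have [measurable]: "s \<in> borel_measurable borel" by (rule L2f_measurable[OF s2])
    have e2: "L2f ?e"
      by (rule L2f_bounded_mult[OF s2, where C=1]) (auto simp del: of_real_mult)
    have "ip (qsh \<tau>) w = ip (FI (qsh \<tau>)) (FI w)" by (simp add: ip_FI L2f_qsh w)
    also have "\<dots> = ip ?e (FI w)"
      using FI_qsh[of \<tau>] unfolding s_def
      by (intro ip_cong_AE L2f_measurable[OF L2f_FI[OF L2f_qsh]] L2f_measurable[OF e2, unfolded s_def] L2f_measurable[OF W]) auto
    also have "\<dots> = (LINT t|lborel. exp (- (\<i> * of_real (\<tau> * t))) * ?h t)"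
      unfolding ip_def by (intro Bochner_Integration.integral_cong) (auto simp: exp_cnj s_def ac_simps)
    finally show ?thesis using z[of \<tau>] by (simp add: FT0_def)
  qed
  then have "nsq (FT0 ?h) = 0" by (simp add: nsq_def)
  then have "nsq ?h = 0" using FT0_isometry[OF h1 h2] by simp
  from nsq_eq_0[OF h2 this] have "AE t in lborel. FI w t = 0"
    by eventually_elim (use c0_pos in \<open>auto simp: s_def\<close>)
  then have "ip (FI w) (FI w) = ip (\<lambda>x. 0) (\<lambda>x. 0)"
    using L2f_measurable[OF W] by (intro ip_cong_AE) auto
  then have "ip w w = 0" unfolding ip_FI[OF w w] by (simp add: ip_def)
  then have "nsq w = 0" by (simp add: ip_self)
  from nsq_eq_0[OF w this] show ?thesis .
qed

lemma logarithm_qsh: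
  assumes t: "t > 0"
  defines "c \<equiv> \<lambda>\<tau>. exp (- (pi * \<tau>))"
  shows "EL (qsh \<tau>) t = of_real (sqrt (c \<tau> / pi) * (1 / (t + c \<tau>)))"
    and "EL (uqsh \<tau>) t = \<i> / of_real pi * of_real (ln (t / c \<tau>)) * of_real (sqrt (c \<tau> / pi) * (1 / (t + c \<tau>)))"
proof -
  have c: "c \<tau> > 0" by (simp add: c_def)
  \<comment> \<open>Then exp (pi v) = c/t, which makes \<open>qs v\<close> algebraic in the square
    roots of c and t.\<close>
  define v where "v = - (1 / pi) * ln t - \<tau>"
  have piv: "pi * v = ln (c \<tau>) - ln t" by (simp add: v_def c_def algebra_simps)
  have e: "exp (pi * v / 2) = sqrt (c \<tau>) / sqrt t"
  proof -
    have pv: "pi * v / 2 = ln (sqrt (c \<tau>)) - ln (sqrt t)"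
      unfolding piv using c t by (simp add: ln_sqrt diff_divide_distrib)
    show ?thesis unfolding pv exp_diff using c t by simp
  qed
  have "sqrt (c \<tau>) / sqrt t + sqrt t / sqrt (c \<tau>) = (c \<tau> + t) / (sqrt t * sqrt (c \<tau>))"
    using c t by (simp add: divide_simps)
  then have q: "qs v = sqrt t * sqrt (c \<tau>) / (t + c \<tau>)"
    unfolding qs_def exp_minus e by (simp add: add.commute)
  have p: "(pi * t) powr (-1/2) = 1 / (sqrt pi * sqrt t)"
    using t by (simp add: powr_minus_divide powr_half_sqrt real_sqrt_mult)
  have pq: "(pi * t) powr (-1/2) * qs v = sqrt (c \<tau> / pi) * (1 / (t + c \<tau>))"
    unfolding p q using t c by (simp add: real_sqrt_divide)
  show 1: "EL (qsh \<tau>) t = of_real (sqrt (c \<tau> / pi) * (1 / (t + c \<tau>)))"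
    unfolding pq[symmetric] using t by (simp add: EL_def qsh_def v_def)
  have "EL (uqsh \<tau>) t = - \<i> * of_real v * EL (qsh \<tau>) t"
    using t by (simp add: EL_def qsh_def uqsh_def v_def)
  also have "v = - (ln (t / c \<tau>) / pi)"
    using piv t c by (simp add: ln_div field_simps)
  finally show "EL (uqsh \<tau>) t = \<i> / of_real pi * of_real (ln (t / c \<tau>)) * of_real (sqrt (c \<tau> / pi) * (1 / (t + c \<tau>)))"
    unfolding 1 by simp
qed

text \<open>The limit computed in \<open>principal_value_resolvent\<close> is the value of
  \<open>HT\<close> wherever \<open>AE_principal_value\<close> applies; the logarithm ln (x / c) =
  -pi (u - \<tau>) reproduces the linear factor of \<open>uqsh\<close>.\<close>

lemma HT_logarithm_qsh: "AE x in lborel. x > 0 \<longrightarrow> HT (EL (qsh \<tau>)) x = EL (uqsh \<tau>) x"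
  using AE_principal_value[OF L2on_L2f[OF L2on_EL[OF L2f_qsh[of \<tau>]]]]
proof eventually_elim
  case (elim x)
  define c where "c = exp (- (pi * \<tau>))"
  have c: "c > 0" by (simp add: c_def)
  define r where "r = sqrt (c / pi)"
  show ?case
  proof
    assume x: "x > 0"
    have E: "EL (qsh \<tau>) y = of_real (r * (indicator Rplus y / (y + c)))" for y
    proof (cases "y > 0")
      case True
      then show ?thesis using logarithm_qsh(1)[OF True, of \<tau>] by (simp add: r_def c_def)
    qed (simp add: EL_def)
    have "1 / (\<i> * of_real pi) * (LINT y|lborel. of_real (trkern e (y - x)) * EL (qsh \<tau>) y)
        = 1 / (\<i> * of_real pi) * (of_real (r * (LINT y|lborel. trkern e (y - x) * (indicator Rplus y / (y + c)))))" for e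
    proof -
      have "of_real (trkern e (y - x)) * EL (qsh \<tau>) y = complex_of_real (r * (trkern e (y - x) * (indicator Rplus y / (y + c))))" for y
        unfolding E by simp
      then show ?thesis by (simp only: integral_complex_of_real Bochner_Integration.integral_mult_right_zero)
    qed
    moreover have "((\<lambda>e. 1 / (\<i> * of_real pi) * complex_of_real (r * (LINT y|lborel. trkern e (y - x) * (indicator Rplus y / (y + c)))))
        \<longlongrightarrow> 1 / (\<i> * of_real pi) * complex_of_real (r * (- ln (x / c) / (x + c)))) (at_right 0)"
      by (intro tendsto_intros tendsto_of_real principal_value_resolvent x c)
    ultimately have "HT (EL (qsh \<tau>)) x = 1 / (\<i> * of_real pi) * complex_of_real (r * (- ln (x / c) / (x + c)))"
      using tendsto_unique[OF trivial_limit_at_right_real elim] by simp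
    also have "\<dots> = EL (uqsh \<tau>) x"
      unfolding logarithm_qsh(2)[OF x] c_def[symmetric] r_def[symmetric] by (simp add: divide_simps)
    finally show "HT (EL (qsh \<tau>)) x = EL (uqsh \<tau>) x" .
  qed
qed

lemma ip_MF_selfadjoint:
  assumes f: "L2f f" and g: "L2f g" and k: "\<kappa> \<in> borel_measurable borel" "\<And>x. cmod (\<kappa> x) \<le> C"
    and r: "\<And>x. cnj (\<kappa> x) = \<kappa> x"
  shows "ip (MF \<kappa> f) g = ip f (MF \<kappa> g)"
proof -
  note F = L2f_bounded_mult[OF L2f_FI[OF f] k] and G = L2f_bounded_mult[OF L2f_FI[OF g] k]
  have "ip (MF \<kappa> f) g = ip (\<lambda>t. \<kappa> t * FI f t) (FI g)"
    unfolding MF_def by (rule ip_FF_FI[OF F g])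
  also have "\<dots> = ip (FI f) (\<lambda>t. \<kappa> t * FI g t)"
    unfolding ip_def by (intro Bochner_Integration.integral_cong) (auto simp: r)
  also have "\<dots> = ip f (MF \<kappa> g)"
    unfolding MF_def by (rule ip_FI_FF[OF f G])
  finally show ?thesis .
qed

text \<open>Both sides are tested against the total family \<open>qsh\<close>, onto which the self-adjoint operators
  are moved.\<close>

theorem HT_logarithm:
  assumes f: "L2f f"
  shows "AE x in lborel. indicator Rplus x * HT (EL f) x = EL (MF tanhc f) x"
proof -
  let ?E = EL
  have R: "Rplus \<in> sets (borel :: real measure)" by simp
  have Ef: "L2f (?E f)" by (rule L2on_L2f[OF L2on_EL[OF f]])
  have g: "L2on Rplus (\<lambda>x. indicator Rplus x * HT (?E f) x)"
    by (intro L2on_indicator L2f_HT Ef R)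
  \<comment> \<open>\<open>y\<close> is the compressed Hilbert transform of \<open>EL f\<close>
    pulled back by the unitary \<open>EL\<close>, to be compared with the multiplier.\<close>
  obtain y where y1: "L2on UNIV y" and Ey: "?E y = (\<lambda>x. indicator Rplus x * HT (?E f) x)"
    using EL_surj[OF g] by blast
  have y: "L2f y" using y1 by (rule L2on_L2f)
  have X: "L2f (MF tanhc f)" by (rule L2f_MF[OF f tanhc_multiplier])
  have ipE: "ip (?E a) (?E b) = ip a b" if "L2f a" "L2f b" for a b
    using ip_EL[OF that] by simp
  have ind: "cnj (?E a x) * (indicator Rplus x * z) = cnj (?E a x) * z" for a x z
    by (simp add: EL_def split: split_indicator)
  have "ip (qsh \<tau>) (\<lambda>u. y u - MF tanhc f u) = 0" for \<tau>
  proof -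
    let ?q = "qsh \<tau>"
    have Eq: "L2f (?E ?q)" by (rule L2on_L2f[OF L2on_EL[OF L2f_qsh]])
    have EX: "L2f (?E (uqsh \<tau>))" by (rule L2on_L2f[OF L2on_EL[OF L2f_uqsh]])
    have "ip ?q y = ip (?E ?q) (?E y)" by (rule ipE[OF L2f_qsh y, symmetric])
    also have "\<dots> = ip (?E ?q) (HT (?E f))" unfolding Ey ip_def ind ..
    also have "\<dots> = ip (HT (?E ?q)) (?E f)"
      unfolding HT_def by (rule ip_MF_selfadjoint[OF Eq Ef sgn_multiplier, symmetric]) simp
    also have "\<dots> = ip (?E (uqsh \<tau>)) (?E f)"
      unfolding ip_def
    proof (rule integral_cong_AE)
      show "(\<lambda>x. cnj (HT (?E ?q) x) * ?E f x) \<in> borel_measurable lborel"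
        "(\<lambda>x. cnj (?E (uqsh \<tau>) x) * ?E f x) \<in> borel_measurable lborel"
        using L2f_measurable[OF L2f_HT[OF Eq]] L2f_measurable[OF Ef] L2f_measurable[OF EX] by measurable
      show "AE x in lborel. cnj (HT (?E ?q) x) * ?E f x = cnj (?E (uqsh \<tau>) x) * ?E f x"
        using HT_logarithm_qsh[of \<tau>] by eventually_elim (simp add: EL_def[of f] split: split_indicator)
    qed
    also have "\<dots> = ip (uqsh \<tau>) f" by (rule ipE[OF L2f_uqsh f])
    also have "\<dots> = ip (MF tanhc ?q) f"
      using MF_tanhc_qsh[of \<tau>]
      by (intro ip_cong_AE L2f_measurable[OF L2f_uqsh] L2f_measurable[OF L2f_MF[OF L2f_qsh tanhc_multiplier]] L2f_measurable[OF f])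
        (auto elim: eventually_mono)
    also have "\<dots> = ip ?q (MF tanhc f)"
      by (rule ip_MF_selfadjoint[OF L2f_qsh f tanhc_multiplier]) (simp add: tanhc_def)
    finally show ?thesis by (simp add: ip_diff_right L2f_qsh y X)
  qed
  from qsh_total[OF L2f_diff[OF y X] this] have "AE u in lborel. u \<in> UNIV \<longrightarrow> y u = MF tanhc f u" by auto
  from EL_cong[OF this] show ?thesis unfolding Ey .
qed

section \<open>Wiener-Hopf operators with symbol $\tanh$\<close>

lemma Gamma_log_eq: "Gamma_log u = ae_class {0<..<1} (EL (ext Rplus u))"
  unfolding Gamma_log_def
proof (rule ae_class_eqI)
  have "- (1 / pi) * ln t \<in> Rplus" if "t \<in> {0<..<1}" for t using logarithm01.g_T[OF that] .
  then show "AE t in lborel. t \<in> {0<..<1} \<longrightarrow>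
      of_real ((pi * t) powr (-1/2)) * rep u (- (1 / pi) * ln t) = EL (ext Rplus u) t"
    by (intro always_eventually) (simp add: EL_def ext_def)
qed simp

lemma EL_L2on01:
  assumes e: "L2on Rplus e"
  shows "L2on {0<..<1} (EL e)"
  unfolding L2on_def
proof (intro conjI allI impI)
  show "L2f (EL e)" by (rule L2on_L2f[OF L2on_EL[OF L2on_L2f[OF e]]])
  fix t :: real assume t: "t \<notin> {0<..<1}"
  show "EL e t = 0"
  proof (cases "t > 0")
    case True
    then have "ln t \<ge> 0" using t by (intro ln_ge_zero) auto
    then have "- (1 / pi) * ln t \<notin> Rplus" by (simp add: divide_less_0_iff)
    then have "e (- (1 / pi) * ln t) = 0" using e unfolding L2on_def by blast
    then show ?thesis unfolding EL_def by simp
  qed (simp add: EL_def)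
qed

lemma hilbert_iso_Gamma_log: "hilbert_iso Rplus {0<..<1} Gamma_log"
proof (rule logarithm01.hilbert_iso_WC)
  fix u
  show "Gamma_log u = ae_class {0<..<1} (logarithm01.WC (ext Rplus u))"
    unfolding Gamma_log_eq
    by (intro ae_class_eqI always_eventually) (simp_all only: EL_def logarithm01.WC_def, auto)
qed

text \<open>\<open>EL\<close> takes functions supported in u > 0 to functions supported in (0,1), so
  compressing both sides of \<open>HT_logarithm\<close> to these sets turns the multiplier into the
  Wiener-Hopf operator with symbol +tanh.\<close>

lemma conjugate_via_Gamma_log:
  "conjugate_via Rplus {0<..<1} Gamma_log (wiener_hopf tanhc) (hilbert_transf 0 1)"
  unfolding conjugate_via_iff
proof (intro conjI ballI image_subsetI)
  let ?S = "{0<..<1::real}"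
  have S: "?S \<in> sets borel" and R: "Rplus \<in> sets (borel :: real measure)" by simp_all
  show iso: "hilbert_iso Rplus ?S Gamma_log" by (rule hilbert_iso_Gamma_log)
  fix u assume u: "u \<in> L2 Rplus"
  let ?e = "ext Rplus u"
  have e1: "L2on Rplus ?e" by (rule ext_L2(1)[OF R u])
  note e = L2on_L2f[OF e1]
  have E: "L2f (EL ?e)" by (rule L2on_L2f[OF L2on_EL[OF e]])
  show "wiener_hopf tanhc u \<in> L2 Rplus" by (rule wiener_hopf_mem[OF u tanhc_multiplier])
  have Gu: "Gamma_log u \<in> L2 ?S" by (rule hilbert_iso_mem[OF iso u])
  have X: "L2f (MF tanhc ?e)" by (rule L2f_MF[OF e tanhc_multiplier])
  have "AE x in lborel. ext ?S (Gamma_log u) x = EL ?e x"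
    unfolding Gamma_log_eq by (rule ext_ae_class_L2on[OF S EL_L2on01[OF e1]])
  from HT_cong[OF L2f_ext[OF S Gu] E this] HT_logarithm[OF e]
  have 1: "AE x in lborel. indicator Rplus x * HT (ext ?S (Gamma_log u)) x = EL (MF tanhc ?e) x"
    by eventually_elim simp
  have "AE x in lborel. ext Rplus (wiener_hopf tanhc u) x = indicator Rplus x * MF tanhc ?e x"
    unfolding wiener_hopf_MF[OF u tanhc_multiplier] by (intro ext_ae_class_L2on L2on_indicator X R)
  then have "AE x in lborel. x \<in> UNIV \<longrightarrow> ext Rplus (wiener_hopf tanhc u) x = indicator Rplus x * MF tanhc ?e x"
    by eventually_elim simp
  from EL_cong[OF this]
  have 2: "AE x in lborel. EL (ext Rplus (wiener_hopf tanhc u)) x = EL (\<lambda>x. indicator Rplus x * MF tanhc ?e x) x" .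
  have 3: "EL (\<lambda>x. indicator Rplus x * MF tanhc ?e x) x = EL (MF tanhc ?e) x" if "x \<in> ?S" for x
    using logarithm01.g_T[OF that] unfolding EL_def by simp
  note H = hilbert_transf_eq[of _ 0 1, unfolded einterval_0_1]
  show "hilbert_transf 0 1 (Gamma_log u) = Gamma_log (wiener_hopf tanhc u)"
    unfolding H[OF Gu] Gamma_log_eq[of "wiener_hopf tanhc u"]
  proof (rule ae_class_eqI[OF S])
    show "AE x in lborel. x \<in> ?S \<longrightarrow> HT (ext ?S (Gamma_log u)) x = EL (ext Rplus (wiener_hopf tanhc u)) x"
      using 1 2
    proof eventually_elim
      case (elim x)
      show ?case
      proof
        assume x: "x \<in> ?S"
        then have "HT (ext ?S (Gamma_log u)) x = EL (MF tanhc ?e) x" using elim(1) by simp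
        then show "HT (ext ?S (Gamma_log u)) x = EL (ext Rplus (wiener_hopf tanhc u)) x"
          unfolding elim(2) 3[OF x] .
      qed
    qed
  qed
qed

section \<open>The symbols tanh and -tanh under the Moebius action\<close>

lemma wiener_hopf_uminus:
  assumes u: "u \<in> L2 Rplus" and k: "\<kappa> \<in> borel_measurable borel" "\<And>x. cmod (\<kappa> x) \<le> C"
  shows "wiener_hopf (\<lambda>x. - \<kappa> x) u = L2_scale Rplus (-1) (wiener_hopf \<kappa> u)"
proof -
  have R: "Rplus \<in> sets (borel :: real measure)" by simp
  have e: "L2f (ext Rplus u)" by (rule L2f_ext[OF R u])
  have nk: "(\<lambda>x. - \<kappa> x) \<in> borel_measurable borel" "\<And>x. cmod (- \<kappa> x) \<le> C"
    using k by auto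
  have X: "L2f (MF \<kappa> (ext Rplus u))" by (rule L2f_MF[OF e k])
  have "(\<lambda>t. - \<kappa> t * FI (ext Rplus u) t) = (\<lambda>t. -1 * (\<kappa> t * FI (ext Rplus u) t))" by auto
  then have 1: "AE x in lborel. MF (\<lambda>x. - \<kappa> x) (ext Rplus u) x = -1 * MF \<kappa> (ext Rplus u) x"
    unfolding MF_def using FF_scale[OF L2f_bounded_mult[OF L2f_FI[OF e] k], of "-1"] by simp
  have 2: "AE x in lborel. ext Rplus (wiener_hopf \<kappa> u) x = indicator Rplus x * MF \<kappa> (ext Rplus u) x"
    unfolding wiener_hopf_MF[OF u k] by (intro ext_ae_class_L2on L2on_indicator X R)
  show ?thesis
    unfolding wiener_hopf_MF[OF u nk] L2_scale_ext[OF R]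
  proof (rule ae_class_eqI[OF R])
    show "AE x in lborel. x \<in> Rplus \<longrightarrow> indicator Rplus x * MF (\<lambda>x. - \<kappa> x) (ext Rplus u) x = -1 * ext Rplus (wiener_hopf \<kappa> u) x"
      using 1 2 by eventually_elim simp
  qed
qed

lemma uminus_kappa: "- kappa A x = tanhc (moebius A x)"
  by (simp add: kappa_def tanhc_def)

lemma moebius_moebius_matrix_inv:
  assumes A: "det A = 1"
  shows "AE x in lborel. moebius A (moebius (matrix_inv A) x) = x"
proof -
  interpret sl2 "A$1$1" "A$1$2" "A$2$1" "A$2$2" by (rule sl2_det[OF A])
  show ?thesis
    using AE_denom
  proof eventually_elim
    case (elim x)
    show ?case
      unfolding moebius_matrix_inv[OF A] moebius_def[of A]
      using moebius_inverse[OF elim] by (simp only: add.commute[of "A$2$1 * _"])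
  qed
qed

text \<open>F'_A composes a symbol with A^-1 and so strips the Moebius map from
  \<open>kappa A\<close>; this is why its inverse occurs in \<open>Lambda'\<close>.\<close>

lemma conjugate_via_F_op'_tanh:
  assumes A: "det A = 1"
  shows "conjugate_via Rplus Rplus (F_op' A) (wiener_hopf (\<lambda>x. - kappa A x)) (wiener_hopf tanhc)"
    and "conjugate_via Rplus Rplus (F_op' A) (wiener_hopf (kappa A)) (wiener_hopf (\<lambda>x. - tanhc x))"
proof -
  have m: "moebius A \<in> borel_measurable borel" unfolding moebius_def by measurable
  have k: "(\<lambda>x. - kappa A x) \<in> borel_measurable borel" "\<And>x. cmod (- kappa A x) \<le> 1"
    unfolding uminus_kappa using measurable_compose[OF m tanhc_multiplier(1)] tanhc_multiplier(2) by auto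
  have k': "kappa A \<in> borel_measurable borel" "\<And>x. cmod (kappa A x) \<le> 1"
    using borel_measurable_uminus[OF k(1)] k(2) by auto
  have nt: "(\<lambda>x. - tanhc x) \<in> borel_measurable borel" "\<And>x. cmod (- tanhc x) \<le> 1"
    using borel_measurable_uminus[OF tanhc_multiplier(1)] tanhc_multiplier(2) by auto
  have eq: "AE x in lborel. tanhc x = - kappa A (moebius (matrix_inv A) x)"
    using moebius_moebius_matrix_inv[OF A] by eventually_elim (simp only: uminus_kappa)
  show "conjugate_via Rplus Rplus (F_op' A) (wiener_hopf (\<lambda>x. - kappa A x)) (wiener_hopf tanhc)"
    by (rule conjugate_via_F_op'[OF A k tanhc_multiplier eq])
  have eq': "AE x in lborel. - tanhc x = kappa A (moebius (matrix_inv A) x)"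
    using eq by eventually_elim simp
  show "conjugate_via Rplus Rplus (F_op' A) (wiener_hopf (kappa A)) (wiener_hopf (\<lambda>x. - tanhc x))"
    by (rule conjugate_via_F_op'[OF A k' nt eq'])
qed

text \<open>Both chains run from \<open>twoK_minus_I\<close> through the Hilbert transformation of
  (0,1). The unreflected one ends at the symbol tanh composed with A, that is at
  \<open>- kappa A\<close>.\<close>

lemma conjugate_via_Lambda':
  assumes A: "det A = 1"
  shows "conjugate_via Rplus Rplus (Lambda' A) twoK_minus_I (wiener_hopf (\<lambda>x. - kappa A x))"
    and "conjugate_via Rplus Rplus (Lambda'_refl A) twoK_minus_I (wiener_hopf (kappa A))"
proof -
  have R: "Rplus \<in> sets (borel :: real measure)" by simp
  have L: "conjugate_via Rplus {0<..<1} (Lambda 0 1) twoK_minus_I (hilbert_transf 0 1)"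
    using conjugate_via_Lambda[of 0 1] by (simp add: einterval_0_1)
  note G = conjugate_via_inv_into[OF R conjugate_via_Gamma_log]
  note F = conjugate_via_inv_into[OF R conjugate_via_F_op'_tanh(1)[OF A]]
  show "conjugate_via Rplus Rplus (Lambda' A) twoK_minus_I (wiener_hopf (\<lambda>x. - kappa A x))"
    unfolding Lambda'_def comp_assoc
    by (rule conjugate_via_comp[OF conjugate_via_comp[OF L G] F])
  note L' = conjugate_via_comp[OF L conjugate_via_reflect01]
  \<comment> \<open>After the reflection the operator on (0,1) carries a minus sign; it is kept
    through the logarithmic change of variable and finally absorbed in the symbol by
    \<open>wiener_hopf_uminus\<close>.\<close>
  note G' = conjugate_via_inv_into[OF R conjugate_via_neg[OF R conjugate_via_Gamma_log]]
  have F': "conjugate_via Rplus Rplus (inv_into (L2 Rplus) (F_op' A)) (\<lambda>u. L2_scale Rplus (-1) (wiener_hopf tanhc u)) (wiener_hopf (kappa A))"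
    by (rule conjugate_via_cong[OF conjugate_via_inv_into[OF R conjugate_via_F_op'_tanh(2)[OF A]] _ refl])
      (rule wiener_hopf_uminus[OF _ tanhc_multiplier, symmetric])
  show "conjugate_via Rplus Rplus (Lambda'_refl A) twoK_minus_I (wiener_hopf (kappa A))"
    unfolding Lambda'_refl_def comp_assoc
    by (rule conjugate_via_comp[OF conjugate_via_comp[OF L' G'] F'])
qed

theorem mainTheorem10:
  shows
    "(\<forall>a b :: ereal. a < b \<and> \<not> (a = -\<infinity> \<and> b = \<infinity>) \<longrightarrow>
        hilbert_isomorphic Rplus (einterval a b) twoK_minus_I (hilbert_transf a b)) \<and>
     (\<forall>A :: real^2^2. det A = 1 \<longrightarrow>
        hilbert_isomorphic Rplus Rplus twoK_minus_I (wiener_hopf (kappa A))) \<and>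
     (\<forall>a b :: ereal. a < b \<and> \<not> (a = -\<infinity> \<and> b = \<infinity>) \<longrightarrow>
        hilbert_iso Rplus (einterval a b) (Gamma_ab a b) \<and>
        conjugate_via Rplus (einterval a b) (Lambda a b) twoK_minus_I (hilbert_transf a b)) \<and>
     (\<forall>A :: real^2^2. det A = 1 \<longrightarrow>
        hilbert_iso Rplus Rplus (F_op' A) \<and>
        hilbert_iso Rplus {0<..<1} Gamma_log \<and>
        conjugate_via Rplus Rplus (Lambda' A) twoK_minus_I (wiener_hopf (\<lambda>x. - kappa A x)) \<and>
        conjugate_via Rplus Rplus (Lambda'_refl A) twoK_minus_I (wiener_hopf (kappa A)))"
proof (intro conjI allI impI)
  fix a b :: ereal assume ab: "a < b \<and> \<not> (a = -\<infinity> \<and> b = \<infinity>)"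
  note L = conjugate_via_Lambda[OF conjunct1[OF ab] conjunct2[OF ab]]
  show "hilbert_isomorphic Rplus (einterval a b) twoK_minus_I (hilbert_transf a b)"
    unfolding hilbert_isomorphic_def by (rule exI[of _ "Lambda a b"]) (rule L)
  show "conjugate_via Rplus (einterval a b) (Lambda a b) twoK_minus_I (hilbert_transf a b)"
    by (rule L)
  show "hilbert_iso Rplus (einterval a b) (Gamma_ab a b)"
    by (rule conjugate_viaD(1)[OF conjugate_via_Gamma_ab[OF conjunct1[OF ab] conjunct2[OF ab]]])
next
  fix A :: "real^2^2" assume A: "det A = 1"
  \<comment> \<open>The witness is the reflected map, since the unreflected one belongs to
    \<open>- kappa A\<close>.\<close>
  show "hilbert_isomorphic Rplus Rplus twoK_minus_I (wiener_hopf (kappa A))"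
    unfolding hilbert_isomorphic_def
    by (rule exI[of _ "Lambda'_refl A"]) (rule conjugate_via_Lambda'(2)[OF A])
qed (simp_all only: hilbert_iso_F_op' hilbert_iso_Gamma_log conjugate_via_Lambda')

end
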